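(* Let $0<s<1$, let $N\ge 1$ be an integer with $N>2s$, and let $1<p<\frac{N+2s}{N-2s}$. Assume that $V:\mathbb{R}^N\to\mathbb{R}$ satisfies $\|V\|_{C^2(\mathbb{R}^N)}<\infty$ and $\inf_{\mathbb{R}^N}V>0$. Let $x_0\in\mathbb{R}^N$ and let $u_\varepsilon\in H^s$ be a sequence (with parameters $\varepsilon>0$, $\varepsilon\to0$) of positive solutions of $$\varepsilon^{2s}(-\Delta)^s u_\varepsilon+V(x)u_\varepsilon-u_\varepsilon^p=0\quad\text{in }\mathbb{R}^N$$ that strongly concentrates at $x_0$. Then $\nabla V(x_0)=0$.
   Context: All function spaces are on $\mathbb{R}^N$ and functions are real valued. $\widehat u$ denotes the Fourier transform $\widehat u(\xi)=(2\pi)^{-N/2}\int_{\mathbb{R}^N}e^{-i\xi\cdot x}u(x)\,dx$. $H^s=\{u\in L^2:\int_{\mathbb{R}^N}|\xi|^{2s}|\widehat u|^2d\xi<\infty\}$. The operator $(-\Delta)^s$ is defined by $\widehat{(-\Delta)^s\varphi}(\xi)=|\xi|^{2s}\widehat\varphi(\xi)$. A function $u_\varepsilon\in H^s$ is a (weak) solution of the equation if $$\varepsilon^{2s}\int_{\mathbb{R}^N}|\xi|^{2s}\,\widehat{u_\varepsilon}(\xi)\,\overline{\widehat\varphi(\xi)}\,d\xi=\int_{\mathbb{R}^N}\big(u_\varepsilon^p(x)-V(x)u_\varepsilon(x)\big)\varphi(x)\,dx\quad\text{for all }\varphi\in H^s.$$ Solutions are identified with their continuous representatives, so pointwise values make sense.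 Strong concentration: the sequence $u_\varepsilon$ strongly concentrates at $x_0$ if for every $\delta>0$ there exist $\varepsilon_0>0$ and $R>0$ such that, for every parameter $\varepsilon\in(0,\varepsilon_0)$ of the sequence, $u_\varepsilon(x)\le\delta$ for all $x\in\mathbb{R}^N\setminus B(x_0,\varepsilon R)$, where $B(x_0,r)$ is the ball of centre $x_0$ and radius $r$. *)

theory Defs
  imports "HOL-Analysis.Analysis"
begin

text \<open>
  Elements of \<open>L\<^sup>2\<close> and \<open>H\<^sup>s\<close> are represented by Borel measurable functions; every class modulo
  null sets has such a representative.
\<close>

definition L2 :: "(real ^ 'n \<Rightarrow> 'b::{banach, second_countable_topology}) set"
  where "L2 = {f \<in> borel_measurable borel. integrable lborel (\<lambda>x. (norm (f x))\<^sup>2)}"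

definition fourier_integral :: "(real ^ 'n \<Rightarrow> real) \<Rightarrow> real ^ 'n \<Rightarrow> complex"
  where "fourier_integral u \<xi> =
    complex_of_real ((2 * pi) powr (- real CARD('n) / 2)) *
    (LINT x|lborel. cis (- (\<xi> \<bullet> x)) * complex_of_real (u x))"

text \<open>
  For \<open>u \<in> L\<^sup>2\<close> the Fourier integral need not converge absolutely, so the transform is taken in
  the sense of Plancherel: it is the \<open>L\<^sup>2\<close> limit of the transforms of the truncations of \<open>u\<close> to
  balls. That limit exists for every \<open>u \<in> L\<^sup>2\<close>, is unique up to null sets, and agrees almost
  everywhere with the integral when \<open>u\<close> is also integrable. The choice of a representative in
  \<open>fourier\<close> is immaterial because it is only used under integrals.
\<close>

definition is_fourier_L2 :: "(real ^ 'n \<Rightarrow> real) \<Rightarrow> (real ^ 'n \<Rightarrow> complex) \<Rightarrow> bool"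
  where "is_fourier_L2 u g \<longleftrightarrow> g \<in> L2 \<and>
    ((\<lambda>R. \<integral>\<^sup>+ \<xi>. ennreal ((cmod (g \<xi> -
        fourier_integral (\<lambda>x. indicator (ball 0 R) x * u x) \<xi>))\<^sup>2) \<partial>lborel) \<longlongrightarrow> 0) at_top"

definition fourier :: "(real ^ 'n \<Rightarrow> real) \<Rightarrow> real ^ 'n \<Rightarrow> complex"
  where "fourier u = (SOME g. is_fourier_L2 u g)"

definition Hs :: "real \<Rightarrow> (real ^ 'n \<Rightarrow> real) set"
  where "Hs s = {u \<in> L2. integrable lborel (\<lambda>\<xi>. norm \<xi> powr (2 * s) * (cmod (fourier u \<xi>))\<^sup>2)}"

definition weak_solution ::
  "real \<Rightarrow> real \<Rightarrow> (real ^ 'n \<Rightarrow> real) \<Rightarrow> real \<Rightarrow> (real ^ 'n \<Rightarrow> real) \<Rightarrow> bool"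
  where "weak_solution s p V \<epsilon> u \<longleftrightarrow> u \<in> Hs s \<and>
    (\<forall>\<phi>\<in>Hs s.
      complex_of_real (\<epsilon> powr (2 * s)) *
        (LINT \<xi>|lborel. complex_of_real (norm \<xi> powr (2 * s)) * fourier u \<xi> * cnj (fourier \<phi> \<xi>))
      = complex_of_real (LINT x|lborel. (u x powr p - V x * u x) * \<phi> x))"

definition strongly_concentrates ::
  "(nat \<Rightarrow> real) \<Rightarrow> (nat \<Rightarrow> real ^ 'n \<Rightarrow> real) \<Rightarrow> real ^ 'n \<Rightarrow> bool"
  where "strongly_concentrates \<epsilon> u x0 \<longleftrightarrow>
    (\<forall>\<delta>>0. \<exists>\<epsilon>0>0. \<exists>R>0. \<forall>k. \<epsilon> k \<in> {0<..<\<epsilon>0} \<longrightarrow>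
      (\<forall>x \<in> - ball x0 (\<epsilon> k * R). u k x \<le> \<delta>))"

text \<open>
  \<open>C\<^sup>2\<close> functions with finite \<open>C\<^sup>2\<close> norm; \<open>G\<close> is the gradient and \<open>H\<close> the Hessian matrix.
\<close>

definition finite_C2_norm :: "(real ^ 'n \<Rightarrow> real) \<Rightarrow> bool"
  where "finite_C2_norm V \<longleftrightarrow>
    (\<exists>(G :: real ^ 'n \<Rightarrow> real ^ 'n) (H :: real ^ 'n \<Rightarrow> real ^ 'n ^ 'n).
      (\<forall>x. GDERIV V x :> G x) \<and>
      (\<forall>x. (G has_derivative (\<lambda>h. H x *v h)) (at x)) \<and>
      continuous_on UNIV H \<and>
      bounded (range V) \<and> bounded (range G) \<and> bounded (range H))"

end

theory Submission
  imports Defs "HOL-Probability.Probability"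
begin

text \<open>
  The proof has two halves. First, every bounded positive solution satisfies
  \<open>\<integral> (\<partial>\<^sub>e V) u\<^sup>2 = 0\<close> for each direction \<open>e\<close>. Testing the equation with \<open>u(\<cdot> + y) - u(\<cdot> - y)\<close>
  kills the nonlocal term exactly, since \<open>\<bar>fourier u\<bar>\<^sup>2\<close> is paired with an odd function. The power term
  is antisymmetric up to an exact difference and a remainder quadratic in \<open>u(\<cdot> + y) - u\<close>, and
  \<open>\<parallel>u(\<cdot> + y) - u\<parallel>\<^sup>2 = O(\<bar>y\<bar>\<^sup>2)\<close>, so dividing by \<open>\<bar>y\<bar>\<close> leaves only the derivative of \<open>V\<close>.

  Second, the mass of \<open>u\<^sub>\<epsilon>\<close> outside a fixed ball around \<open>x\<^sub>0\<close> is \<open>O(\<epsilon>\<^bsup>2s\<^esup>) \<parallel>u\<^sub>\<epsilon>\<parallel>\<^sup>2\<close>. Indeed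
  \<open>V - u\<^bsup>p-1\<^esup> \<ge> inf V / 2\<close> there by strong concentration, and testing with \<open>\<rho>\<^sup>2 u\<close> for a Lipschitz
  cutoff \<open>\<rho>\<close> the nonlocal form is bounded below by \<open>- C \<parallel>u\<parallel>\<^sup>2\<close>, because
  \<open>(u - u')(\<rho>\<^sup>2 u - \<rho>'\<^sup>2 u') \<ge> - u u' (\<rho> - \<rho>')\<^sup>2\<close>. If \<open>\<nabla>V(x\<^sub>0) \<noteq> 0\<close>, taking \<open>e = \<nabla>V(x\<^sub>0)\<close> makes the
  integral of the first half positive for small \<open>\<epsilon>\<close>.
\<close>

section \<open>Gaussians\<close>

text \<open>Membership in \<open>Hs s\<close> gives no derivative of the solution, so the
  translation identity is written with a finite shift and only \<open>V\<close> is ever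
  differentiated. In the first half the solution stays fixed while the shift tends to zero, so the
  sup bound \<open>M\<close> and all constants may depend on it. In the second half the constant
  must be chosen before \<epsilon> and \<open>u\<close>; this is why the outer mass is measured
  against the square norm of the same solution. Boundedness of a single solution comes from
  concentration away from a ball and continuity on its closure.

  \<open>fourier\<close> is an arbitrary choice among the L2 limits of truncated transforms, so
  existence, Plancherel, uniqueness and the translation rule have to be established for it.
  Continuous representatives help here: their truncations are discontinuous on a sphere at most.

  The weak form lives on the frequency side, whereas the cutoff inequality compares values at two
  points of space. The passage is the representation of the symbol through \<open>1 - cos\<close>.
  Its constant is never computed; only that it is positive and finite matters.\<close>

lemma lborel_integral_prod_Basis:
  fixes f :: "'a::euclidean_space \<Rightarrow> real \<Rightarrow> complex"
  assumes f: "\<And>b. b \<in> Basis \<Longrightarrow> integrable lborel (f b)"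
  shows "integrable lborel (\<lambda>x::'a. \<Prod>b\<in>Basis. f b (x \<bullet> b))"
    and "(LINT x|lborel. (\<Prod>b\<in>Basis. f b ((x::'a) \<bullet> b))) = (\<Prod>b\<in>Basis. LINT t|lborel. f b t)"
proof -
  interpret product_sigma_finite "\<lambda>_::'a. lborel :: real measure" ..
  have [measurable]: "f b \<in> borel_measurable borel" if "b \<in> Basis" for b
    using borel_measurable_integrable[OF f[OF that]] by simp
  have meas: "(\<lambda>x::'a. \<Prod>b\<in>Basis. f b (x \<bullet> b)) \<in> borel_measurable borel"
    by measurable
  have coord: "(\<Prod>b\<in>Basis. f b ((\<Sum>c\<in>Basis. x c *\<^sub>R c) \<bullet> b)) = (\<Prod>b\<in>Basis. f b (x b))" for x :: "'a \<Rightarrow> real"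
    by (intro prod.cong) auto
  have meas': "(\<lambda>g. \<Sum>b\<in>Basis. g b *\<^sub>R (b::'a)) \<in> measurable (\<Pi>\<^sub>M b\<in>Basis. lborel) borel"
    by measurable
  have "integrable (\<Pi>\<^sub>M b\<in>Basis. lborel) (\<lambda>x. \<Prod>b\<in>(Basis::'a set). f b (x b))"
    by (intro product_integrable_prod f) auto
  then show "integrable lborel (\<lambda>x::'a. \<Prod>b\<in>Basis. f b (x \<bullet> b))"
    by (subst lborel_eq, subst integrable_distr_eq[OF meas']) (auto simp: coord meas)
  show "(LINT x|lborel. (\<Prod>b\<in>Basis. f b ((x::'a) \<bullet> b))) = (\<Prod>b\<in>Basis. LINT t|lborel. f b t)"
    apply (subst lborel_eq, subst integral_distr[OF meas' meas])
    apply (simp add: coord)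
    by (intro product_integral_prod f) auto
qed

text \<open>The product form makes the Fourier transform factorise into one-dimensional ones. The
  density has total mass one: it serves as an approximate identity for Plancherel and later as the
  distribution of the jump \<open>levy_jump\<close> at fixed scale.\<close>

definition gauss :: "'a::euclidean_space \<Rightarrow> real"
  where "gauss x = (\<Prod>b\<in>Basis. std_normal_density (x \<bullet> b))"

lemma norm_power2_eq_sum: "(norm (x::'a::euclidean_space))\<^sup>2 = (\<Sum>b\<in>Basis. (x \<bullet> b)\<^sup>2)"
  unfolding power2_norm_eq_inner by (subst euclidean_inner) (simp add: power2_eq_square)

lemma gauss_eq_exp:
  "gauss (x::'a::euclidean_space) = (2 * pi) powr (- real DIM('a) / 2) * exp (- (norm x)\<^sup>2 / 2)"
proof -
  have "(1 / sqrt (2 * pi)) ^ DIM('a) = (2 * pi) powr (- real DIM('a) / 2)"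
    by (simp add: powr_half_sqrt[symmetric] powr_minus_divide powr_powr powr_realpow[symmetric] power_one_over)
  moreover have "(\<Prod>b\<in>Basis. exp (- (x \<bullet> b)\<^sup>2 / 2)) = exp (- (norm x)\<^sup>2 / 2)"
    by (simp add: norm_power2_eq_sum sum_negf flip: exp_sum sum_divide_distrib)
  ultimately show ?thesis
    by (simp only: gauss_def std_normal_density_def prod.distrib prod_constant)
qed

lemma gauss_nonneg [simp]: "0 \<le> gauss x"
  by (simp add: gauss_eq_exp)

lemma gauss_minus [simp]: "gauss (- x) = gauss x"
  by (simp add: gauss_eq_exp)

lemma borel_measurable_gauss [measurable]: "gauss \<in> borel_measurable borel"
  unfolding gauss_eq_exp[abs_def] by measurable

text \<open>Both \<open>cis\<close> and \<open>gauss\<close> split into products over the basis, and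
  each one-dimensional factor is the known characteristic function of the standard normal
  distribution.\<close>

lemma char_gauss:
  fixes \<xi> :: "'a::euclidean_space"
  shows "integrable lborel (\<lambda>x. cis (\<xi> \<bullet> x) * complex_of_real (gauss x))"
    and "(LINT x|lborel. cis (\<xi> \<bullet> x) * complex_of_real (gauss x)) = complex_of_real (exp (- (norm \<xi>)\<^sup>2 / 2))"
proof -
  let ?f = "\<lambda>b t. cis ((\<xi> \<bullet> b) * t) * complex_of_real (std_normal_density t)"
  have fact: "cis (\<xi> \<bullet> x) * complex_of_real (gauss x) = (\<Prod>b\<in>Basis. ?f b (x \<bullet> b))" for x
  proof -
    have "cis (\<xi> \<bullet> x) = (\<Prod>b\<in>Basis. cis ((\<xi> \<bullet> b) * (x \<bullet> b)))"
      by (simp add: cis_conv_exp exp_sum[symmetric] euclidean_inner[of \<xi> x] sum_distrib_left)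
    then show ?thesis
      by (simp add: gauss_def prod.distrib)
  qed
  have int: "integrable lborel (?f b)" for b
  proof (rule Bochner_Integration.integrable_bound)
    show "integrable lborel std_normal_density"
      by simp
    show "?f b \<in> borel_measurable lborel"
      unfolding cis_conv_exp by measurable
  qed (auto simp: norm_mult)
  have val: "(LINT t|lborel. ?f b t) = complex_of_real (exp (- (\<xi> \<bullet> b)\<^sup>2 / 2))" for b
  proof -
    have "(LINT t|lborel. ?f b t) = char std_normal_distribution (\<xi> \<bullet> b)"
      unfolding char_def
      by (subst integral_density) (auto simp: normal_density_nonneg cis_conv_exp scaleR_conv_of_real mult_ac)
    then show ?thesis
      by (simp add: char_std_normal_distribution)
  qed
  show "integrable lborel (\<lambda>x. cis (\<xi> \<bullet> x) * complex_of_real (gauss x))"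
    unfolding fact by (rule lborel_integral_prod_Basis(1)) (rule int)
  have "(\<Sum>b\<in>Basis. - (\<xi> \<bullet> b)\<^sup>2 / 2) = - (norm \<xi>)\<^sup>2 / 2"
    by (simp add: norm_power2_eq_sum sum_negf flip: sum_divide_distrib)
  then show "(LINT x|lborel. cis (\<xi> \<bullet> x) * complex_of_real (gauss x)) = complex_of_real (exp (- (norm \<xi>)\<^sup>2 / 2))"
    unfolding fact
    apply (subst lborel_integral_prod_Basis(2)) 
     apply (rule int)
    by (simp only: val of_real_prod[symmetric] exp_sum[symmetric] finite_Basis)
qed

lemma integrable_gauss [simp]: "integrable lborel (gauss :: 'a::euclidean_space \<Rightarrow> real)"
  using char_gauss(1)[of "0::'a"] by (simp only: inner_zero_left cis_zero mult_1 complex_of_real_integrable_eq)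

lemma integral_gauss [simp]: "(LINT x|lborel. gauss (x::'a::euclidean_space)) = 1"
proof -
  have "complex_of_real (LINT x|lborel. gauss (x::'a)) = complex_of_real 1"
    using char_gauss(2)[of "0::'a"] by simp
  then show ?thesis
    using of_real_eq_iff by blast
qed

section \<open>Affine changes of variables and Fubini for bounded kernels\<close>

lemma lborel_integral_affine:
  fixes f :: "'a::euclidean_space \<Rightarrow> 'b::{banach, second_countable_topology}"
  assumes "c > 0" and [measurable]: "f \<in> borel_measurable borel"
  shows "(LINT x|lborel. f x) = c ^ DIM('a) *\<^sub>R (LINT x|lborel. f (t + c *\<^sub>R x))"
proof -
  have "(LINT x|lborel. f x) = (LINT x|density (distr lborel borel (\<lambda>x. t + c *\<^sub>R x)) (\<lambda>_. ennreal (c ^ DIM('a))). f x)"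
    using lborel_affine[of c t] assms(1) by (simp add: ennreal_power)
  also have "\<dots> = c ^ DIM('a) *\<^sub>R (LINT x|lborel. f (t + c *\<^sub>R x))"
    using assms(1) by (simp add: integral_density integral_distr)
  finally show ?thesis .
qed

lemma lborel_integrable_affine:
  fixes f :: "'a::euclidean_space \<Rightarrow> 'b::{banach, second_countable_topology}"
  assumes "c > 0" and f: "integrable lborel f"
  shows "integrable lborel (\<lambda>x. f (t + c *\<^sub>R x))"
proof -
  have [measurable]: "f \<in> borel_measurable borel"
    using borel_measurable_integrable[OF f] by simp
  have "integrable (density (distr lborel borel (\<lambda>x. t + c *\<^sub>R x)) (\<lambda>_. ennreal (c ^ DIM('a)))) f"
    using lborel_affine[of c t] assms by (simp add: ennreal_power)
  then show ?thesis
    using assms(1) integrable_scaleR_right[of "inverse (c ^ DIM('a))" lborel "\<lambda>x. c ^ DIM('a) *\<^sub>R f (t + c *\<^sub>R x)"]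
    by (simp add: integrable_density integrable_distr_eq)
qed

lemma nn_integral_lborel_translate:
  fixes f :: "'a::euclidean_space \<Rightarrow> ennreal"
  assumes [measurable]: "f \<in> borel_measurable borel"
  shows "(\<integral>\<^sup>+x. f (x + t) \<partial>lborel) = (\<integral>\<^sup>+x. f x \<partial>lborel)"
proof -
  have "(\<integral>\<^sup>+x. f x \<partial>lborel) = (\<integral>\<^sup>+x. f x \<partial>distr lborel borel ((+) t))"
    by (simp add: lborel_distr_plus)
  then show ?thesis
    by (simp add: nn_integral_distr add.commute)
qed

text \<open>A bounded kernel leaves a multiple of \<open>cmod (a x) * cmod (b y)\<close> as an
  integrable majorant on the product space. The kernels of interest are the characters
  \<open>cis\<close>, of modulus one.\<close>

lemma integral_swap_bounded_kernel:
  fixes a b :: "'a::euclidean_space \<Rightarrow> complex" and k :: "'a \<Rightarrow> 'a \<Rightarrow> complex"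
  assumes a: "integrable lborel a" and b: "integrable lborel b"
    and [measurable]: "case_prod k \<in> borel_measurable (borel \<Otimes>\<^sub>M borel)"
    and k: "\<And>x y. cmod (k x y) \<le> C"
  shows "(LINT x|lborel. a x * (LINT y|lborel. k x y * b y)) = (LINT y|lborel. b y * (LINT x|lborel. k x y * a x))"
proof -
  have [measurable]: "a \<in> borel_measurable borel" "b \<in> borel_measurable borel"
    using a b borel_measurable_integrable by force+
  have kb: "integrable lborel (\<lambda>y. k x y * b y)" for x
    by (rule Bochner_Integration.integrable_bound[of _ "\<lambda>y. C * cmod (b y)"])
       (use b k in \<open>auto simp: norm_mult intro!: mult_right_mono order_trans[OF _ abs_ge_self]\<close>)
  have nkb: "(LINT y|lborel. cmod (k x y * b y)) \<le> (LINT y|lborel. C * cmod (b y))" for x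
  proof (rule integral_mono)
    show "integrable lborel (\<lambda>y. cmod (k x y * b y))"
      using kb by (rule integrable_norm)
    show "integrable lborel (\<lambda>y. C * cmod (b y))"
      using b by simp
  qed (simp add: norm_mult k mult_right_mono)
  have int: "integrable (lborel \<Otimes>\<^sub>M lborel) (\<lambda>(x, y). a x * (k x y * b y))"
  proof (rule lborel_pair.Fubini_integrable)
    show "(\<lambda>(x, y). a x * (k x y * b y)) \<in> borel_measurable (lborel \<Otimes>\<^sub>M lborel)" by measurable
    show "integrable lborel (\<lambda>x. LINT y|lborel. cmod (case (x, y) of (x, y) \<Rightarrow> a x * (k x y * b y)))"
    proof (rule Bochner_Integration.integrable_bound)
      show "integrable lborel (\<lambda>x. cmod (a x) * (LINT y|lborel. C * cmod (b y)))"
        using a by auto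
      have "norm (LINT y|lborel. cmod (a x * (k x y * b y))) \<le> norm (cmod (a x) * (LINT y|lborel. C * cmod (b y)))" for x
      proof -
        have "norm (LINT y|lborel. cmod (a x * (k x y * b y))) = cmod (a x) * (LINT y|lborel. cmod (k x y * b y))"
          by (simp only: norm_mult[of "a x"] integral_mult_right_zero) (simp add: integral_nonneg_AE)
        also have "\<dots> \<le> cmod (a x) * (LINT y|lborel. C * cmod (b y))"
          by (intro mult_left_mono nkb) simp
        finally show ?thesis by (rule order_trans) simp
      qed
      then show "AE x in lborel. norm (LINT y|lborel. cmod (case (x, y) of (x, y) \<Rightarrow> a x * (k x y * b y)))
        \<le> norm (cmod (a x) * (LINT y|lborel. C * cmod (b y)))"
        by simp
    qed measurable
    show "AE x in lborel. integrable lborel (\<lambda>y. case (x, y) of (x, y) \<Rightarrow> a x * (k x y * b y))"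
      using kb by auto
  qed
  have "(LINT x|lborel. a x * (LINT y|lborel. k x y * b y)) = (LINT x|lborel. LINT y|lborel. a x * (k x y * b y))"
    by simp
  also have "\<dots> = (LINT y|lborel. LINT x|lborel. a x * (k x y * b y))"
    using lborel_pair.Fubini_integral[OF int] by simp
  also have "\<dots> = (LINT y|lborel. b y * (LINT x|lborel. k x y * a x))"
    by (simp add: mult_ac flip: integral_mult_right_zero)
  finally show ?thesis .
qed

section \<open>Plancherel's identity\<close>

lemma borel_measurable_cis [measurable]: "cis \<in> borel_measurable borel"
  by (intro borel_measurable_continuous_onI continuous_intros)

lemma borel_measurable_fourier_integral [measurable]:
  assumes [measurable]: "v \<in> borel_measurable borel"
  shows "fourier_integral v \<in> borel_measurable borel"
  unfolding fourier_integral_def[abs_def] by measurable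

lemma cmod_fourier_integral_le:
  "cmod (fourier_integral (v :: real ^ 'n \<Rightarrow> real) \<xi>) \<le> (2 * pi) powr (- real CARD('n) / 2) * (LINT x|lborel. \<bar>v x\<bar>)"
proof -
  have "cmod (LINT x|lborel. cis (- (\<xi> \<bullet> x)) * complex_of_real (v x))
      \<le> (LINT x|lborel. cmod (cis (- (\<xi> \<bullet> x)) * complex_of_real (v x)))"
    by (rule integral_norm_bound)
  then show ?thesis
    by (simp add: fourier_integral_def norm_mult mult_left_mono)
qed

lemma integrable_cis_mult:
  fixes v :: "real ^ 'n \<Rightarrow> real"
  assumes "integrable lborel v"
  shows "integrable lborel (\<lambda>x. cis (\<xi> \<bullet> x) * complex_of_real (v x))"
proof (rule Bochner_Integration.integrable_bound[OF assms])
  have [measurable]: "v \<in> borel_measurable borel"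
    using borel_measurable_integrable[OF assms] by simp
  show "(\<lambda>x. cis (\<xi> \<bullet> x) * complex_of_real (v x)) \<in> borel_measurable lborel"
    by measurable
qed (simp add: norm_mult)

text \<open>The constant \<open>(2 * pi) powr (- real DIM('a) / 2)\<close> occurs squared: once to
  turn the exponential into the normalised \<open>gauss\<close>, once to turn the exponential that
  \<open>char_gauss\<close> returns back into \<open>gauss\<close>. The power of \<open>d\<close> is
  the Jacobian.\<close>

lemma char_gauss_scaled:
  fixes \<eta> :: "'a::euclidean_space"
  assumes "d > 0"
  shows "integrable lborel (\<lambda>\<xi>::'a. exp (- (norm (d *\<^sub>R \<xi>))\<^sup>2 / 2))"
    and "(LINT \<xi>|lborel. cis (\<eta> \<bullet> \<xi>) * complex_of_real (exp (- (norm (d *\<^sub>R \<xi>))\<^sup>2 / 2)))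
      = complex_of_real (gauss (\<eta> /\<^sub>R d) / (((2 * pi) powr (- real DIM('a) / 2))\<^sup>2 * d ^ DIM('a)))"
proof -
  define c where "c = (2 * pi) powr (- real DIM('a) / 2)"
  have c: "c > 0" by (simp add: c_def)
  have w: "exp (- (norm (d *\<^sub>R \<xi>))\<^sup>2 / 2) = gauss (d *\<^sub>R \<xi>) / c" for \<xi> :: 'a
    unfolding gauss_eq_exp c_def[symmetric] using c by simp
  show "integrable lborel (\<lambda>\<xi>::'a. exp (- (norm (d *\<^sub>R \<xi>))\<^sup>2 / 2))"
    unfolding w using integrable_mult_left[OF lborel_integrable_affine[OF assms integrable_gauss, of 0], of "1 / c"] by simp
  have "complex_of_real (c * gauss (\<eta> /\<^sub>R d) / c\<^sup>2) = (LINT x|lborel. cis ((\<eta> /\<^sub>R d) \<bullet> x) * complex_of_real (gauss x))"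
    unfolding char_gauss gauss_eq_exp[of "\<eta> /\<^sub>R d"] c_def[symmetric] using c by (simp add: power2_eq_square)
  also have "\<dots> = d ^ DIM('a) *\<^sub>R (LINT x|lborel. cis ((\<eta> /\<^sub>R d) \<bullet> (d *\<^sub>R x)) * complex_of_real (gauss (d *\<^sub>R x)))"
    using lborel_integral_affine[OF assms, of "\<lambda>x. cis ((\<eta> /\<^sub>R d) \<bullet> x) * complex_of_real (gauss x)" 0] by simp
  also have "(LINT x|lborel. cis ((\<eta> /\<^sub>R d) \<bullet> (d *\<^sub>R x)) * complex_of_real (gauss (d *\<^sub>R x)))
     = c * (LINT x|lborel. cis (\<eta> \<bullet> x) * complex_of_real (exp (- (norm (d *\<^sub>R x))\<^sup>2 / 2)))"
    using assms c unfolding w by (simp flip: mult.assoc)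
  finally show "(LINT \<xi>|lborel. cis (\<eta> \<bullet> \<xi>) * complex_of_real (exp (- (norm (d *\<^sub>R \<xi>))\<^sup>2 / 2)))
      = complex_of_real (gauss (\<eta> /\<^sub>R d) / (((2 * pi) powr (- real DIM('a) / 2))\<^sup>2 * d ^ DIM('a)))"
    unfolding c_def[symmetric] using c assms by (simp add: field_simps power2_eq_square scaleR_conv_of_real)
qed

text \<open>The Gaussian weight makes the frequency integral absolutely convergent for merely
  integrable \<open>v\<close>, so Fubini applies to both transforms. The frequency integral then
  collapses to a Gaussian of width \<open>d\<close> in the difference of the space variables, and
  rescaling that difference gives the right-hand side.\<close>

lemma gauss_regularised_plancherel:
  fixes v :: "real ^ 'n \<Rightarrow> real"
  assumes v: "integrable lborel v" and d: "d > 0"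
  shows "(LINT \<xi>|lborel. complex_of_real (exp (- (norm (d *\<^sub>R \<xi>))\<^sup>2 / 2)) * (fourier_integral v \<xi> * cnj (fourier_integral v \<xi>)))
    = complex_of_real (LINT x|lborel. v x * (LINT z|lborel. v (x + d *\<^sub>R z) * gauss z))"
proof -
  define c where "c = (2 * pi) powr (- real CARD('n) / 2)"
  have c: "c > 0" by (simp add: c_def)
  have [measurable]: "v \<in> borel_measurable borel"
    using borel_measurable_integrable[OF v] by simp
  define w where "w \<xi> = complex_of_real (exp (- (norm (d *\<^sub>R \<xi>))\<^sup>2 / 2))" for \<xi> :: "real ^ 'n"
  have [measurable]: "w \<in> borel_measurable borel"
    unfolding w_def[abs_def] by measurable
  have w: "integrable lborel w"
    using char_gauss_scaled(1)[OF d, where 'a = "real ^ 'n"] unfolding w_def complex_of_real_integrable_eq .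
  have F: "fourier_integral v \<xi> = c * (LINT x|lborel. cis (- (\<xi> \<bullet> x)) * complex_of_real (v x))" for \<xi>
    by (simp add: fourier_integral_def c_def)
  have cF: "cnj (fourier_integral v \<xi>) = c * (LINT x|lborel. cis (\<xi> \<bullet> x) * complex_of_real (v x))" for \<xi>
    unfolding F using Bochner_Integration.integral_cnj[of lborel "\<lambda>x. cis (- (\<xi> \<bullet> x)) * complex_of_real (v x)"] by (simp add: cis_cnj)
  have wF: "integrable lborel (\<lambda>\<xi>. w \<xi> * fourier_integral v \<xi>)"
  proof (rule Bochner_Integration.integrable_bound)
    show "integrable lborel (\<lambda>\<xi>. w \<xi> * (c * (LINT x|lborel. \<bar>v x\<bar>)))"
      using w by simp
    show "AE \<xi> in lborel. norm (w \<xi> * fourier_integral v \<xi>) \<le> norm (w \<xi> * (c * (LINT x|lborel. \<bar>v x\<bar>)))"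
      using cmod_fourier_integral_le[of v]
      by (auto intro!: AE_I2 mult_left_mono order_trans[OF _ abs_ge_self] simp: norm_mult c_def simp flip: of_real_mult simp del: of_real_mult)
  qed measurable
  have vc: "integrable lborel (\<lambda>x. complex_of_real (v x))"
    using v by (simp add: complex_of_real_integrable_eq)
  \<comment> \<open>First exchange of integrals. The leftover \<open>1 / c\<close> is one factor
    \<open>c\<close> of the transform against \<open>c\<^sup>2\<close> from the Gaussian; the factor
    \<open>c\<close> of the conjugate transform cancels it below.\<close>
  have inner: "(LINT \<xi>|lborel. cis (\<xi> \<bullet> x) * (w \<xi> * fourier_integral v \<xi>))
     = complex_of_real ((LINT z|lborel. v (x + d *\<^sub>R z) * gauss z) / c)" for x
  proof -
    have cw: "integrable lborel (\<lambda>\<xi>. cis (\<xi> \<bullet> x) * w \<xi>)"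
      by (rule Bochner_Integration.integrable_bound[OF w]) (simp_all add: norm_mult)
    have "(LINT \<xi>|lborel. cis (\<xi> \<bullet> x) * (w \<xi> * fourier_integral v \<xi>))
       = c * (LINT \<xi>|lborel. (cis (\<xi> \<bullet> x) * w \<xi>) * (LINT y|lborel. cis (- (\<xi> \<bullet> y)) * complex_of_real (v y)))"
      unfolding F by (simp flip: integral_mult_right_zero add: mult_ac)
    also have "(LINT \<xi>|lborel. (cis (\<xi> \<bullet> x) * w \<xi>) * (LINT y|lborel. cis (- (\<xi> \<bullet> y)) * complex_of_real (v y)))
       = (LINT y|lborel. complex_of_real (v y) * (LINT \<xi>|lborel. cis (- (\<xi> \<bullet> y)) * (cis (\<xi> \<bullet> x) * w \<xi>)))"
      by (rule integral_swap_bounded_kernel[OF cw vc, where C = 1]) simp_all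
    also have "\<dots> = (LINT y|lborel. complex_of_real (v y * gauss ((y - x) /\<^sub>R d) / (c\<^sup>2 * d ^ CARD('n))))"
    proof (rule Bochner_Integration.integral_cong[OF refl])
      fix y :: "real ^ 'n"
      have "(LINT \<xi>|lborel. cis (- (\<xi> \<bullet> y)) * (cis (\<xi> \<bullet> x) * w \<xi>)) = (LINT \<xi>|lborel. cis ((x - y) \<bullet> \<xi>) * w \<xi>)"
        by (rule Bochner_Integration.integral_cong[OF refl])
          (simp add: cis_mult inner_diff_left inner_diff_right inner_commute flip: mult.assoc)
      also have "\<dots> = complex_of_real (gauss ((x - y) /\<^sub>R d) / (c\<^sup>2 * d ^ CARD('n)))"
        unfolding w_def char_gauss_scaled(2)[OF d] by (simp add: c_def)
      also have "gauss ((x - y) /\<^sub>R d) = gauss ((y - x) /\<^sub>R d)"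
        using gauss_minus[of "(x - y) /\<^sub>R d"] by (simp add: scaleR_minus_right[symmetric] del: scaleR_minus_right gauss_minus)
      finally show "complex_of_real (v y) * (LINT \<xi>|lborel. cis (- (\<xi> \<bullet> y)) * (cis (\<xi> \<bullet> x) * w \<xi>))
         = complex_of_real (v y * gauss ((y - x) /\<^sub>R d) / (c\<^sup>2 * d ^ CARD('n)))"
        by simp
    qed
    also have "\<dots> = complex_of_real ((LINT y|lborel. v y * gauss ((y - x) /\<^sub>R d)) / (c\<^sup>2 * d ^ CARD('n)))"
      by (simp only: integral_complex_of_real integral_divide_zero)
    also have "(LINT y|lborel. v y * gauss ((y - x) /\<^sub>R d)) = d ^ CARD('n) * (LINT z|lborel. v (x + d *\<^sub>R z) * gauss z)"
      using lborel_integral_affine[OF d, of "\<lambda>y. v y * gauss ((y - x) /\<^sub>R d)" x] d by simp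
    finally show ?thesis
      using d c by (simp add: power2_eq_square field_simps)
  qed
  have "(LINT \<xi>|lborel. w \<xi> * (fourier_integral v \<xi> * cnj (fourier_integral v \<xi>)))
     = c * (LINT \<xi>|lborel. (w \<xi> * fourier_integral v \<xi>) * (LINT x|lborel. cis (\<xi> \<bullet> x) * complex_of_real (v x)))"
    unfolding cF by (simp flip: integral_mult_right_zero add: mult_ac)
  also have "\<dots> = c * (LINT x|lborel. complex_of_real (v x) * (LINT \<xi>|lborel. cis (\<xi> \<bullet> x) * (w \<xi> * fourier_integral v \<xi>)))"
    by (subst integral_swap_bounded_kernel[OF wF vc, where C = 1]) simp_all
  also have "\<dots> = c * (LINT x|lborel. complex_of_real (v x * (LINT z|lborel. v (x + d *\<^sub>R z) * gauss z) / c))"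
    unfolding inner by simp
  also have "\<dots> = complex_of_real (LINT x|lborel. v x * (LINT z|lborel. v (x + d *\<^sub>R z) * gauss z))"
    using c by (simp only: integral_complex_of_real integral_divide_zero) simp
  finally show ?thesis
    unfolding w_def .
qed

text \<open>
  For this class of functions the Gaussian regularisation converges by dominated convergence
  alone, so no density argument is needed; it contains the truncations of continuous functions.
\<close>

definition tame :: "('a::euclidean_space \<Rightarrow> real) set"
  where "tame = {v. integrable lborel v \<and> bounded (range v) \<and> (AE x in lborel. isCont v x)}"

text \<open>The damping is removed along \<open>d n\<close> decreasing to zero. On the frequency
  side the weights increase to one, so monotone convergence applies without knowing that the
  transform is square integrable. On the space side the Gaussian averages converge at every
  continuity point, and boundedness and integrability of \<open>v\<close> provide the
  majorants.\<close>

lemma plancherel_tame: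
  fixes v :: "real ^ 'n \<Rightarrow> real"
  assumes "v \<in> tame"
  shows "(\<integral>\<^sup>+\<xi>. ennreal ((cmod (fourier_integral v \<xi>))\<^sup>2) \<partial>lborel) = (\<integral>\<^sup>+x. ennreal ((v x)\<^sup>2) \<partial>lborel)"
proof -
  have v: "integrable lborel v" and cont: "AE x in lborel. isCont v x"
    using assms by (auto simp: tame_def)
  obtain M where M: "\<bar>v x\<bar> \<le> M" for x
    using assms by (auto simp: tame_def bounded_iff)
  have M0: "0 \<le> M" using M[of 0] by linarith
  have [measurable]: "v \<in> borel_measurable borel"
    using borel_measurable_integrable[OF v] by simp
  define d where "d n = 1 / real (Suc n)" for n
  have d: "d n > 0" for n by (simp add: d_def)
  have d0: "d \<longlonglongrightarrow> 0"
    unfolding d_def by real_asymp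
  define F where "F = fourier_integral v"
  have [measurable]: "F \<in> borel_measurable borel"
    unfolding F_def by measurable
  define I where "I n = (LINT x|lborel. v x * (LINT z|lborel. v (x + d n *\<^sub>R z) * gauss z))" for n
  have lim1: "(\<lambda>n. \<integral>\<^sup>+\<xi>. ennreal (exp (- (norm (d n *\<^sub>R \<xi>))\<^sup>2 / 2) * (cmod (F \<xi>))\<^sup>2) \<partial>lborel)
      \<longlonglongrightarrow> (\<integral>\<^sup>+\<xi>. ennreal ((cmod (F \<xi>))\<^sup>2) \<partial>lborel)"
  proof (rule nn_integral_LIMSEQ)
    have "d n \<le> d m" if "m \<le> n" for m n
      using that by (simp add: d_def frac_le)
    then have "(norm (d n *\<^sub>R \<xi>))\<^sup>2 \<le> (norm (d m *\<^sub>R \<xi>))\<^sup>2" if "m \<le> n" for m n and \<xi> :: "real ^ 'n"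
      using that d[of n] d[of m] by (intro power_mono) (auto intro!: mult_right_mono)
    then show "incseq (\<lambda>n \<xi>. ennreal (exp (- (norm (d n *\<^sub>R \<xi>))\<^sup>2 / 2) * (cmod (F \<xi>))\<^sup>2))"
      by (auto simp: incseq_def le_fun_def intro!: ennreal_leI mult_right_mono)
    fix \<xi> :: "real ^ 'n"
    have "(\<lambda>n. exp (- (norm (d n *\<^sub>R \<xi>))\<^sup>2 / 2) * (cmod (F \<xi>))\<^sup>2) \<longlonglongrightarrow> exp (- (norm (0 *\<^sub>R \<xi>))\<^sup>2 / 2) * (cmod (F \<xi>))\<^sup>2"
      by (intro tendsto_intros d0) auto
    then show "(\<lambda>n. ennreal (exp (- (norm (d n *\<^sub>R \<xi>))\<^sup>2 / 2) * (cmod (F \<xi>))\<^sup>2)) \<longlonglongrightarrow> ennreal ((cmod (F \<xi>))\<^sup>2)"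
      by (intro tendsto_ennrealI) simp
  qed measurable
  have eq: "(\<integral>\<^sup>+\<xi>. ennreal (exp (- (norm (d n *\<^sub>R \<xi>))\<^sup>2 / 2) * (cmod (F \<xi>))\<^sup>2) \<partial>lborel) = ennreal (I n)" for n
  proof -
    have int: "integrable lborel (\<lambda>\<xi>. exp (- (norm (d n *\<^sub>R \<xi>))\<^sup>2 / 2) * (cmod (F \<xi>))\<^sup>2)"
    proof (rule Bochner_Integration.integrable_bound)
      define L where "L = ((2 * pi) powr (- real CARD('n) / 2) * (LINT x|lborel. \<bar>v x\<bar>))\<^sup>2"
      have "(cmod (F \<xi>))\<^sup>2 \<le> L" for \<xi>
        unfolding F_def L_def by (intro power_mono cmod_fourier_integral_le) simp
      then show "AE \<xi> in lborel. norm (exp (- (norm (d n *\<^sub>R \<xi>))\<^sup>2 / 2) * (cmod (F \<xi>))\<^sup>2)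
         \<le> norm (exp (- (norm (d n *\<^sub>R \<xi>))\<^sup>2 / 2) * L)"
        by (auto intro!: AE_I2 mult_left_mono order_trans[OF _ abs_ge_self] simp: abs_mult)
      show "integrable lborel (\<lambda>\<xi>::real ^ 'n. exp (- (norm (d n *\<^sub>R \<xi>))\<^sup>2 / 2) * L)"
        using char_gauss_scaled(1)[OF d[of n], where 'a = "real ^ 'n"] by (rule integrable_mult_left)
    qed measurable
    have "complex_of_real (LINT \<xi>|lborel. exp (- (norm (d n *\<^sub>R \<xi>))\<^sup>2 / 2) * (cmod (F \<xi>))\<^sup>2) = complex_of_real (I n)"
      unfolding I_def gauss_regularised_plancherel[OF v d, symmetric] F_def
      by (simp only: complex_norm_square[symmetric] of_real_mult[symmetric] integral_complex_of_real)
    then have "(LINT \<xi>|lborel. exp (- (norm (d n *\<^sub>R \<xi>))\<^sup>2 / 2) * (cmod (F \<xi>))\<^sup>2) = I n"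
      by (simp only: of_real_eq_iff)
    then show ?thesis
      using nn_integral_eq_integral[OF int] by simp
  qed
  have int_vg: "integrable lborel (\<lambda>z. v (x + d n *\<^sub>R z) * gauss z)" for x n
    by (rule Bochner_Integration.integrable_bound[of _ "\<lambda>z. M * gauss z"])
      (use M M0 in \<open>auto simp: abs_mult intro!: mult_right_mono\<close>)
  have "I \<longlonglongrightarrow> (LINT x|lborel. v x * v x)"
    unfolding I_def
  proof (rule integral_dominated_convergence[where w = "\<lambda>x. M * \<bar>v x\<bar>"])
    show "AE x in lborel. (\<lambda>n. v x * (LINT z|lborel. v (x + d n *\<^sub>R z) * gauss z)) \<longlonglongrightarrow> v x * v x"
      using cont
    proof eventually_elim
      case (elim x)
      have "(\<lambda>n. LINT z|lborel. v (x + d n *\<^sub>R z) * gauss z) \<longlonglongrightarrow> (LINT z|lborel. v x * gauss (z :: real ^ 'n))"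
      proof (rule integral_dominated_convergence[where w = "\<lambda>z. M * gauss z"])
        have "(\<lambda>n. v (x + d n *\<^sub>R z) * gauss z) \<longlonglongrightarrow> v x * gauss z" for z
        proof -
          have "(\<lambda>n. x + d n *\<^sub>R z) \<longlonglongrightarrow> x + 0 *\<^sub>R z"
            by (intro tendsto_intros d0)
          then show ?thesis
            using isCont_tendsto_compose[OF elim] by (intro tendsto_mult_right) auto
        qed
        then show "AE z in lborel. (\<lambda>n. v (x + d n *\<^sub>R z) * gauss z) \<longlonglongrightarrow> v x * gauss z"
          by simp
      qed (use M in \<open>auto simp: abs_mult intro!: mult_right_mono\<close>)
      then show ?case
        by (intro tendsto_mult_left) simp
    qed
    fix n
    have "\<bar>LINT z|lborel. v (x + d n *\<^sub>R z) * gauss z\<bar> \<le> M" for x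
    proof -
      have "\<bar>LINT z|lborel. v (x + d n *\<^sub>R z) * gauss z\<bar> \<le> (LINT z|lborel. M * gauss (z :: real ^ 'n))"
      proof (rule integral_abs_bound[THEN order_trans], rule integral_mono)
        show "integrable lborel (\<lambda>z. \<bar>v (x + d n *\<^sub>R z) * gauss z\<bar>)"
          using int_vg by (rule integrable_abs)
      qed (use M in \<open>auto simp: abs_mult intro!: mult_right_mono\<close>)
      then show ?thesis by simp
    qed
    then show "AE x in lborel. norm (v x * (LINT z|lborel. v (x + d n *\<^sub>R z) * gauss z)) \<le> M * \<bar>v x\<bar>"
      by (auto simp: abs_mult mult.commute[of M] intro!: mult_left_mono)
  qed (use v in auto)
  then have lim2: "(\<lambda>n. ennreal (I n)) \<longlonglongrightarrow> ennreal (LINT x|lborel. v x * v x)"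
    by (rule tendsto_ennrealI)
  have *: "v x * v x \<le> M * \<bar>v x\<bar>" for x
    using mult_right_mono[OF M abs_ge_zero, of x "v x"] by simp
  have "integrable lborel (\<lambda>x. v x * v x)"
    by (rule Bochner_Integration.integrable_bound[of _ "\<lambda>x. M * \<bar>v x\<bar>"])
      (use v M0 * in \<open>auto simp: abs_mult\<close>)
  then have "(\<integral>\<^sup>+x. ennreal ((v x)\<^sup>2) \<partial>lborel) = ennreal (LINT x|lborel. v x * v x)"
    by (simp add: nn_integral_eq_integral power2_eq_square)
  with LIMSEQ_unique[OF lim1[unfolded eq] lim2] show ?thesis
    by (simp add: F_def)
qed

lemma integrable_indicator_ball [simp]:
  "integrable lborel (indicator (ball (c::'a::euclidean_space) R) :: 'a \<Rightarrow> real)"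
  using emeasure_lborel_ball_finite[of c R] by (intro integrable_real_indicator) auto

text \<open>The only possible discontinuities lie on the bounding sphere, a null set. An arbitrary
  centre is allowed because translating a truncation moves its ball.\<close>

lemma tame_truncation:
  fixes u :: "'a::euclidean_space \<Rightarrow> real"
  assumes u: "continuous_on UNIV u"
  shows "(\<lambda>x. indicator (ball c R) x * u x) \<in> tame"
proof -
  have [measurable]: "u \<in> borel_measurable borel"
    using u by (rule borel_measurable_continuous_onI)
  have "compact (u ` cball c R)"
    using u by (intro compact_continuous_image) (auto intro: continuous_on_subset)
  then have "bounded (u ` cball c R)"
    by (rule compact_imp_bounded)
  then obtain M where M: "\<And>x. x \<in> cball c R \<Longrightarrow> \<bar>u x\<bar> \<le> M"
    unfolding bounded_iff real_norm_def by blast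
  have bound: "\<bar>indicator (ball c R) x * u x\<bar> \<le> \<bar>M\<bar> * indicator (ball c R) x" for x
    using M[of x] by (auto simp: indicator_def)
  have "integrable lborel (\<lambda>x. indicator (ball c R) x * u x)"
  proof (rule Bochner_Integration.integrable_bound)
    show "integrable lborel (\<lambda>x. \<bar>M\<bar> * indicator (ball c R) x)"
      by (intro integrable_mult_right integrable_indicator_ball)
  qed (use bound in \<open>auto intro!: borel_measurable_times borel_measurable_indicator\<close>)
  moreover have "bounded (range (\<lambda>x. indicator (ball c R) x * u x))"
  proof (rule boundedI[of _ "\<bar>M\<bar>"], clarify)
    fix x
    show "norm (indicator (ball c R) x * u x) \<le> \<bar>M\<bar>"
      using bound[of x] by (auto simp: indicator_def split: if_splits)
  qed
  moreover have "AE x in lborel. isCont (\<lambda>x. indicator (ball c R) x * u x) x"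
  proof -
    have "sphere c R \<in> null_sets lborel"
      using negligible_sphere[of c R] by (auto simp: null_sets_completion_iff negligible_iff_null_sets)
    then have "AE x in lborel. x \<notin> sphere c R"
      by (rule AE_not_in)
    then show ?thesis
    proof eventually_elim
      case (elim x)
      have cu: "isCont u x"
        using u by (simp add: continuous_on_eq_continuous_at)
      consider "x \<in> ball c R" | "x \<in> - cball c R"
        using elim by fastforce
      then show ?case
      proof cases
        case 1
        then have "eventually (\<lambda>y. indicator (ball c R) y * u y = u y) (nhds x)"
          by (intro eventually_nhds[THEN iffD2] exI[of _ "ball c R"]) auto
        from isCont_cong[OF this] cu show ?thesis by simp
      next
        case 2
        then have "eventually (\<lambda>y. indicator (ball c R) y * u y = 0) (nhds x)"
          by (intro eventually_nhds[THEN iffD2] exI[of _ "- cball c R"]) (auto simp: indicator_def)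
        from isCont_cong[OF this] show ?thesis by simp
      qed
    qed
  qed
  ultimately show ?thesis
    by (simp add: tame_def)
qed

lemma tame_diff:
  assumes "v \<in> tame" "w \<in> tame"
  shows "(\<lambda>x. v x - w x) \<in> tame"
proof -
  have "AE x in lborel. isCont (\<lambda>x. v x - w x) x"
    using assms by (auto simp: tame_def elim: AE_mp intro: AE_I2)
  moreover have "bounded (range (\<lambda>x. v x - w x))"
    using assms by (intro bounded_minus_comp) (auto simp: tame_def)
  ultimately show ?thesis
    using assms by (auto simp: tame_def)
qed

section \<open>Linearity and translation of the Fourier integral\<close>

lemma fourier_integral_lincomb:
  assumes "integrable lborel v" "integrable lborel w"
  shows "fourier_integral (\<lambda>x. a * v x + b * w x) \<xi> = a * fourier_integral v \<xi> + b * fourier_integral w \<xi>"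
proof -
  have int: "integrable lborel (\<lambda>x. cis (- (\<xi> \<bullet> x)) * complex_of_real (v x))"
    "integrable lborel (\<lambda>x. cis (- (\<xi> \<bullet> x)) * complex_of_real (w x))"
    using assms[THEN integrable_cis_mult, of "- \<xi>"] by simp_all
  have "(LINT x|lborel. cis (- (\<xi> \<bullet> x)) * complex_of_real (a * v x + b * w x))
     = (LINT x|lborel. a * (cis (- (\<xi> \<bullet> x)) * complex_of_real (v x)) + b * (cis (- (\<xi> \<bullet> x)) * complex_of_real (w x)))"
    by (intro Bochner_Integration.integral_cong) (auto simp: algebra_simps)
  also have "\<dots> = a * (LINT x|lborel. cis (- (\<xi> \<bullet> x)) * complex_of_real (v x))
      + b * (LINT x|lborel. cis (- (\<xi> \<bullet> x)) * complex_of_real (w x))"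
    by (subst Bochner_Integration.integral_add) (auto intro!: integrable_mult_right int)
  finally show ?thesis
    by (simp add: fourier_integral_def algebra_simps)
qed

lemma fourier_integral_translate:
  fixes v :: "real ^ 'n \<Rightarrow> real"
  assumes [measurable]: "v \<in> borel_measurable borel"
  shows "fourier_integral (\<lambda>x. v (x + y)) \<xi> = cis (y \<bullet> \<xi>) * fourier_integral v \<xi>"
proof -
  have "(LINT x|lborel. cis (- (\<xi> \<bullet> x)) * complex_of_real (v (x + y)))
     = (LINT x|lborel. cis (- (\<xi> \<bullet> (x - y))) * complex_of_real (v x))"
    using lborel_integral_affine[of 1 "\<lambda>x. cis (- (\<xi> \<bullet> x)) * complex_of_real (v (x + y))" "- y"] by simp
  also have "\<dots> = (LINT x|lborel. cis (y \<bullet> \<xi>) * (cis (- (\<xi> \<bullet> x)) * complex_of_real (v x)))"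
    by (intro Bochner_Integration.integral_cong)
      (auto simp: cis_mult inner_diff_right inner_commute simp flip: mult.assoc)
  finally show ?thesis
    by (simp add: fourier_integral_def)
qed

text \<open>Weighted Young inequality. Small \<theta> brings the factor of the first term close to
  one, which is what the exact Plancherel identity for L2 limits requires; elsewhere \<theta> is
  1.\<close>

lemma cmod_add_power2_le:
  assumes "\<theta> > 0"
  shows "(cmod (a + b))\<^sup>2 \<le> (1 + \<theta>) * (cmod a)\<^sup>2 + (1 + 1 / \<theta>) * (cmod b)\<^sup>2"
proof -
  have "(cmod (a + b))\<^sup>2 \<le> (cmod a + cmod b)\<^sup>2"
    by (intro power_mono norm_triangle_ineq) simp
  also have "\<dots> \<le> (1 + \<theta>) * (cmod a)\<^sup>2 + (1 + 1 / \<theta>) * (cmod b)\<^sup>2"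
  proof -
    have "0 \<le> (\<theta> * cmod a - cmod b)\<^sup>2 / \<theta>"
      using assms by simp
    then show ?thesis
      using assms by (simp add: power2_eq_square field_simps)
  qed
  finally show ?thesis .
qed

lemma nn_integral_cmod_add_power2_le:
  assumes [measurable]: "f \<in> borel_measurable M" "g \<in> borel_measurable M" and "\<theta> > 0"
  shows "(\<integral>\<^sup>+x. ennreal ((cmod (f x + g x))\<^sup>2) \<partial>M)
    \<le> ennreal (1 + \<theta>) * (\<integral>\<^sup>+x. ennreal ((cmod (f x))\<^sup>2) \<partial>M) + ennreal (1 + 1 / \<theta>) * (\<integral>\<^sup>+x. ennreal ((cmod (g x))\<^sup>2) \<partial>M)"
proof -
  have "(\<integral>\<^sup>+x. ennreal ((cmod (f x + g x))\<^sup>2) \<partial>M)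
     \<le> (\<integral>\<^sup>+x. ennreal (1 + \<theta>) * ennreal ((cmod (f x))\<^sup>2) + ennreal (1 + 1 / \<theta>) * ennreal ((cmod (g x))\<^sup>2) \<partial>M)"
    using assms(3) cmod_add_power2_le[OF assms(3)]
    by (intro nn_integral_mono) (simp flip: ennreal_mult ennreal_plus)
  then show ?thesis
    by (simp add: nn_integral_add nn_integral_cmult)
qed

section \<open>Completeness of L2\<close>

lemma ennreal_tendsto_0I:
  fixes f :: "'a \<Rightarrow> ennreal"
  assumes "\<And>e::real. e > 0 \<Longrightarrow> eventually (\<lambda>x. f x \<le> ennreal e) F"
  shows "(f \<longlongrightarrow> 0) F"
proof (rule order_tendstoI)
  fix a :: ennreal assume "0 < a"
  then obtain b where b: "0 < b" "b < a"
    using dense by blast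
  then obtain e where e: "b = ennreal e" "e > 0"
    by (cases b) (auto simp: ennreal_less_top)
  from assms[OF e(2)] show "eventually (\<lambda>x. f x < a) F"
    by eventually_elim (use b e in auto)
qed auto

text \<open>Riesz-Fischer for a family with a real index: a rapidly Cauchy subsequence converges
  almost everywhere, and Fatou along it bounds the distance from every late member to the
  limit.\<close>

lemma L2_complete:
  fixes F :: "real \<Rightarrow> 'a \<Rightarrow> complex"
  assumes [measurable]: "\<And>R. F R \<in> borel_measurable M"
    and cauchy: "\<And>e::real. e > 0 \<Longrightarrow> \<exists>r. \<forall>R\<ge>r. \<forall>S\<ge>r. (\<integral>\<^sup>+x. ennreal ((cmod (F R x - F S x))\<^sup>2) \<partial>M) \<le> ennreal e"
  shows "\<exists>g \<in> borel_measurable M. ((\<lambda>R. \<integral>\<^sup>+x. ennreal ((cmod (g x - F R x))\<^sup>2) \<partial>M) \<longlongrightarrow> 0) at_top"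
proof -
  \<comment> \<open>The rate \<open>(1/8)^n\<close> leaves the summable \<open>(1/4)^n\<close> after
    the weight \<open>2^n\<close>. The weight is what converts square summability into summability
    of the increments themselves.\<close>
  have "\<exists>r. \<forall>n. \<forall>R\<ge>r n. \<forall>S\<ge>r n. (\<integral>\<^sup>+x. ennreal ((cmod (F R x - F S x))\<^sup>2) \<partial>M) \<le> ennreal ((1/8)^n)"
    by (rule choice) (simp add: cauchy)
  then obtain r where r: "\<And>n R S. R \<ge> r n \<Longrightarrow> S \<ge> r n \<Longrightarrow> (\<integral>\<^sup>+x. ennreal ((cmod (F R x - F S x))\<^sup>2) \<partial>M) \<le> ennreal ((1/8)^n)"
    by blast
  \<comment> \<open>The sum makes both \<open>s n\<close> and \<open>s (Suc n)\<close> exceed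
    \<open>r n\<close>, although \<open>r\<close> need not be monotone; the summand
    \<open>real n\<close> forces \<open>s\<close> to infinity.\<close>
  define s where "s n = (\<Sum>i\<le>n. \<bar>r i\<bar>) + real n" for n
  have s_ge: "r n \<le> s n" "r n \<le> s (Suc n)" "real n \<le> s n" for n
  proof -
    have "\<bar>r n\<bar> \<le> (\<Sum>i\<le>n. \<bar>r i\<bar>)"
      by (rule member_le_sum) auto
    then show "r n \<le> s n" "r n \<le> s (Suc n)"
      by (auto simp: s_def)
    show "real n \<le> s n"
      by (simp add: s_def sum_nonneg)
  qed
  define f where "f n = F (s n)" for n
  have [measurable]: "f n \<in> borel_measurable M" for n
    by (simp add: f_def)
  define D where "D n x = cmod (f (Suc n) x - f n x)" for n x
  have [measurable]: "D n \<in> borel_measurable M" for n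
    unfolding D_def[abs_def] by measurable
  have "(\<integral>\<^sup>+x. (\<Sum>n. ennreal (2^n * (D n x)\<^sup>2)) \<partial>M) = (\<Sum>n. \<integral>\<^sup>+x. ennreal (2^n * (D n x)\<^sup>2) \<partial>M)"
    by (rule nn_integral_suminf) measurable
  also have "\<dots> \<le> (\<Sum>n. ennreal ((1/4)^n))"
  proof (rule suminf_le)
    fix n
    have "(\<integral>\<^sup>+x. ennreal (2^n * (D n x)\<^sup>2) \<partial>M) = ennreal (2^n) * (\<integral>\<^sup>+x. ennreal ((D n x)\<^sup>2) \<partial>M)"
      by (subst nn_integral_cmult[symmetric]) (auto simp: ennreal_mult)
    also have "\<dots> \<le> ennreal (2^n) * ennreal ((1/8)^n)"
      unfolding D_def f_def by (intro mult_left_mono r s_ge) auto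
    also have "\<dots> = ennreal ((1/4)^n)"
      by (simp add: ennreal_mult[symmetric] power_mult_distrib[symmetric] del: power_mult_distrib)
    finally show "(\<integral>\<^sup>+x. ennreal (2^n * (D n x)\<^sup>2) \<partial>M) \<le> ennreal ((1/4)^n)" .
  qed auto
  also have "\<dots> = ennreal (\<Sum>n. (1/4)^n)"
    by (intro suminf_ennreal2 summable_geometric) auto
  also have "\<dots> < \<infinity>"
    by simp
  finally have "AE x in M. (\<Sum>n. ennreal (2^n * (D n x)\<^sup>2)) \<noteq> \<infinity>"
    by (intro nn_integral_PInf_AE) auto
  then have conv: "AE x in M. convergent (\<lambda>n. f n x)"
  proof eventually_elim
    case (elim x)
    have "summable (\<lambda>n. 2^n * (D n x)\<^sup>2)"
      using elim by (intro summable_suminf_not_top) auto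
    moreover have "summable (\<lambda>n. (1/2)^n :: real)"
      by (intro summable_geometric) auto
    ultimately have "summable (\<lambda>n. 2^n * (D n x)\<^sup>2 + (1/2)^n)"
      by (rule summable_add)
    \<comment> \<open>Arithmetic-geometric mean inequality, from the nonnegative square of
      \<open>2^n * D n x - 1\<close>.\<close>
    moreover have "D n x \<le> 2^n * (D n x)\<^sup>2 + (1/2)^n" for n
    proof -
      have "0 \<le> (2^n * D n x - 1)\<^sup>2 / 2^n" by simp
      also have "\<dots> = 2^n * (D n x)\<^sup>2 - 2 * D n x + (1/2)^n"
        by (simp add: power2_eq_square field_simps power_one_over)
      finally have "2 * D n x \<le> 2^n * (D n x)\<^sup>2 + (1/2)^n" by linarith
      moreover have "0 \<le> D n x" by (simp add: D_def)
      ultimately show ?thesis by linarith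
    qed
    ultimately have "summable (\<lambda>n. f (Suc n) x - f n x)"
      by (intro summable_comparison_test[of "\<lambda>n. f (Suc n) x - f n x"]) (auto simp: D_def)
    then have "convergent (\<lambda>n. \<Sum>i<n. f (Suc i) x - f i x)"
      by (simp add: summable_iff_convergent)
    then have "convergent (\<lambda>n. f n x - f 0 x)"
      unfolding sum_lessThan_telescope[of "\<lambda>n. f n x"] .
    from convergent_add[OF this convergent_const[of "f 0 x"]] show ?case by simp
  qed
  define g where "g x = lim (\<lambda>n. f n x)" for x
  have g [measurable]: "g \<in> borel_measurable M"
    unfolding g_def[abs_def] by measurable
  have lim: "AE x in M. (\<lambda>n. f n x) \<longlonglongrightarrow> g x"
    using conv by eventually_elim (simp add: g_def convergent_LIMSEQ_iff)
  have "((\<lambda>R. \<integral>\<^sup>+x. ennreal ((cmod (g x - F R x))\<^sup>2) \<partial>M) \<longlongrightarrow> 0) at_top"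
  proof (rule ennreal_tendsto_0I)
    fix e :: real assume "e > 0"
    then obtain q where q: "\<And>R S. R \<ge> q \<Longrightarrow> S \<ge> q \<Longrightarrow> (\<integral>\<^sup>+x. ennreal ((cmod (F R x - F S x))\<^sup>2) \<partial>M) \<le> ennreal e"
      using cauchy by blast
    have "(\<integral>\<^sup>+x. ennreal ((cmod (g x - F R x))\<^sup>2) \<partial>M) \<le> ennreal e" if "R \<ge> q" for R
    proof -
      have "(\<integral>\<^sup>+x. ennreal ((cmod (g x - F R x))\<^sup>2) \<partial>M) = (\<integral>\<^sup>+x. liminf (\<lambda>n. ennreal ((cmod (f n x - F R x))\<^sup>2)) \<partial>M)"
      proof (rule nn_integral_cong_AE)
        show "AE x in M. ennreal ((cmod (g x - F R x))\<^sup>2) = liminf (\<lambda>n. ennreal ((cmod (f n x - F R x))\<^sup>2))"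
          using lim
        proof eventually_elim
          case (elim x)
          have "(\<lambda>n. ennreal ((cmod (f n x - F R x))\<^sup>2)) \<longlonglongrightarrow> ennreal ((cmod (g x - F R x))\<^sup>2)"
            by (intro tendsto_ennrealI tendsto_intros elim)
          then show ?case
            by (rule lim_imp_Liminf[OF trivial_limit_sequentially, symmetric])
        qed
      qed
      also have "\<dots> \<le> liminf (\<lambda>n. \<integral>\<^sup>+x. ennreal ((cmod (f n x - F R x))\<^sup>2) \<partial>M)"
        by (rule nn_integral_liminf) measurable
      also have "\<dots> \<le> ennreal e"
      proof (rule Liminf_le)
        have "eventually (\<lambda>n. q \<le> real n) sequentially"
          by real_asymp
        then show "eventually (\<lambda>n. (\<integral>\<^sup>+x. ennreal ((cmod (f n x - F R x))\<^sup>2) \<partial>M) \<le> ennreal e) sequentially"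
        proof eventually_elim
          case (elim n)
          then have "q \<le> s n" using s_ge(3)[of n] by linarith
          then show ?case unfolding f_def using q that by blast
        qed
      qed simp
      finally show ?thesis .
    qed
    then show "eventually (\<lambda>R. (\<integral>\<^sup>+x. ennreal ((cmod (g x - F R x))\<^sup>2) \<partial>M) \<le> ennreal e) at_top"
      by (rule eventually_mono[OF eventually_ge_at_top[of q]])
  qed
  with g show ?thesis by blast
qed

section \<open>The Fourier transform on continuous square-integrable functions\<close>

abbreviation trunc :: "real \<Rightarrow> ('a::euclidean_space \<Rightarrow> real) \<Rightarrow> 'a \<Rightarrow> real"
  where "trunc R u \<equiv> (\<lambda>x. indicator (ball 0 R) x * u x)"

lemma borel_measurable_trunc [measurable]:
  "u \<in> borel_measurable borel \<Longrightarrow> trunc R u \<in> borel_measurable borel"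
  by (intro borel_measurable_times borel_measurable_indicator) auto

section \<open>Square-integrable functions: products, translations, tails\<close>

lemma L2_iff_real: "u \<in> L2 \<longleftrightarrow> u \<in> borel_measurable borel \<and> integrable lborel (\<lambda>x. (u x)\<^sup>2)"
  for u :: "real ^ 'n \<Rightarrow> real"
  by (simp add: L2_def)

lemma L2_measurable: "f \<in> L2 \<Longrightarrow> f \<in> borel_measurable borel"
  by (simp add: L2_def)

lemma L2_nn_integral_finite: "f \<in> L2 \<Longrightarrow> (\<integral>\<^sup>+x. ennreal ((norm (f x))\<^sup>2) \<partial>lborel) < \<infinity>"
  by (auto simp: L2_def integrable_iff_bounded)

lemma L2_I:
  assumes "f \<in> borel_measurable borel" "(\<integral>\<^sup>+x. ennreal ((norm (f x))\<^sup>2) \<partial>lborel) < \<infinity>"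
  shows "f \<in> L2"
  using assms by (auto simp: L2_def integrable_iff_bounded)

lemma L2_mult_integrable:
  fixes f g :: "real ^ 'n \<Rightarrow> real"
  assumes "f \<in> L2" "g \<in> L2"
  shows "integrable lborel (\<lambda>x. f x * g x)"
proof (rule Bochner_Integration.integrable_bound)
  show "integrable lborel (\<lambda>x. (f x)\<^sup>2 + (g x)\<^sup>2)"
    using assms by (simp add: L2_iff_real)
  show "(\<lambda>x. f x * g x) \<in> borel_measurable lborel"
    using assms by (auto simp: L2_iff_real)
  have "\<bar>f x * g x\<bar> \<le> (f x)\<^sup>2 + (g x)\<^sup>2" for x
  proof -
    have "2 * (\<bar>f x\<bar> * \<bar>g x\<bar>) \<le> (f x)\<^sup>2 + (g x)\<^sup>2" "0 \<le> \<bar>f x\<bar> * \<bar>g x\<bar>"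
      using sum_squares_bound[of "\<bar>f x\<bar>" "\<bar>g x\<bar>"] by simp_all
    then show ?thesis
      unfolding abs_mult by linarith
  qed
  then show "AE x in lborel. norm (f x * g x) \<le> norm ((f x)\<^sup>2 + (g x)\<^sup>2)"
    by (intro AE_I2) (simp add: order_trans[OF _ abs_ge_self])
qed

lemma L2_lincomb:
  fixes f g :: "real ^ 'n \<Rightarrow> real"
  assumes "f \<in> L2" "g \<in> L2"
  shows "(\<lambda>x. a * f x + b * g x) \<in> L2"
proof -
  have [measurable]: "f \<in> borel_measurable borel" "g \<in> borel_measurable borel"
    using assms by (auto intro: L2_measurable)
  have "(\<lambda>x. (a * f x + b * g x)\<^sup>2) = (\<lambda>x. a\<^sup>2 * (f x)\<^sup>2 + b\<^sup>2 * (g x)\<^sup>2 + 2 * a * b * (f x * g x))"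
    by (auto simp: power2_eq_square algebra_simps)
  moreover have "integrable lborel (\<lambda>x. a\<^sup>2 * (f x)\<^sup>2 + b\<^sup>2 * (g x)\<^sup>2 + 2 * a * b * (f x * g x))"
    using assms L2_mult_integrable[OF assms] by (auto simp: L2_iff_real)
  ultimately show ?thesis
    by (simp add: L2_iff_real)
qed

lemma L2_bounded_mult:
  fixes f b :: "real ^ 'n \<Rightarrow> real"
  assumes f: "f \<in> L2" and [measurable]: "b \<in> borel_measurable borel" and b: "\<And>x. \<bar>b x\<bar> \<le> C"
  shows "(\<lambda>x. b x * f x) \<in> L2"
proof -
  have [measurable]: "f \<in> borel_measurable borel"
    using f by (rule L2_measurable)
  have "integrable lborel (\<lambda>x. (b x * f x)\<^sup>2)"
  proof (rule Bochner_Integration.integrable_bound)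
    show "integrable lborel (\<lambda>x. C\<^sup>2 * (f x)\<^sup>2)"
      using f by (simp add: L2_iff_real)
    have "(b x)\<^sup>2 \<le> C\<^sup>2" for x
      using b[of x] by (metis abs_ge_zero power2_abs power_mono)
    then show "AE x in lborel. norm ((b x * f x)\<^sup>2) \<le> norm (C\<^sup>2 * (f x)\<^sup>2)"
      by (simp add: power_mult_distrib mult_right_mono)
  qed measurable
  then show ?thesis
    by (simp add: L2_iff_real)
qed

lemma integral_lborel_translate:
  fixes f :: "'a::euclidean_space \<Rightarrow> 'b::{banach, second_countable_topology}"
  assumes "f \<in> borel_measurable borel"
  shows "(LINT x|lborel. f (x + y)) = (LINT x|lborel. f x)"
  using lborel_integral_affine[of 1 f y] assms by (simp add: add.commute)

lemma integrable_lborel_translate: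
  fixes f :: "'a::euclidean_space \<Rightarrow> 'b::{banach, second_countable_topology}"
  assumes "integrable lborel f"
  shows "integrable lborel (\<lambda>x. f (x + y))"
  using lborel_integrable_affine[of 1 f y] assms by (simp add: add.commute)

lemma L2_translate:
  fixes u :: "real ^ 'n \<Rightarrow> real"
  assumes "u \<in> L2"
  shows "(\<lambda>x. u (x + y)) \<in> L2"
proof -
  have [measurable]: "u \<in> borel_measurable borel"
    using assms by (rule L2_measurable)
  show ?thesis
    using integrable_lborel_translate[of "\<lambda>x. (u x)\<^sup>2" y] assms by (simp add: L2_iff_real)
qed

lemma L2_tail:
  fixes u :: "real ^ 'n \<Rightarrow> real"
  assumes u: "u \<in> L2"
  shows "((\<lambda>R. \<integral>\<^sup>+x. ennreal (indicator (- ball 0 R) x * (u x)\<^sup>2) \<partial>lborel) \<longlongrightarrow> 0) at_top"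
proof -
  have [measurable]: "u \<in> borel_measurable borel"
    using u by (rule L2_measurable)
  have int: "integrable lborel (\<lambda>x. (u x)\<^sup>2)"
    using u by (simp add: L2_iff_real)
  have "((\<lambda>R. LINT x|lborel. indicator (- ball 0 R) x * (u x)\<^sup>2) \<longlongrightarrow> (LINT x|(lborel::(real ^ 'n) measure). 0)) at_top"
  proof (rule integral_dominated_convergence_at_top[where w = "\<lambda>x. (u x)\<^sup>2"])
    show "AE x in lborel. ((\<lambda>R. indicator (- ball 0 R) x * (u x)\<^sup>2) \<longlongrightarrow> 0) at_top"
    proof (rule AE_I2)
      fix x :: "real ^ 'n"
      show "((\<lambda>R. indicator (- ball 0 R) x * (u x)\<^sup>2) \<longlongrightarrow> 0) at_top"
        by (rule tendsto_eventually, rule eventually_mono[OF eventually_gt_at_top[of "norm x"]]) simp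
    qed
  qed (use int in \<open>auto simp: indicator_def\<close>)
  moreover have "(\<integral>\<^sup>+x. ennreal (indicator (- ball 0 R) x * (u x)\<^sup>2) \<partial>lborel)
     = ennreal (LINT x|lborel. indicator (- ball 0 R) x * (u x)\<^sup>2)" for R
  proof (rule nn_integral_eq_integral)
    show "integrable lborel (\<lambda>x. indicator (- ball 0 R) x * (u x)\<^sup>2)"
      by (rule Bochner_Integration.integrable_bound[OF int]) (auto simp: indicator_def)
  qed auto
  ultimately show ?thesis
    using tendsto_ennrealI by fastforce
qed

lemma integrable_trunc: "continuous_on UNIV u \<Longrightarrow> integrable lborel (trunc R u)"
  using tame_truncation[of u 0 R] by (simp add: tame_def)

lemma integrable_trunc_L2:
  fixes u :: "real ^ 'n \<Rightarrow> real"
  assumes "u \<in> L2"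
  shows "integrable lborel (trunc R u)"
proof (rule Bochner_Integration.integrable_bound)
  show "integrable lborel (\<lambda>x. indicator (ball 0 R) x + (u x)\<^sup>2)"
    using assms by (intro Bochner_Integration.integrable_add integrable_indicator_ball) (simp add: L2_iff_real)
  have "\<bar>a\<bar> \<le> 1 + a\<^sup>2" for a :: real
    using sum_squares_bound[of "\<bar>a\<bar>" 1] by simp
  then show "AE x in lborel. norm (trunc R u x) \<le> norm (indicator (ball 0 R) x + (u x)\<^sup>2)"
    by (auto simp: indicator_def)
qed (use L2_measurable[OF assms] borel_measurable_trunc in simp)

text \<open>A difference of two truncations is tame, so Plancherel turns the distance of their
  transforms into a tail of \<open>u\<close>. The transforms are therefore Cauchy, and completeness
  supplies the limit.\<close>

lemma fourier_L2_exists: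
  fixes u :: "real ^ 'n \<Rightarrow> real"
  assumes u: "u \<in> L2" and cont: "continuous_on UNIV u"
  shows "\<exists>g. is_fourier_L2 u g"
proof -
  have [measurable]: "u \<in> borel_measurable borel"
    using u by (rule L2_measurable)
  define F where "F R = fourier_integral (trunc R u)" for R
  have [measurable]: "F R \<in> borel_measurable borel" for R
    unfolding F_def by measurable
  have diff: "(\<integral>\<^sup>+\<xi>. ennreal ((cmod (F R \<xi> - F S \<xi>))\<^sup>2) \<partial>lborel)
     \<le> (\<integral>\<^sup>+x. ennreal (indicator (- ball 0 q) x * (u x)\<^sup>2) \<partial>lborel)" if "q \<le> R" "q \<le> S" for R S q
  proof -
    have "F R \<xi> - F S \<xi> = fourier_integral (\<lambda>x. trunc R u x - trunc S u x) \<xi>" for \<xi>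
      using fourier_integral_lincomb[OF integrable_trunc[OF cont, of R] integrable_trunc[OF cont, of S], of 1 "-1" \<xi>]
      by (simp add: F_def)
    then have "(\<integral>\<^sup>+\<xi>. ennreal ((cmod (F R \<xi> - F S \<xi>))\<^sup>2) \<partial>lborel)
       = (\<integral>\<^sup>+x. ennreal ((trunc R u x - trunc S u x)\<^sup>2) \<partial>lborel)"
      using plancherel_tame[OF tame_diff[OF tame_truncation[OF cont] tame_truncation[OF cont]]] by simp
    also have "\<dots> \<le> (\<integral>\<^sup>+x. ennreal (indicator (- ball 0 q) x * (u x)\<^sup>2) \<partial>lborel)"
      using that by (intro nn_integral_mono ennreal_leI) (auto simp: indicator_def)
    finally show ?thesis .
  qed
  obtain g where [measurable]: "g \<in> borel_measurable lborel"
    and lim: "((\<lambda>R. \<integral>\<^sup>+x. ennreal ((cmod (g x - F R x))\<^sup>2) \<partial>lborel) \<longlongrightarrow> 0) at_top"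
  proof -
    have "\<exists>r. \<forall>R\<ge>r. \<forall>S\<ge>r. (\<integral>\<^sup>+x. ennreal ((cmod (F R x - F S x))\<^sup>2) \<partial>lborel) \<le> ennreal e" if "e > 0" for e :: real
    proof -
      have "eventually (\<lambda>R. (\<integral>\<^sup>+x. ennreal (indicator (- ball 0 R) x * (u x)\<^sup>2) \<partial>lborel) < ennreal e) at_top"
        using order_tendstoD(2)[OF L2_tail[OF u], of "ennreal e"] that by simp
      then obtain q where "(\<integral>\<^sup>+x. ennreal (indicator (- ball 0 q) x * (u x)\<^sup>2) \<partial>lborel) < ennreal e"
        by (auto simp: eventually_at_top_linorder)
      then show ?thesis
        using diff[of q] by (meson less_imp_le order_trans)
    qed
    then have "\<exists>g \<in> borel_measurable lborel. ((\<lambda>R. \<integral>\<^sup>+x. ennreal ((cmod (g x - F R x))\<^sup>2) \<partial>lborel) \<longlongrightarrow> 0) at_top"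
      by (intro L2_complete) auto
    then show ?thesis using that by blast
  qed
  have "eventually (\<lambda>R. (\<integral>\<^sup>+x. ennreal ((cmod (g x - F R x))\<^sup>2) \<partial>lborel) < 1) at_top"
    using order_tendstoD(2)[OF lim, of 1] by simp
  then obtain R where R: "(\<integral>\<^sup>+x. ennreal ((cmod (g x - F R x))\<^sup>2) \<partial>lborel) < 1"
    by (auto simp: eventually_at_top_linorder)
  have "(\<integral>\<^sup>+x. ennreal ((cmod (F R x))\<^sup>2) \<partial>lborel) = (\<integral>\<^sup>+x. ennreal ((trunc R u x)\<^sup>2) \<partial>lborel)"
    unfolding F_def by (rule plancherel_tame[OF tame_truncation[OF cont]])
  also have "\<dots> \<le> (\<integral>\<^sup>+x. ennreal ((norm (u x))\<^sup>2) \<partial>lborel)"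
    by (intro nn_integral_mono ennreal_leI) (auto simp: indicator_def)
  finally have FR: "(\<integral>\<^sup>+x. ennreal ((cmod (F R x))\<^sup>2) \<partial>lborel) < \<infinity>"
    using L2_nn_integral_finite[OF u] by (rule le_less_trans)
  have "(\<integral>\<^sup>+x. ennreal ((cmod ((g x - F R x) + F R x))\<^sup>2) \<partial>lborel) \<le>
     ennreal (1 + 1) * (\<integral>\<^sup>+x. ennreal ((cmod (g x - F R x))\<^sup>2) \<partial>lborel)
     + ennreal (1 + 1 / 1) * (\<integral>\<^sup>+x. ennreal ((cmod (F R x))\<^sup>2) \<partial>lborel)"
    by (rule nn_integral_cmod_add_power2_le) auto
  also have "\<dots> < \<infinity>"
    using R FR by (auto simp: ennreal_mult_less_top intro: less_trans)
  finally have "g \<in> L2"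
    by (intro L2_I) simp_all
  with lim show ?thesis
    unfolding is_fourier_L2_def F_def by blast
qed

text \<open>Plancherel holds for each truncation. Young's inequality compares \<open>g\<close> with
  the truncated transform in both directions at the price of a factor \<open>1 + \<theta>\<close>;
  the truncation radius goes to infinity at fixed \<theta>, and \<theta> to zero afterwards.\<close>

lemma is_fourier_L2_plancherel:
  fixes u :: "real ^ 'n \<Rightarrow> real"
  assumes u: "u \<in> L2" and cont: "continuous_on UNIV u" and g: "is_fourier_L2 u g"
  shows "(\<integral>\<^sup>+\<xi>. ennreal ((cmod (g \<xi>))\<^sup>2) \<partial>lborel) = (\<integral>\<^sup>+x. ennreal ((u x)\<^sup>2) \<partial>lborel)" (is "?G = ?U")
proof -
  have [measurable]: "u \<in> borel_measurable borel"
    using u by (rule L2_measurable)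
  have gL2: "g \<in> L2"
    using g by (simp add: is_fourier_L2_def)
  then have [measurable]: "g \<in> borel_measurable borel"
    by (rule L2_measurable)
  define F where "F R = fourier_integral (trunc R u)" for R
  have [measurable]: "F R \<in> borel_measurable borel" for R
    unfolding F_def by measurable
  define b where "b R = (\<integral>\<^sup>+x. ennreal ((cmod (g x - F R x))\<^sup>2) \<partial>lborel)" for R
  have b: "(b \<longlongrightarrow> 0) at_top"
    using g by (simp add: is_fourier_L2_def b_def[abs_def] F_def)
  define a where "a R = (\<integral>\<^sup>+x. ennreal ((cmod (F R x))\<^sup>2) \<partial>lborel)" for R
  have a_eq: "a R = (\<integral>\<^sup>+x. ennreal ((trunc R u x)\<^sup>2) \<partial>lborel)" for R
    unfolding a_def F_def by (rule plancherel_tame[OF tame_truncation[OF cont]])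
  have a_le: "a R \<le> ?U" for R
    unfolding a_eq by (intro nn_integral_mono ennreal_leI) (auto simp: indicator_def)
  have a_ge: "?U \<le> a R + (\<integral>\<^sup>+x. ennreal (indicator (- ball 0 R) x * (u x)\<^sup>2) \<partial>lborel)" for R
    unfolding a_eq by (subst nn_integral_add[symmetric]) (auto intro!: nn_integral_mono simp: indicator_def)
  obtain U where U: "?U = ennreal U" "0 \<le> U"
    using L2_nn_integral_finite[OF u] by (cases ?U) auto
  obtain G where G: "?G = ennreal G" "0 \<le> G"
    using L2_nn_integral_finite[OF gL2] by (cases ?G) auto
  have GU: "G \<le> (1 + \<theta>) * U" if "\<theta> > 0" for \<theta> :: real
  proof -
    have "?G \<le> ennreal (1 + \<theta>) * ?U + ennreal (1 + 1 / \<theta>) * b R" for R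
    proof -
      have "?G = (\<integral>\<^sup>+\<xi>. ennreal ((cmod (F R \<xi> + (g \<xi> - F R \<xi>)))\<^sup>2) \<partial>lborel)"
        by simp
      also have "\<dots> \<le> ennreal (1 + \<theta>) * a R + ennreal (1 + 1 / \<theta>) * b R"
        unfolding a_def b_def by (rule nn_integral_cmod_add_power2_le) (use that in auto)
      also have "\<dots> \<le> ennreal (1 + \<theta>) * ?U + ennreal (1 + 1 / \<theta>) * b R"
        by (intro add_mono mult_left_mono a_le) auto
      finally show ?thesis .
    qed
    moreover have "((\<lambda>R. ennreal (1 + \<theta>) * ?U + ennreal (1 + 1 / \<theta>) * b R) \<longlongrightarrow> ennreal (1 + \<theta>) * ?U + ennreal (1 + 1 / \<theta>) * 0) at_top"
      by (intro tendsto_add tendsto_const ennreal_tendsto_cmult b) auto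
    ultimately have "?G \<le> ennreal (1 + \<theta>) * ?U"
      using tendsto_lowerbound[of _ _ at_top ?G] by force
    then have "ennreal G \<le> ennreal ((1 + \<theta>) * U)"
      unfolding G(1) U(1) using that U(2) by (subst ennreal_mult) auto
    then show ?thesis
      using that U(2) by (simp add: ennreal_le_iff)
  qed
  have UG: "U \<le> (1 + \<theta>) * G" if "\<theta> > 0" for \<theta> :: real
  proof -
    let ?t = "\<lambda>R. \<integral>\<^sup>+x. ennreal (indicator (- ball 0 R) x * (u x)\<^sup>2) \<partial>lborel"
    have "?U \<le> ennreal (1 + \<theta>) * ?G + ennreal (1 + 1 / \<theta>) * b R + ?t R" for R
    proof -
      have "a R = (\<integral>\<^sup>+\<xi>. ennreal ((cmod (g \<xi> + (F R \<xi> - g \<xi>)))\<^sup>2) \<partial>lborel)"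
        by (simp add: a_def)
      also have "\<dots> \<le> ennreal (1 + \<theta>) * ?G + ennreal (1 + 1 / \<theta>) * (\<integral>\<^sup>+\<xi>. ennreal ((cmod (F R \<xi> - g \<xi>))\<^sup>2) \<partial>lborel)"
        by (rule nn_integral_cmod_add_power2_le) (use that in auto)
      also have "(\<integral>\<^sup>+\<xi>. ennreal ((cmod (F R \<xi> - g \<xi>))\<^sup>2) \<partial>lborel) = b R"
        by (simp add: b_def norm_minus_commute)
      finally show ?thesis
        using a_ge[of R] by (meson add_right_mono order_trans)
    qed
    moreover have "((\<lambda>R. ennreal (1 + \<theta>) * ?G + ennreal (1 + 1 / \<theta>) * b R + ?t R) \<longlongrightarrow> ennreal (1 + \<theta>) * ?G + ennreal (1 + 1 / \<theta>) * 0 + 0) at_top"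
      by (intro tendsto_add tendsto_const ennreal_tendsto_cmult b L2_tail u) auto
    ultimately have "?U \<le> ennreal (1 + \<theta>) * ?G"
      using tendsto_lowerbound[of _ _ at_top ?U] by force
    then have "ennreal U \<le> ennreal ((1 + \<theta>) * G)"
      unfolding G(1) U(1) using that G(2) by (subst ennreal_mult) auto
    then show ?thesis
      using that G(2) by (simp add: ennreal_le_iff)
  qed
  have lim_le: "x \<le> y" if "\<And>\<theta>. \<theta> > 0 \<Longrightarrow> x \<le> (1 + \<theta>) * y" "0 \<le> y" for x y :: real
  proof (rule field_le_epsilon)
    fix e :: real assume "e > 0"
    \<comment> \<open>The denominator \<open>y + 1\<close> instead of \<open>y\<close> covers the
      case \<open>y = 0\<close>.\<close>
    then have "x \<le> (1 + e / (y + 1)) * y"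
      using that by (intro that(1)) auto
    also have "\<dots> \<le> y + e"
      using \<open>e > 0\<close> that(2) by (simp add: field_simps)
    finally show "x \<le> y + e" .
  qed
  show ?thesis
    using lim_le[OF GU U(2)] lim_le[OF UG G(2)] unfolding G(1) U(1) by simp
qed

text \<open>This makes the arbitrary choice in \<open>fourier\<close> harmless: whatever is verified
  to be a transform of \<open>u\<close> agrees with \<open>fourier u\<close> almost
  everywhere.\<close>

lemma is_fourier_L2_unique:
  fixes u :: "real ^ 'n \<Rightarrow> real"
  assumes [measurable]: "u \<in> borel_measurable borel" and g: "is_fourier_L2 u g" and h: "is_fourier_L2 u h"
  shows "AE \<xi> in lborel. g \<xi> = h \<xi>"
proof -
  have [measurable]: "g \<in> borel_measurable borel" "h \<in> borel_measurable borel"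
    using g h by (auto simp: is_fourier_L2_def intro: L2_measurable)
  define F where "F R = fourier_integral (trunc R u)" for R
  have [measurable]: "F R \<in> borel_measurable borel" for R
    unfolding F_def by measurable
  define b where "b f R = (\<integral>\<^sup>+x. ennreal ((cmod (f x - F R x))\<^sup>2) \<partial>lborel)" for f R
  have b: "(b g \<longlongrightarrow> 0) at_top" "(b h \<longlongrightarrow> 0) at_top"
    using g h by (simp_all add: is_fourier_L2_def b_def[abs_def] F_def)
  let ?D = "\<integral>\<^sup>+\<xi>. ennreal ((cmod (g \<xi> - h \<xi>))\<^sup>2) \<partial>lborel"
  have "?D \<le> ennreal (1 + 1) * b g R + ennreal (1 + 1 / 1) * b h R" for R
  proof -
    have "?D = (\<integral>\<^sup>+\<xi>. ennreal ((cmod ((g \<xi> - F R \<xi>) + (F R \<xi> - h \<xi>)))\<^sup>2) \<partial>lborel)"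
      by simp
    also have "\<dots> \<le> ennreal (1 + 1) * b g R + ennreal (1 + 1 / 1) * (\<integral>\<^sup>+\<xi>. ennreal ((cmod (F R \<xi> - h \<xi>))\<^sup>2) \<partial>lborel)"
      unfolding b_def by (rule nn_integral_cmod_add_power2_le) auto
    also have "(\<integral>\<^sup>+\<xi>. ennreal ((cmod (F R \<xi> - h \<xi>))\<^sup>2) \<partial>lborel) = b h R"
      by (simp add: b_def norm_minus_commute)
    finally show ?thesis .
  qed
  moreover have "((\<lambda>R. ennreal (1 + 1) * b g R + ennreal (1 + 1 / 1) * b h R) \<longlongrightarrow> ennreal (1 + 1) * 0 + ennreal (1 + 1 / 1) * 0) at_top"
    by (intro tendsto_add ennreal_tendsto_cmult b) auto
  ultimately have "?D \<le> 0"
    using tendsto_lowerbound[of _ _ at_top ?D] by force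
  then have "AE \<xi> in lborel. ennreal ((cmod (g \<xi> - h \<xi>))\<^sup>2) = 0"
    by (subst nn_integral_0_iff_AE[symmetric]) auto
  then show ?thesis
    by eventually_elim simp
qed

lemma is_fourier_L2_lincomb:
  fixes u v :: "real ^ 'n \<Rightarrow> real"
  assumes u: "u \<in> L2" "is_fourier_L2 u g" and v: "v \<in> L2" "is_fourier_L2 v h"
  shows "is_fourier_L2 (\<lambda>x. a * u x + b * v x) (\<lambda>\<xi>. a * g \<xi> + b * h \<xi>)"
proof -
  have [measurable]: "u \<in> borel_measurable borel" "v \<in> borel_measurable borel"
    using u v by (auto intro: L2_measurable)
  have L2: "g \<in> L2" "h \<in> L2"
    using u v by (auto simp: is_fourier_L2_def)
  then have [measurable]: "g \<in> borel_measurable borel" "h \<in> borel_measurable borel"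
    by (auto intro: L2_measurable)
  have split: "(\<integral>\<^sup>+\<xi>. ennreal ((cmod (a * f \<xi> + b * k \<xi>))\<^sup>2) \<partial>lborel) \<le>
     ennreal (2 * a\<^sup>2) * (\<integral>\<^sup>+\<xi>. ennreal ((cmod (f \<xi>))\<^sup>2) \<partial>lborel) + ennreal (2 * b\<^sup>2) * (\<integral>\<^sup>+\<xi>. ennreal ((cmod (k \<xi>))\<^sup>2) \<partial>lborel)"
    if [measurable]: "f \<in> borel_measurable borel" "k \<in> borel_measurable borel" for f k :: "real ^ 'n \<Rightarrow> complex"
  proof -
    have "(\<integral>\<^sup>+\<xi>. ennreal ((cmod (a * f \<xi> + b * k \<xi>))\<^sup>2) \<partial>lborel) \<le>
     ennreal (1 + 1) * (\<integral>\<^sup>+\<xi>. ennreal ((cmod (a * f \<xi>))\<^sup>2) \<partial>lborel) + ennreal (1 + 1 / 1) * (\<integral>\<^sup>+\<xi>. ennreal ((cmod (b * k \<xi>))\<^sup>2) \<partial>lborel)"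
      by (rule nn_integral_cmod_add_power2_le) auto
    also have "\<dots> = ennreal (2 * a\<^sup>2) * (\<integral>\<^sup>+\<xi>. ennreal ((cmod (f \<xi>))\<^sup>2) \<partial>lborel) + ennreal (2 * b\<^sup>2) * (\<integral>\<^sup>+\<xi>. ennreal ((cmod (k \<xi>))\<^sup>2) \<partial>lborel)"
      by (simp add: norm_mult power_mult_distrib ennreal_mult nn_integral_cmult mult.assoc)
    finally show ?thesis .
  qed
  define F where "F w R = fourier_integral (trunc R w)" for w :: "real ^ 'n \<Rightarrow> real" and R
  have [measurable]: "F w R \<in> borel_measurable borel" if "w \<in> borel_measurable borel" for w R
    using that unfolding F_def by measurable
  have F: "F (\<lambda>x. a * u x + b * v x) R \<xi> = a * F u R \<xi> + b * F v R \<xi>" for R \<xi>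
    using fourier_integral_lincomb[OF integrable_trunc_L2[OF u(1), of R] integrable_trunc_L2[OF v(1), of R], of a b \<xi>]
    by (simp add: F_def algebra_simps)
  define B where "B w f R = (\<integral>\<^sup>+\<xi>. ennreal ((cmod (f \<xi> - F w R \<xi>))\<^sup>2) \<partial>lborel)" for w f R
  have B: "(B u g \<longlongrightarrow> 0) at_top" "(B v h \<longlongrightarrow> 0) at_top"
    using u v by (simp_all add: is_fourier_L2_def B_def[abs_def] F_def)
  have "((\<lambda>R. ennreal (2 * a\<^sup>2) * B u g R + ennreal (2 * b\<^sup>2) * B v h R) \<longlongrightarrow> ennreal (2 * a\<^sup>2) * 0 + ennreal (2 * b\<^sup>2) * 0) at_top"
    by (intro tendsto_add ennreal_tendsto_cmult B) auto
  then have lim0: "((\<lambda>R. ennreal (2 * a\<^sup>2) * B u g R + ennreal (2 * b\<^sup>2) * B v h R) \<longlongrightarrow> 0) at_top"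
    by simp
  have "B (\<lambda>x. a * u x + b * v x) (\<lambda>\<xi>. a * g \<xi> + b * h \<xi>) R \<le> ennreal (2 * a\<^sup>2) * B u g R + ennreal (2 * b\<^sup>2) * B v h R" for R
    using split[of "\<lambda>\<xi>. g \<xi> - F u R \<xi>" "\<lambda>\<xi>. h \<xi> - F v R \<xi>"]
    by (simp add: B_def F algebra_simps)
  then have "(B (\<lambda>x. a * u x + b * v x) (\<lambda>\<xi>. a * g \<xi> + b * h \<xi>) \<longlongrightarrow> 0) at_top"
    by (intro tendsto_sandwich[OF _ _ tendsto_const lim0] always_eventually allI) auto
  moreover have "(\<integral>\<^sup>+\<xi>. ennreal ((cmod (a * g \<xi> + b * h \<xi>))\<^sup>2) \<partial>lborel) < \<infinity>"
    using split[of g h] L2[THEN L2_nn_integral_finite]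
    by (auto simp: ennreal_mult_less_top intro: le_less_trans)
  ultimately show ?thesis
    unfolding is_fourier_L2_def B_def[abs_def] F_def by (auto intro!: L2_I)
qed

text \<open>Translating a truncation and truncating a translate use balls with different centres.
  The two functions agree wherever \<open>x + y\<close> lies within \<open>R - norm y\<close> of the
  origin, so by Plancherel their transforms differ by at most a tail of \<open>u\<close>.\<close>

lemma is_fourier_L2_translate:
  fixes u :: "real ^ 'n \<Rightarrow> real"
  assumes u: "u \<in> L2" and cont: "continuous_on UNIV u" and g: "is_fourier_L2 u g"
  shows "is_fourier_L2 (\<lambda>x. u (x + y)) (\<lambda>\<xi>. cis (y \<bullet> \<xi>) * g \<xi>)"
proof -
  have [measurable]: "u \<in> borel_measurable borel"
    using u by (rule L2_measurable)
  have gL2: "g \<in> L2"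
    using g by (simp add: is_fourier_L2_def)
  then have [measurable]: "g \<in> borel_measurable borel"
    by (rule L2_measurable)
  define F where "F R = fourier_integral (trunc R u)" for R
  define F' where "F' R = fourier_integral (trunc R (\<lambda>x. u (x + y)))" for R
  have [measurable]: "F R \<in> borel_measurable borel" "F' R \<in> borel_measurable borel" for R
    unfolding F_def F'_def by measurable
  define b where "b R = (\<integral>\<^sup>+x. ennreal ((cmod (g x - F R x))\<^sup>2) \<partial>lborel)" for R
  have b: "(b \<longlongrightarrow> 0) at_top"
    using g by (simp add: is_fourier_L2_def b_def[abs_def] F_def)
  let ?t = "\<lambda>R. \<integral>\<^sup>+x. ennreal (indicator (- ball 0 R) x * (u x)\<^sup>2) \<partial>lborel"
  have cont': "continuous_on UNIV (\<lambda>x. u (x + y))"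
    by (rule continuous_on_compose2[OF cont]) (auto intro!: continuous_intros)
  have diff: "(\<integral>\<^sup>+\<xi>. ennreal ((cmod (cis (y \<bullet> \<xi>) * F R \<xi> - F' R \<xi>))\<^sup>2) \<partial>lborel) \<le> ?t (R - norm y)" for R
  proof -
    let ?w = "\<lambda>x. indicator (ball (- y) R) x * u (x + y) - trunc R (\<lambda>x. u (x + y)) x"
    have ball: "indicator (ball 0 R) (x + y) = (indicator (ball (- y) R) x :: real)" for x :: "real ^ 'n"
      by (simp add: indicator_def dist_norm norm_minus_commute add.commute)
    have "cis (y \<bullet> \<xi>) * F R \<xi> = fourier_integral (\<lambda>x. indicator (ball (- y) R) x * u (x + y)) \<xi>" for \<xi>
      using fourier_integral_translate[of "trunc R u" y \<xi>] by (simp add: F_def ball)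
    moreover have "integrable lborel (\<lambda>x. indicator (ball (- y) R) x * u (x + y))"
      using tame_truncation[OF cont', of "- y" R] by (simp add: tame_def)
    ultimately have "cis (y \<bullet> \<xi>) * F R \<xi> - F' R \<xi> = fourier_integral ?w \<xi>" for \<xi>
      using fourier_integral_lincomb[of "\<lambda>x. indicator (ball (- y) R) x * u (x + y)" "trunc R (\<lambda>x. u (x + y))" 1 "-1" \<xi>]
        integrable_trunc[OF cont', of R]
      by (simp add: F'_def)
    then have "(\<integral>\<^sup>+\<xi>. ennreal ((cmod (cis (y \<bullet> \<xi>) * F R \<xi> - F' R \<xi>))\<^sup>2) \<partial>lborel) = (\<integral>\<^sup>+x. ennreal ((?w x)\<^sup>2) \<partial>lborel)"
      using plancherel_tame[OF tame_diff[OF tame_truncation[OF cont', of "- y" R] tame_truncation[OF cont', of 0 R]]]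
      by simp
    also have "\<dots> \<le> (\<integral>\<^sup>+x. ennreal (indicator (- ball 0 (R - norm y)) (x + y) * (u (x + y))\<^sup>2) \<partial>lborel)"
    proof (intro nn_integral_mono ennreal_leI)
      fix x :: "real ^ 'n"
      show "(?w x)\<^sup>2 \<le> indicator (- ball 0 (R - norm y)) (x + y) * (u (x + y))\<^sup>2"
      proof (cases "x + y \<in> ball 0 (R - norm y)")
        case True
        then have "norm (x + y) < R" "norm x < R"
          using norm_triangle_ineq4[of "x + y" y] norm_ge_zero[of y] by (auto simp del: norm_ge_zero)
        then have "x \<in> ball (- y) R" "x \<in> ball 0 R"
          using ball[of x] by (auto simp: indicator_def split: if_splits)
        then show ?thesis by simp
      qed (auto simp: indicator_def)
    qed
    also have "\<dots> = ?t (R - norm y)"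
      by (rule nn_integral_lborel_translate[of "\<lambda>x. ennreal (indicator (- ball 0 (R - norm y)) x * (u x)\<^sup>2)"]) measurable
    finally show ?thesis .
  qed
  have le: "(\<integral>\<^sup>+\<xi>. ennreal ((cmod (cis (y \<bullet> \<xi>) * g \<xi> - F' R \<xi>))\<^sup>2) \<partial>lborel)
     \<le> ennreal (1 + 1) * b R + ennreal (1 + 1 / 1) * ?t (R - norm y)" for R
  proof -
    have "(\<integral>\<^sup>+\<xi>. ennreal ((cmod (cis (y \<bullet> \<xi>) * g \<xi> - F' R \<xi>))\<^sup>2) \<partial>lborel)
       = (\<integral>\<^sup>+\<xi>. ennreal ((cmod (cis (y \<bullet> \<xi>) * (g \<xi> - F R \<xi>) + (cis (y \<bullet> \<xi>) * F R \<xi> - F' R \<xi>)))\<^sup>2) \<partial>lborel)"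
      by (simp add: algebra_simps)
    also have "\<dots> \<le> ennreal (1 + 1) * (\<integral>\<^sup>+\<xi>. ennreal ((cmod (cis (y \<bullet> \<xi>) * (g \<xi> - F R \<xi>)))\<^sup>2) \<partial>lborel)
        + ennreal (1 + 1 / 1) * (\<integral>\<^sup>+\<xi>. ennreal ((cmod (cis (y \<bullet> \<xi>) * F R \<xi> - F' R \<xi>))\<^sup>2) \<partial>lborel)"
      by (rule nn_integral_cmod_add_power2_le) auto
    also have "(\<integral>\<^sup>+\<xi>. ennreal ((cmod (cis (y \<bullet> \<xi>) * (g \<xi> - F R \<xi>)))\<^sup>2) \<partial>lborel) = b R"
      by (simp add: b_def norm_mult)
    finally show ?thesis
      using diff[of R] by (meson add_left_mono mult_left_mono order_trans zero_le)
  qed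
  have "((\<lambda>R. ?t (R - norm y)) \<longlongrightarrow> 0) at_top"
    by (rule filterlim_compose[OF L2_tail[OF u]]) real_asymp
  then have "((\<lambda>R. ennreal (1 + 1) * b R + ennreal (1 + 1 / 1) * ?t (R - norm y)) \<longlongrightarrow> ennreal (1 + 1) * 0 + ennreal (1 + 1 / 1) * 0) at_top"
    by (intro tendsto_add ennreal_tendsto_cmult b) auto
  then have lim0: "((\<lambda>R. ennreal (1 + 1) * b R + ennreal (1 + 1 / 1) * ?t (R - norm y)) \<longlongrightarrow> 0) at_top"
    by simp
  have "((\<lambda>R. \<integral>\<^sup>+\<xi>. ennreal ((cmod (cis (y \<bullet> \<xi>) * g \<xi> - F' R \<xi>))\<^sup>2) \<partial>lborel) \<longlongrightarrow> 0) at_top"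
    by (rule tendsto_sandwich[OF _ _ tendsto_const lim0]) (intro always_eventually allI zero_le le)+
  moreover have "(\<lambda>\<xi>. cis (y \<bullet> \<xi>) * g \<xi>) \<in> L2"
    using L2_nn_integral_finite[OF gL2] by (intro L2_I) (auto simp: norm_mult)
  ultimately show ?thesis
    by (simp add: is_fourier_L2_def F'_def)
qed

lemma is_fourier_L2_fourier:
  fixes u :: "real ^ 'n \<Rightarrow> real"
  shows "u \<in> L2 \<Longrightarrow> continuous_on UNIV u \<Longrightarrow> is_fourier_L2 u (fourier u)"
  unfolding fourier_def using fourier_L2_exists by (metis someI_ex)

lemma continuous_translate:
  "continuous_on UNIV (u :: real ^ 'n \<Rightarrow> real) \<Longrightarrow> continuous_on UNIV (\<lambda>x. u (x + y))"
  by (rule continuous_on_compose2[of UNIV u]) (auto intro!: continuous_intros)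

lemma fourier_measurable:
  fixes u :: "real ^ 'n \<Rightarrow> real"
  shows "u \<in> L2 \<Longrightarrow> continuous_on UNIV u \<Longrightarrow> fourier u \<in> borel_measurable borel"
  using is_fourier_L2_fourier[of u] by (simp add: is_fourier_L2_def L2_def)

lemma plancherel:
  fixes u :: "real ^ 'n \<Rightarrow> real"
  assumes "u \<in> L2" "continuous_on UNIV u"
  shows "(\<integral>\<^sup>+\<xi>. ennreal ((cmod (fourier u \<xi>))\<^sup>2) \<partial>lborel) = (\<integral>\<^sup>+x. ennreal ((u x)\<^sup>2) \<partial>lborel)"
  using assms is_fourier_L2_fourier by (intro is_fourier_L2_plancherel) auto

lemma fourier_translate:
  fixes u :: "real ^ 'n \<Rightarrow> real"
  assumes "u \<in> L2" "continuous_on UNIV u"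
  shows "AE \<xi> in lborel. fourier (\<lambda>x. u (x + y)) \<xi> = cis (y \<bullet> \<xi>) * fourier u \<xi>"
  using assms
  by (intro is_fourier_L2_unique[of "\<lambda>x. u (x + y)"] is_fourier_L2_translate is_fourier_L2_fourier
      continuous_translate L2_translate L2_measurable)

lemma fourier_lincomb:
  fixes u v :: "real ^ 'n \<Rightarrow> real"
  assumes "u \<in> L2" "continuous_on UNIV u" "v \<in> L2" "continuous_on UNIV v"
  shows "AE \<xi> in lborel. fourier (\<lambda>x. a * u x + b * v x) \<xi> = a * fourier u \<xi> + b * fourier v \<xi>"
  using assms
  by (intro is_fourier_L2_unique[of "\<lambda>x. a * u x + b * v x"] is_fourier_L2_lincomb is_fourier_L2_fourier
      continuous_intros L2_lincomb L2_measurable)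

section \<open>The fractional Laplacian as a superposition of differences\<close>

text \<open>
  Subordination: \<open>\<bar>\<xi>\<bar>\<^bsup>2s\<^esup>\<close> is a positive superposition of the functions
  \<open>1 - cos (\<xi> \<bullet> y)\<close>. Writing \<open>y = a z\<close> with \<open>a\<close> distributed like \<open>a\<^bsup>-1-2s\<^esup> da\<close> and \<open>z\<close>
  Gaussian reduces the identity to a scaling in the single variable \<open>a\<close>.
\<close>

definition levy_weight :: "real \<Rightarrow> real \<times> 'a::euclidean_space \<Rightarrow> real"
  where "levy_weight s \<omega> = indicator {0<..} (fst \<omega>) * fst \<omega> powr (-1 - 2 * s) * gauss (snd \<omega>)"

definition levy_jump :: "real \<times> 'a::euclidean_space \<Rightarrow> 'a"
  where "levy_jump \<omega> = fst \<omega> *\<^sub>R snd \<omega>"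

text \<open>Averaging \<open>1 - cos (a * (\<xi> \<bullet> z))\<close> over Gaussian
  \<open>z\<close> for a unit vector \<xi> gives \<open>1 - exp (- a\<^sup>2 / 2)\<close>, so this
  is the value of the superposition at unit frequency. Its finiteness is a separate matter, hence
  the type \<open>ennreal\<close>.\<close>

definition levy_const :: "real \<Rightarrow> ennreal"
  where "levy_const s = (\<integral>\<^sup>+a. ennreal (indicator {0<..} a * a powr (-1 - 2 * s) * (1 - exp (- a\<^sup>2 / 2))) \<partial>lborel)"

lemma levy_weight_nonneg [simp]: "0 \<le> levy_weight s \<omega>"
  by (simp add: levy_weight_def)

lemma levy_weight_measurable [measurable]:
  "levy_weight s \<in> borel_measurable (borel :: (real \<times> 'a::euclidean_space) measure)"
  unfolding levy_weight_def[abs_def] borel_prod[symmetric] by measurable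

lemma levy_jump_measurable [measurable]:
  "levy_jump \<in> borel_measurable (borel :: (real \<times> 'a::euclidean_space) measure)"
  unfolding levy_jump_def[abs_def] borel_prod[symmetric] by measurable

lemma nn_integral_levy:
  fixes h :: "'a::euclidean_space \<Rightarrow> real"
  assumes [measurable]: "h \<in> borel_measurable borel" and h: "\<And>y. 0 \<le> h y"
  shows "(\<integral>\<^sup>+\<omega>. ennreal (levy_weight s \<omega> * h (levy_jump \<omega>)) \<partial>lborel)
    = (\<integral>\<^sup>+a. ennreal (indicator {0<..} a * a powr (-1 - 2 * s)) * (\<integral>\<^sup>+z. ennreal (gauss z * h (a *\<^sub>R z)) \<partial>lborel) \<partial>lborel)"
proof -
  have "(\<integral>\<^sup>+\<omega>. ennreal (levy_weight s \<omega> * h (levy_jump \<omega>)) \<partial>lborel)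
     = (\<integral>\<^sup>+\<omega>. ennreal (levy_weight s \<omega> * h (levy_jump \<omega>)) \<partial>(lborel \<Otimes>\<^sub>M lborel))"
    by (simp add: lborel_prod)
  also have "\<dots> = (\<integral>\<^sup>+a. \<integral>\<^sup>+z. ennreal (levy_weight s (a, z) * h (levy_jump (a, z))) \<partial>lborel \<partial>lborel)"
    by (subst lborel.nn_integral_fst[symmetric]) (simp_all add: lborel_prod)
  also have "\<dots> = (\<integral>\<^sup>+a. ennreal (indicator {0<..} a * a powr (-1 - 2 * s)) * (\<integral>\<^sup>+z. ennreal (gauss z * h (a *\<^sub>R z)) \<partial>lborel) \<partial>lborel)"
    by (intro nn_integral_cong, subst nn_integral_cmult[symmetric])
      (auto simp: levy_weight_def levy_jump_def ennreal_mult[symmetric] h mult.assoc)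
  finally show ?thesis .
qed

lemma nn_integral_gauss_one_minus_cos:
  "(\<integral>\<^sup>+z. ennreal (gauss z * (1 - cos (\<xi> \<bullet> z))) \<partial>lborel) = ennreal (1 - exp (- (norm (\<xi>::'a::euclidean_space))\<^sup>2 / 2))"
proof -
  have cos: "Re (cis (\<xi> \<bullet> z) * complex_of_real (gauss z)) = gauss z * cos (\<xi> \<bullet> z)" for z
    by simp
  have int: "integrable lborel (\<lambda>z. gauss z * cos (\<xi> \<bullet> z))"
    using integrable_Re[OF char_gauss(1)[of \<xi>]] unfolding cos .
  have "(LINT z|lborel. gauss z * cos (\<xi> \<bullet> z)) = Re (LINT z|lborel. cis (\<xi> \<bullet> z) * complex_of_real (gauss z))"
    unfolding cos[symmetric] by (rule integral_Re[OF char_gauss(1)])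
  then have val: "(LINT z|lborel. gauss z * cos (\<xi> \<bullet> z)) = exp (- (norm \<xi>)\<^sup>2 / 2)"
    unfolding char_gauss by simp
  have "(\<integral>\<^sup>+z. ennreal (gauss z * (1 - cos (\<xi> \<bullet> z))) \<partial>lborel) = ennreal (LINT z|lborel. gauss z * (1 - cos (\<xi> \<bullet> z)))"
    using int by (intro nn_integral_eq_integral) (auto simp: right_diff_distrib intro!: AE_I2 mult_left_le)
  also have "(LINT z|lborel. gauss z * (1 - cos (\<xi> \<bullet> z))) = 1 - exp (- (norm \<xi>)\<^sup>2 / 2)"
    using int by (simp add: right_diff_distrib val)
  finally show ?thesis .
qed

text \<open>The Gaussian average leaves a function of \<open>a * norm \<xi>\<close> only, and
  replacing \<open>a\<close> by \<open>a / norm \<xi>\<close> extracts the frequency.\<close>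

lemma nn_integral_levy_one_minus_cos:
  fixes \<xi> :: "'a::euclidean_space"
  assumes "0 < s"
  shows "(\<integral>\<^sup>+\<omega>. ennreal (levy_weight s \<omega> * (1 - cos (\<xi> \<bullet> levy_jump \<omega>))) \<partial>lborel) = levy_const s * ennreal (norm \<xi> powr (2 * s))"
proof -
  have "(\<integral>\<^sup>+\<omega>. ennreal (levy_weight s \<omega> * (1 - cos (\<xi> \<bullet> levy_jump \<omega>))) \<partial>lborel)
      = (\<integral>\<^sup>+a. ennreal (indicator {0<..} a * a powr (-1 - 2 * s)) * (\<integral>\<^sup>+z. ennreal (gauss z * (1 - cos (\<xi> \<bullet> (a *\<^sub>R z)))) \<partial>lborel) \<partial>lborel)"
    by (rule nn_integral_levy[where h = "\<lambda>y. 1 - cos (\<xi> \<bullet> y)"]) simp_all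
  also have "\<dots> = (\<integral>\<^sup>+a. ennreal (indicator {0<..} a * a powr (-1 - 2 * s) * (1 - exp (- (a * norm \<xi>)\<^sup>2 / 2))) \<partial>lborel)"
    using nn_integral_gauss_one_minus_cos[of "_ *\<^sub>R \<xi>"]
    by (intro nn_integral_cong) (simp add: ennreal_mult power_mult_distrib)
  also have "\<dots> = levy_const s * ennreal (norm \<xi> powr (2 * s))"
  proof (cases "\<xi> = 0")
    case False
    define r where "r = norm \<xi>"
    have r: "r > 0" using False by (simp add: r_def)
    have "(\<integral>\<^sup>+a. ennreal (indicator {0<..} a * a powr (-1 - 2 * s) * (1 - exp (- (a * r)\<^sup>2 / 2))) \<partial>lborel)
       = ennreal \<bar>1 / r\<bar> * (\<integral>\<^sup>+a. ennreal (indicator {0<..} (0 + 1 / r * a) * (0 + 1 / r * a) powr (-1 - 2 * s) * (1 - exp (- ((0 + 1 / r * a) * r)\<^sup>2 / 2))) \<partial>lborel)"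
      by (rule nn_integral_real_affine) (use r in auto)
    also have "\<dots> = (\<integral>\<^sup>+a. ennreal (r powr (2 * s)) * ennreal (indicator {0<..} a * a powr (-1 - 2 * s) * (1 - exp (- a\<^sup>2 / 2))) \<partial>lborel)"
    proof (subst nn_integral_cmult[symmetric], simp, intro nn_integral_cong)
      fix a :: real
      \<comment> \<open>The Jacobian \<open>1 / r\<close> lowers the factor
        \<open>r powr (2 * s + 1)\<close> from the weight to the wanted power.\<close>
      have "1 / r * ((1 / r * a) powr (-1 - 2 * s)) = r powr (2 * s) * a powr (-1 - 2 * s)" if "a > 0"
      proof -
        have "(1 / r * a) powr (-1 - 2 * s) = r powr (2 * s + 1) * a powr (-1 - 2 * s)"
        proof -
          have "r powr (2 * s + 1) * r powr (-1 - 2 * s) = 1"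
            using r by (simp flip: powr_add)
          then show ?thesis
            using r that by (simp add: powr_divide divide_simps)
        qed
        then show ?thesis
          using r by (simp add: powr_add)
      qed
      then show "ennreal \<bar>1 / r\<bar> * ennreal (indicator {0<..} (0 + 1 / r * a) * (0 + 1 / r * a) powr (-1 - 2 * s) * (1 - exp (- ((0 + 1 / r * a) * r)\<^sup>2 / 2)))
         = ennreal (r powr (2 * s)) * ennreal (indicator {0<..} a * a powr (-1 - 2 * s) * (1 - exp (- a\<^sup>2 / 2)))"
        using r by (cases "a > 0") (auto simp: ennreal_mult[symmetric] zero_less_divide_iff simp flip: mult.assoc)
    qed
    also have "\<dots> = ennreal (r powr (2 * s)) * levy_const s"
      unfolding levy_const_def by (rule nn_integral_cmult) measurable
    finally show ?thesis
      by (simp add: r_def mult.commute)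
  qed simp
  finally show ?thesis .
qed

text \<open>Near zero the exponent becomes \<open>1 - 2 * s > -1\<close> because
  \<open>s < 1\<close>; at infinity it is \<open>-1 - 2 * s < -1\<close> because
  \<open>0 < s\<close>.\<close>

lemma nn_integral_powr_min_finite:
  assumes "0 < s" "s < 1"
  shows "(\<integral>\<^sup>+a. ennreal (indicator {0<..} a * a powr (-1 - 2 * s) * min 1 (a\<^sup>2)) \<partial>lborel) < \<infinity>"
proof -
  have 1: "(\<integral>\<^sup>+a. ennreal (indicator {0..1} a * a powr (1 - 2 * s)) \<partial>lborel) < \<infinity>"
    using nn_integral_has_integral_lebesgue[OF _ has_integral_powr_from_0[of "1 - 2 * s" 1]] assms by simp
  have 2: "(\<integral>\<^sup>+a. ennreal (indicator {1..} a * a powr (-1 - 2 * s)) \<partial>lborel) < \<infinity>"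
    using nn_integral_has_integral_lebesgue[OF _ has_integral_powr_to_inf[of "-1 - 2 * s" 1]] assms by simp
  have "(\<integral>\<^sup>+a. ennreal (indicator {0<..} a * a powr (-1 - 2 * s) * min 1 (a\<^sup>2)) \<partial>lborel)
      \<le> (\<integral>\<^sup>+a. ennreal (indicator {0..1} a * a powr (1 - 2 * s)) + ennreal (indicator {1..} a * a powr (-1 - 2 * s)) \<partial>lborel)"
  proof (intro nn_integral_mono)
    fix a :: real
    have "indicator {0<..} a * a powr (-1 - 2 * s) * min 1 (a\<^sup>2) \<le> indicator {0..1} a * a powr (1 - 2 * s) + indicator {1..} a * a powr (-1 - 2 * s)"
    proof (cases "a > 0")
      case True
      then have "a powr (-1 - 2 * s) * a\<^sup>2 = a powr (1 - 2 * s)"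
        by (simp add: powr_numeral[symmetric] powr_add[symmetric] del: powr_numeral)
      moreover have "a powr (-1 - 2 * s) * min 1 (a\<^sup>2) \<le> a powr (-1 - 2 * s) * 1" "a powr (-1 - 2 * s) * min 1 (a\<^sup>2) \<le> a powr (-1 - 2 * s) * a\<^sup>2"
        by (intro mult_left_mono; simp)+
      ultimately show ?thesis
        using True by (cases "a \<le> 1") (auto simp: indicator_def)
    qed simp
    then show "ennreal (indicator {0<..} a * a powr (-1 - 2 * s) * min 1 (a\<^sup>2)) \<le> ennreal (indicator {0..1} a * a powr (1 - 2 * s)) + ennreal (indicator {1..} a * a powr (-1 - 2 * s))"
      by (simp flip: ennreal_plus)
  qed
  also have "\<dots> < \<infinity>"
    using 1 2 by (subst nn_integral_add) auto
  finally show ?thesis .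
qed

lemma levy_const_finite:
  assumes "0 < s" "s < 1"
  shows "levy_const s < \<infinity>"
proof -
  have "1 - exp (- a\<^sup>2 / 2) \<le> min 1 (a\<^sup>2)" for a :: real
  proof -
    have "1 - exp (- a\<^sup>2 / 2) \<le> a\<^sup>2 / 2" "a\<^sup>2 / 2 \<le> a\<^sup>2"
      using exp_ge_add_one_self[of "- a\<^sup>2 / 2"] by simp_all
    then have "1 - exp (- a\<^sup>2 / 2) \<le> a\<^sup>2"
      by linarith
    then show ?thesis
      by (intro min.boundedI) simp_all
  qed
  then have "levy_const s \<le> (\<integral>\<^sup>+a. ennreal (indicator {0<..} a * a powr (-1 - 2 * s) * min 1 (a\<^sup>2)) \<partial>lborel)"
    unfolding levy_const_def by (intro nn_integral_mono ennreal_leI mult_left_mono) auto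
  then show ?thesis
    using nn_integral_powr_min_finite[OF assms] by (rule le_less_trans)
qed

lemma levy_const_pos:
  assumes "0 < s"
  shows "0 < levy_const s"
proof -
  let ?c = "2 powr (-1 - 2 * s) * (1 - exp (- 1 / 2)) :: real"
  have "0 < ennreal ?c"
    by simp
  also have "\<dots> = (\<integral>\<^sup>+a. ennreal ?c * indicator {1..2::real} a \<partial>lborel)"
    by (subst nn_integral_cmult_indicator) auto
  also have "\<dots> \<le> levy_const s"
    unfolding levy_const_def
  proof (intro nn_integral_mono)
    fix a :: real
    show "ennreal ?c * indicator {1..2} a \<le> ennreal (indicator {0<..} a * a powr (-1 - 2 * s) * (1 - exp (- a\<^sup>2 / 2)))"
    proof (cases "a \<in> {1..2}")
      case True
      have "1 \<le> a\<^sup>2" using True by (simp add: one_le_power)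
      moreover have "2 powr (-1 - 2 * s) \<le> a powr (-1 - 2 * s)"
        using True assms by (intro powr_mono2') auto
      ultimately show ?thesis
        using True by (auto intro!: mult_mono)
    qed simp
  qed
  finally show ?thesis .
qed

text \<open>The bound of \<open>min 1 (a\<^sup>2 * (norm z)\<^sup>2)\<close> by
  \<open>min 1 (a\<^sup>2) * (1 + (norm z)\<^sup>2)\<close> separates scale from direction. What
  remains is the one-dimensional integral above and a second moment of the Gaussian.\<close>

lemma nn_integral_levy_min_finite:
  assumes "0 < s" "s < 1"
  shows "(\<integral>\<^sup>+\<omega>. ennreal (levy_weight s \<omega> * min 1 ((norm (levy_jump \<omega> :: 'a::euclidean_space))\<^sup>2)) \<partial>lborel) < \<infinity>"
proof -
  let ?A = "\<integral>\<^sup>+z. ennreal (gauss z * (1 + (norm (z :: 'a))\<^sup>2)) \<partial>lborel"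
  have fin: "?A < \<infinity>"
  proof -
    define c where "c = (2 * pi) powr (- real DIM('a) / 2)"
    \<comment> \<open>A wider Gaussian dominates the second moment:
      \<open>t \<le> 4 * exp (t / 4)\<close> for \<open>t = (norm z)\<^sup>2\<close> leaves
      \<open>exp (- t / 4)\<close>, and the scaling by \<open>sqrt (1 / 2)\<close> brings this into
      the form of \<open>char_gauss_scaled\<close>.\<close>
    have "integrable lborel (\<lambda>z::'a. gauss z + 4 * c * exp (- (norm (sqrt (1 / 2) *\<^sub>R z))\<^sup>2 / 2))"
      using char_gauss_scaled(1)[of "sqrt (1 / 2)", where 'a = 'a]
      by (intro Bochner_Integration.integrable_add integrable_mult_right) auto
    then have "(\<integral>\<^sup>+z. ennreal (norm (gauss z + 4 * c * exp (- (norm (sqrt (1 / 2) *\<^sub>R z))\<^sup>2 / 2))) \<partial>(lborel :: 'a measure)) < \<infinity>"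
      by (auto simp: integrable_iff_bounded)
    moreover have "gauss z * (1 + (norm z)\<^sup>2) \<le> norm (gauss z + 4 * c * exp (- (norm (sqrt (1 / 2) *\<^sub>R z))\<^sup>2 / 2))" for z :: 'a
    proof -
      define t where "t = (norm z)\<^sup>2"
      have "t \<le> 4 * exp (t / 4)"
        using exp_ge_add_one_self[of "t / 4"] by linarith
      then have "exp (- t / 2) * t \<le> exp (- t / 2) * (4 * exp (t / 4))"
        by (intro mult_left_mono) auto
      also have "\<dots> = 4 * exp (- t / 4)"
        by (simp add: exp_add[symmetric])
      finally have "c * (exp (- t / 2) * t) \<le> c * (4 * exp (- t / 4))"
        by (intro mult_left_mono) (auto simp: c_def)
      moreover have "(norm (sqrt (1 / 2) *\<^sub>R z))\<^sup>2 / 2 = t / 4"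
        by (simp add: t_def power_mult_distrib)
      moreover have "gauss z = c * exp (- t / 2)"
        by (simp add: gauss_eq_exp c_def t_def)
      ultimately show ?thesis
        by (auto simp: algebra_simps t_def[symmetric] intro!: order_trans[OF _ abs_ge_self])
    qed
    ultimately show ?thesis
      by (rule le_less_trans[OF nn_integral_mono[OF ennreal_leI], rotated])
  qed
  have "(\<integral>\<^sup>+\<omega>. ennreal (levy_weight s \<omega> * min 1 ((norm (levy_jump \<omega> :: 'a))\<^sup>2)) \<partial>lborel)
     = (\<integral>\<^sup>+a. ennreal (indicator {0<..} a * a powr (-1 - 2 * s)) * (\<integral>\<^sup>+z. ennreal (gauss z * min 1 ((norm (a *\<^sub>R z :: 'a))\<^sup>2)) \<partial>lborel) \<partial>lborel)"
    by (rule nn_integral_levy[where h = "\<lambda>y. min 1 ((norm y)\<^sup>2)"]) simp_all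
  also have "\<dots> \<le> (\<integral>\<^sup>+a. ennreal (indicator {0<..} a * a powr (-1 - 2 * s) * min 1 (a\<^sup>2)) * ?A \<partial>lborel)"
  proof (intro nn_integral_mono)
    fix a :: real
    have "(\<integral>\<^sup>+z. ennreal (gauss z * min 1 ((norm (a *\<^sub>R z :: 'a))\<^sup>2)) \<partial>lborel)
       \<le> (\<integral>\<^sup>+z. ennreal (min 1 (a\<^sup>2)) * ennreal (gauss z * (1 + (norm (z :: 'a))\<^sup>2)) \<partial>lborel)"
    proof (intro nn_integral_mono)
      fix z :: 'a
      have "min 1 (a\<^sup>2 * (norm z)\<^sup>2) \<le> min 1 (a\<^sup>2) * (1 + (norm z)\<^sup>2)"
      proof (cases "a\<^sup>2 \<le> 1")
        case True
        have "min 1 (a\<^sup>2 * (norm z)\<^sup>2) \<le> a\<^sup>2 * (norm z)\<^sup>2"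
          by simp
        also have "\<dots> \<le> a\<^sup>2 * (1 + (norm z)\<^sup>2)"
          by (intro mult_left_mono) auto
        finally show ?thesis
          using True by (simp add: min_absorb2)
      next
        case False
        have "min 1 (a\<^sup>2 * (norm z)\<^sup>2) \<le> 1 + (norm z)\<^sup>2"
          by (rule order_trans[OF min.cobounded1]) simp
        then show ?thesis
          using False by (simp add: min_absorb1)
      qed
      then have "gauss z * min 1 ((norm (a *\<^sub>R z))\<^sup>2) \<le> gauss z * (min 1 (a\<^sup>2) * (1 + (norm z)\<^sup>2))"
        by (intro mult_left_mono) (auto simp: power_mult_distrib)
      then show "ennreal (gauss z * min 1 ((norm (a *\<^sub>R z))\<^sup>2)) \<le> ennreal (min 1 (a\<^sup>2)) * ennreal (gauss z * (1 + (norm z)\<^sup>2))"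
        by (subst ennreal_mult[symmetric]) (auto intro!: ennreal_leI simp: mult_ac)
    qed
    also have "\<dots> = ennreal (min 1 (a\<^sup>2)) * ?A"
      by (rule nn_integral_cmult) measurable
    finally have "ennreal (indicator {0<..} a * a powr (-1 - 2 * s)) * (\<integral>\<^sup>+z. ennreal (gauss z * min 1 ((norm (a *\<^sub>R z :: 'a))\<^sup>2)) \<partial>lborel)
       \<le> ennreal (indicator {0<..} a * a powr (-1 - 2 * s)) * (ennreal (min 1 (a\<^sup>2)) * ?A)"
      by (rule mult_left_mono) simp
    then show "ennreal (indicator {0<..} a * a powr (-1 - 2 * s)) * (\<integral>\<^sup>+z. ennreal (gauss z * min 1 ((norm (a *\<^sub>R z :: 'a))\<^sup>2)) \<partial>lborel)
       \<le> ennreal (indicator {0<..} a * a powr (-1 - 2 * s) * min 1 (a\<^sup>2)) * ?A"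
      by (simp add: ennreal_mult mult.assoc)
  qed
  also have "\<dots> = (\<integral>\<^sup>+a. ennreal (indicator {0<..} a * a powr (-1 - 2 * s) * min 1 (a\<^sup>2)) \<partial>lborel) * ?A"
    by (rule nn_integral_multc) measurable
  also have "\<dots> < \<infinity>"
    using fin nn_integral_powr_min_finite[OF assms] by (simp add: ennreal_mult_less_top)
  finally show ?thesis .
qed

section \<open>The jump energy: squared Gagliardo seminorm up to a constant\<close>

definition jump_energy :: "real \<Rightarrow> (real ^ 'n \<Rightarrow> real) \<Rightarrow> ennreal"
  where "jump_energy s u = (\<integral>\<^sup>+\<omega>. ennreal (levy_weight s \<omega>) * (\<integral>\<^sup>+x. ennreal ((u (x + levy_jump \<omega>) - u x)\<^sup>2) \<partial>lborel) \<partial>lborel)"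

lemma norm_cis_minus_one_power2: "(cmod (cis t - 1))\<^sup>2 = 2 * (1 - cos t)"
proof -
  have "(cmod (cis t - 1))\<^sup>2 = (cos t - 1)\<^sup>2 + (sin t)\<^sup>2"
    by (simp add: cmod_power2)
  also have "\<dots> = 2 * (1 - cos t)"
    by (simp add: power2_diff sin_squared_eq)
  finally show ?thesis .
qed

text \<open>Plancherel for the increment: its transform carries the multiplier
  \<open>cis (\<xi> \<bullet> y) - 1\<close>, whose squared modulus is
  \<open>2 * (1 - cos (\<xi> \<bullet> y))\<close>.\<close>

lemma nn_integral_diff_translate:
  fixes u :: "real ^ 'n \<Rightarrow> real"
  assumes u: "u \<in> L2" "continuous_on UNIV u"
  shows "(\<integral>\<^sup>+x. ennreal ((u (x + y) - u x)\<^sup>2) \<partial>lborel)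
    = (\<integral>\<^sup>+\<xi>. ennreal (2 * (1 - cos (\<xi> \<bullet> y)) * (cmod (fourier u \<xi>))\<^sup>2) \<partial>lborel)"
proof -
  let ?w = "\<lambda>x. 1 * u (x + y) + (-1) * u x"
  have L2: "?w \<in> L2" and cont: "continuous_on UNIV ?w"
    using u by (intro L2_lincomb L2_translate continuous_intros continuous_translate; simp)+
  have "AE \<xi> in lborel. fourier ?w \<xi> = complex_of_real 1 * fourier (\<lambda>x. u (x + y)) \<xi> + complex_of_real (-1) * fourier u \<xi>"
    using u by (intro fourier_lincomb L2_translate continuous_translate) auto
  with fourier_translate[OF u, of y]
  have AE: "AE \<xi> in lborel. (cmod (fourier ?w \<xi>))\<^sup>2 = 2 * (1 - cos (\<xi> \<bullet> y)) * (cmod (fourier u \<xi>))\<^sup>2"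
  proof eventually_elim
    case (elim \<xi>)
    then have "fourier ?w \<xi> = (cis (\<xi> \<bullet> y) - 1) * fourier u \<xi>"
      by (simp add: algebra_simps inner_commute)
    then show ?case
      by (simp add: norm_mult power_mult_distrib norm_cis_minus_one_power2)
  qed
  have "(\<integral>\<^sup>+x. ennreal ((?w x)\<^sup>2) \<partial>lborel) = (\<integral>\<^sup>+\<xi>. ennreal ((cmod (fourier ?w \<xi>))\<^sup>2) \<partial>lborel)"
    by (rule plancherel[OF L2 cont, symmetric])
  also have "\<dots> = (\<integral>\<^sup>+\<xi>. ennreal (2 * (1 - cos (\<xi> \<bullet> y)) * (cmod (fourier u \<xi>))\<^sup>2) \<partial>lborel)"
    using AE by (intro nn_integral_cong_AE) (auto elim: AE_mp intro: AE_I2)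
  finally show ?thesis by simp
qed

lemma jump_energy_eq:
  fixes u :: "real ^ 'n \<Rightarrow> real"
  assumes u: "u \<in> L2" "continuous_on UNIV u" and s: "0 < s"
  shows "jump_energy s u = 2 * levy_const s * (\<integral>\<^sup>+\<xi>. ennreal (norm \<xi> powr (2 * s) * (cmod (fourier u \<xi>))\<^sup>2) \<partial>lborel)"
proof -
  have [measurable]: "fourier u \<in> borel_measurable borel"
    using u by (rule fourier_measurable)
  have "jump_energy s u = (\<integral>\<^sup>+\<omega>. \<integral>\<^sup>+\<xi>. ennreal (levy_weight s \<omega> * (1 - cos (\<xi> \<bullet> levy_jump \<omega>))) * ennreal (2 * (cmod (fourier u \<xi>))\<^sup>2) \<partial>lborel \<partial>lborel)"
    unfolding jump_energy_def nn_integral_diff_translate[OF u]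
    by (intro nn_integral_cong, subst nn_integral_cmult[symmetric])
      (measurable, auto simp: ennreal_mult[symmetric] mult_ac intro!: nn_integral_cong)
  also have "\<dots> = (\<integral>\<^sup>+\<xi>. \<integral>\<^sup>+\<omega>. ennreal (levy_weight s \<omega> * (1 - cos (\<xi> \<bullet> levy_jump \<omega>))) * ennreal (2 * (cmod (fourier u \<xi>))\<^sup>2) \<partial>lborel \<partial>lborel)"
    by (rule lborel_pair.Fubini'[symmetric]) measurable
  also have "\<dots> = (\<integral>\<^sup>+\<xi>. (levy_const s * 2) * ennreal (norm \<xi> powr (2 * s) * (cmod (fourier u \<xi>))\<^sup>2) \<partial>lborel)"
  proof (intro nn_integral_cong)
    fix \<xi> :: "real ^ 'n"
    have "(\<integral>\<^sup>+\<omega>. ennreal (levy_weight s \<omega> * (1 - cos (\<xi> \<bullet> levy_jump \<omega>))) * ennreal (2 * (cmod (fourier u \<xi>))\<^sup>2) \<partial>lborel)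
       = (\<integral>\<^sup>+\<omega>. ennreal (levy_weight s \<omega> * (1 - cos (\<xi> \<bullet> levy_jump \<omega>))) \<partial>lborel) * ennreal (2 * (cmod (fourier u \<xi>))\<^sup>2)"
      by (rule nn_integral_multc) measurable
    then show "(\<integral>\<^sup>+\<omega>. ennreal (levy_weight s \<omega> * (1 - cos (\<xi> \<bullet> levy_jump \<omega>))) * ennreal (2 * (cmod (fourier u \<xi>))\<^sup>2) \<partial>lborel)
       = (levy_const s * 2) * ennreal (norm \<xi> powr (2 * s) * (cmod (fourier u \<xi>))\<^sup>2)"
      by (simp only: nn_integral_levy_one_minus_cos[OF s]) (simp add: ennreal_mult ac_simps)
  qed
  also have "\<dots> = 2 * levy_const s * (\<integral>\<^sup>+\<xi>. ennreal (norm \<xi> powr (2 * s) * (cmod (fourier u \<xi>))\<^sup>2) \<partial>lborel)"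
    by (subst nn_integral_cmult) (auto simp: ac_simps)
  finally show ?thesis .
qed

text \<open>Since \<open>levy_const s\<close> is neither zero nor infinite, membership can be tested
  in space. This is how products with cutoffs and linear combinations are handled, where the
  transform offers no pointwise bound for the former.\<close>

lemma Hs_iff_jump_energy_finite:
  fixes u :: "real ^ 'n \<Rightarrow> real"
  assumes u: "u \<in> L2" "continuous_on UNIV u" and s: "0 < s" "s < 1"
  shows "u \<in> Hs s \<longleftrightarrow> jump_energy s u < \<infinity>"
proof -
  have [measurable]: "fourier u \<in> borel_measurable borel"
    using u by (rule fourier_measurable)
  have "u \<in> Hs s \<longleftrightarrow> (\<integral>\<^sup>+\<xi>. ennreal (norm \<xi> powr (2 * s) * (cmod (fourier u \<xi>))\<^sup>2) \<partial>lborel) < \<infinity>"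
    using u by (simp add: Hs_def integrable_iff_bounded)
  also have "\<dots> \<longleftrightarrow> jump_energy s u < \<infinity>"
    unfolding jump_energy_eq[OF u s(1)] using levy_const_finite[OF s] levy_const_pos[OF s(1)]
    by (auto simp: ennreal_mult_less_top ennreal_mult_eq_top_iff top_unique less_top)
  finally show ?thesis .
qed

text \<open>Read \<open>A\<close>, \<open>B\<close> as values of \<open>u\<close> at two points and
  \<open>r\<close>, \<open>r'\<close> as those of the cutoff. The difference of the squares is four
  times the product of the increments of \<open>u\<close> and of the cutoff square times
  \<open>u\<close>, which equals \<open>(r' * B - r * A)\<^sup>2 - A * B * (r' - r)\<^sup>2\<close>.
  Stated with squares, it compares two nonnegative energies rather than bounding a bilinear
  form.\<close>

lemma cutoff_square_diff_le:
  fixes A B r r' :: real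
  shows "((B - r'\<^sup>2 * B) - (A - r\<^sup>2 * A))\<^sup>2 \<le> ((B + r'\<^sup>2 * B) - (A + r\<^sup>2 * A))\<^sup>2 + 2 * (A\<^sup>2 + B\<^sup>2) * (r' - r)\<^sup>2"
proof -
  have eq: "((B + r'\<^sup>2 * B) - (A + r\<^sup>2 * A))\<^sup>2 - ((B - r'\<^sup>2 * B) - (A - r\<^sup>2 * A))\<^sup>2
     = 4 * (r' * B - r * A)\<^sup>2 - 4 * (A * B) * (r' - r)\<^sup>2"
    by (simp add: power2_eq_square algebra_simps)
  have "2 * (A * B) * (r' - r)\<^sup>2 \<le> (A\<^sup>2 + B\<^sup>2) * (r' - r)\<^sup>2"
    using sum_squares_bound[of A B] by (intro mult_right_mono) auto
  moreover have "0 \<le> 4 * (r' * B - r * A)\<^sup>2"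
    by simp
  ultimately show ?thesis
    using eq by linarith
qed

text \<open>Discrete Leibniz rule with \<open>r' + r \<le> 2\<close>. It serves to show that the
  product of \<open>u\<close> with a squared cutoff stays in \<open>Hs s\<close>.\<close>

lemma cutoff_product_diff_le:
  fixes A B r r' :: real
  assumes "0 \<le> r" "r \<le> 1" "0 \<le> r'" "r' \<le> 1"
  shows "(r'\<^sup>2 * B - r\<^sup>2 * A)\<^sup>2 \<le> 2 * (B - A)\<^sup>2 + 8 * (A\<^sup>2 + B\<^sup>2) * (r' - r)\<^sup>2"
proof -
  have eq: "r'\<^sup>2 * B - r\<^sup>2 * A = r'\<^sup>2 * (B - A) + A * ((r' + r) * (r' - r))"
    by (simp add: power2_eq_square algebra_simps)
  have "(r'\<^sup>2 * B - r\<^sup>2 * A)\<^sup>2 \<le> 2 * (r'\<^sup>2 * (B - A))\<^sup>2 + 2 * (A * ((r' + r) * (r' - r)))\<^sup>2"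
  proof -
    have "(a + b)\<^sup>2 \<le> 2 * a\<^sup>2 + 2 * b\<^sup>2" for a b :: real
      using sum_squares_bound[of a b] by (simp add: power2_sum)
    then show ?thesis unfolding eq by blast
  qed
  also have "(r'\<^sup>2 * (B - A))\<^sup>2 \<le> 1 * (B - A)\<^sup>2"
    unfolding power_mult_distrib using assms by (intro mult_right_mono power_le_one) auto
  also have "(A * ((r' + r) * (r' - r)))\<^sup>2 = A\<^sup>2 * ((r' + r)\<^sup>2 * (r' - r)\<^sup>2)"
    by (simp add: power_mult_distrib)
  also have "\<dots> \<le> (A\<^sup>2 + B\<^sup>2) * (4 * (r' - r)\<^sup>2)"
  proof (intro mult_mono)
    have "(r' + r)\<^sup>2 \<le> 2\<^sup>2"
      using assms by (intro power_mono) auto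
    then show "(r' + r)\<^sup>2 \<le> 4" by simp
  qed auto
  finally show ?thesis by linarith
qed

definition cutoff :: "real \<Rightarrow> ('a::euclidean_space \<Rightarrow> real) \<Rightarrow> bool"
  where "cutoff L \<rho> \<longleftrightarrow> (\<forall>x. 0 \<le> \<rho> x \<and> \<rho> x \<le> 1) \<and> L-lipschitz_on UNIV \<rho>"

text \<open>The increment of the cutoff is at most 1 and at most \<open>L * norm y\<close>, so
  \<open>1 + L\<^sup>2\<close> times \<open>min 1 ((norm y)\<^sup>2)\<close> dominates its square,
  which is exactly what the jump weight can integrate. Translation invariance makes the two
  \<open>u\<close> terms equal, whence the factor 2.\<close>

lemma nn_integral_cutoff_jumps:
  fixes u :: "real ^ 'n \<Rightarrow> real"
  assumes u: "u \<in> L2" and \<rho>: "cutoff L \<rho>" and s: "0 < s" "s < 1"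
  shows "(\<integral>\<^sup>+\<omega>. ennreal (levy_weight s \<omega>) * (\<integral>\<^sup>+x. ennreal (((u x)\<^sup>2 + (u (x + levy_jump \<omega>))\<^sup>2) * (\<rho> (x + levy_jump \<omega>) - \<rho> x)\<^sup>2) \<partial>lborel) \<partial>lborel)
    \<le> ennreal (2 * (1 + L\<^sup>2)) * (\<integral>\<^sup>+\<omega>. ennreal (levy_weight s \<omega> * min 1 ((norm (levy_jump \<omega> :: real ^ 'n))\<^sup>2)) \<partial>lborel) * (\<integral>\<^sup>+x. ennreal ((u x)\<^sup>2) \<partial>lborel)"
proof -
  have [measurable]: "u \<in> borel_measurable borel"
    using u by (rule L2_measurable)
  let ?U = "\<integral>\<^sup>+x. ennreal ((u x)\<^sup>2) \<partial>lborel"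
  have jump: "(\<rho> (x + y) - \<rho> x)\<^sup>2 \<le> (1 + L\<^sup>2) * min 1 ((norm y)\<^sup>2)" for x y
  proof -
    have r: "0 \<le> \<rho> x" "\<rho> x \<le> 1" "0 \<le> \<rho> (x + y)" "\<rho> (x + y) \<le> 1"
      using \<rho> by (auto simp: cutoff_def)
    have "\<bar>\<rho> (x + y) - \<rho> x\<bar> \<le> L * norm y"
      using \<rho> lipschitz_onD[of L UNIV \<rho> "x + y" x] by (auto simp: cutoff_def dist_norm)
    then have 1: "(\<rho> (x + y) - \<rho> x)\<^sup>2 \<le> L\<^sup>2 * (norm y)\<^sup>2"
      by (metis abs_ge_zero power2_abs power_mono power_mult_distrib)
    have 2: "(\<rho> (x + y) - \<rho> x)\<^sup>2 \<le> 1"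
      using r by (simp add: abs_square_le_1)
    show ?thesis
    proof (cases "(norm y)\<^sup>2 \<le> 1")
      case True
      then show ?thesis
        using 1 by (simp add: min_absorb2 distrib_right add_increasing)
    next
      case False
      then show ?thesis
        using 2 by (simp add: min_absorb1 add_increasing2)
    qed
  qed
  have inner: "(\<integral>\<^sup>+x. ennreal (((u x)\<^sup>2 + (u (x + y))\<^sup>2) * (\<rho> (x + y) - \<rho> x)\<^sup>2) \<partial>lborel)
     \<le> ennreal ((1 + L\<^sup>2) * min 1 ((norm y)\<^sup>2)) * (2 * ?U)" for y
  proof -
    have "(\<integral>\<^sup>+x. ennreal (((u x)\<^sup>2 + (u (x + y))\<^sup>2) * (\<rho> (x + y) - \<rho> x)\<^sup>2) \<partial>lborel)
      \<le> (\<integral>\<^sup>+x. ennreal ((1 + L\<^sup>2) * min 1 ((norm y)\<^sup>2)) * (ennreal ((u x)\<^sup>2) + ennreal ((u (x + y))\<^sup>2)) \<partial>lborel)"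
    proof (intro nn_integral_mono)
      fix x
      have "((u x)\<^sup>2 + (u (x + y))\<^sup>2) * (\<rho> (x + y) - \<rho> x)\<^sup>2 \<le> ((u x)\<^sup>2 + (u (x + y))\<^sup>2) * ((1 + L\<^sup>2) * min 1 ((norm y)\<^sup>2))"
        by (intro mult_left_mono jump) auto
      then show "ennreal (((u x)\<^sup>2 + (u (x + y))\<^sup>2) * (\<rho> (x + y) - \<rho> x)\<^sup>2)
        \<le> ennreal ((1 + L\<^sup>2) * min 1 ((norm y)\<^sup>2)) * (ennreal ((u x)\<^sup>2) + ennreal ((u (x + y))\<^sup>2))"
        by (subst ennreal_plus[symmetric], simp, simp, subst ennreal_mult[symmetric]) (auto intro!: ennreal_leI simp: mult.commute)
    qed
    also have "\<dots> = ennreal ((1 + L\<^sup>2) * min 1 ((norm y)\<^sup>2)) * (?U + (\<integral>\<^sup>+x. ennreal ((u (x + y))\<^sup>2) \<partial>lborel))"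
      by (subst nn_integral_cmult) (auto simp: nn_integral_add)
    also have "(\<integral>\<^sup>+x. ennreal ((u (x + y))\<^sup>2) \<partial>lborel) = ?U"
      by (rule nn_integral_lborel_translate[of "\<lambda>x. ennreal ((u x)\<^sup>2)"]) measurable
    finally show ?thesis
      by (simp add: mult_2)
  qed
  have "(\<integral>\<^sup>+\<omega>. ennreal (levy_weight s \<omega>) * (\<integral>\<^sup>+x. ennreal (((u x)\<^sup>2 + (u (x + levy_jump \<omega>))\<^sup>2) * (\<rho> (x + levy_jump \<omega>) - \<rho> x)\<^sup>2) \<partial>lborel) \<partial>lborel)
    \<le> (\<integral>\<^sup>+\<omega>. ennreal (levy_weight s \<omega>) * (ennreal ((1 + L\<^sup>2) * min 1 ((norm (levy_jump \<omega> :: real ^ 'n))\<^sup>2)) * (2 * ?U)) \<partial>lborel)"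
    by (intro nn_integral_mono mult_left_mono inner) simp
  also have "\<dots> = (\<integral>\<^sup>+\<omega>. ennreal (levy_weight s \<omega> * min 1 ((norm (levy_jump \<omega> :: real ^ 'n))\<^sup>2)) * (ennreal (1 + L\<^sup>2) * (2 * ?U)) \<partial>lborel)"
    by (intro nn_integral_cong) (simp add: ennreal_mult ac_simps del: ennreal_plus)
  also have "\<dots> = (\<integral>\<^sup>+\<omega>. ennreal (levy_weight s \<omega> * min 1 ((norm (levy_jump \<omega> :: real ^ 'n))\<^sup>2)) \<partial>lborel) * (ennreal (1 + L\<^sup>2) * (2 * ?U))"
    by (rule nn_integral_multc) measurable
  finally have "(\<integral>\<^sup>+\<omega>. ennreal (levy_weight s \<omega>) * (\<integral>\<^sup>+x. ennreal (((u x)\<^sup>2 + (u (x + levy_jump \<omega>))\<^sup>2) * (\<rho> (x + levy_jump \<omega>) - \<rho> x)\<^sup>2) \<partial>lborel) \<partial>lborel)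
     \<le> (2 * ennreal (1 + L\<^sup>2)) * (\<integral>\<^sup>+\<omega>. ennreal (levy_weight s \<omega> * min 1 ((norm (levy_jump \<omega> :: real ^ 'n))\<^sup>2)) \<partial>lborel) * ?U"
    by (simp only: mult_ac)
  moreover have "ennreal (2 * (1 + L\<^sup>2)) = 2 * ennreal (1 + L\<^sup>2)"
    by (subst ennreal_mult) auto
  ultimately show ?thesis
    by (simp only:)
qed

section \<open>Linear structure of \<open>Hs\<close> and the pairing with a cutoff\<close>

lemma borel_measurable_cnj [measurable]: "cnj \<in> borel_measurable borel"
  by (intro borel_measurable_continuous_onI continuous_intros)

lemma Hs_L2: "u \<in> Hs s \<Longrightarrow> u \<in> L2"
  by (simp add: Hs_def)

lemma cutoff_continuous: "cutoff L \<rho> \<Longrightarrow> continuous_on UNIV \<rho>"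
  by (auto simp: cutoff_def intro: lipschitz_on_continuous_on)

lemma cutoff_mult_L2:
  fixes u :: "real ^ 'n \<Rightarrow> real"
  assumes "u \<in> L2" "cutoff L \<rho>"
  shows "(\<lambda>x. (\<rho> x)\<^sup>2 * u x) \<in> L2"
proof (rule L2_bounded_mult[where C = 1])
  show "(\<lambda>x. (\<rho> x)\<^sup>2) \<in> borel_measurable borel"
    by (intro borel_measurable_continuous_onI continuous_intros cutoff_continuous[OF assms(2)])
  show "\<bar>(\<rho> x)\<^sup>2\<bar> \<le> 1" for x
    using assms(2) by (simp add: cutoff_def power_le_one)
qed (use assms in auto)

lemma integrable_Hs_pairing:
  fixes u v :: "real ^ 'n \<Rightarrow> real"
  assumes u: "u \<in> Hs s" "continuous_on UNIV u" and v: "v \<in> Hs s" "continuous_on UNIV v"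
  shows "integrable lborel (\<lambda>\<xi>. complex_of_real (norm \<xi> powr (2 * s)) * fourier u \<xi> * cnj (fourier v \<xi>))"
proof (rule Bochner_Integration.integrable_bound)
  have [measurable]: "fourier u \<in> borel_measurable borel" "fourier v \<in> borel_measurable borel"
    using u v by (auto intro: fourier_measurable Hs_L2)
  show "integrable lborel (\<lambda>\<xi>. norm \<xi> powr (2 * s) * (cmod (fourier u \<xi>))\<^sup>2 + norm \<xi> powr (2 * s) * (cmod (fourier v \<xi>))\<^sup>2)"
    using u v by (auto simp: Hs_def)
  show "(\<lambda>\<xi>. complex_of_real (norm \<xi> powr (2 * s)) * fourier u \<xi> * cnj (fourier v \<xi>)) \<in> borel_measurable lborel"
    by measurable
  have "norm \<xi> powr (2 * s) * (cmod (fourier u \<xi>) * cmod (fourier v \<xi>))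
     \<le> norm \<xi> powr (2 * s) * ((cmod (fourier u \<xi>))\<^sup>2 + (cmod (fourier v \<xi>))\<^sup>2)" for \<xi>
  proof (rule mult_left_mono)
    have "2 * (cmod (fourier u \<xi>) * cmod (fourier v \<xi>)) \<le> (cmod (fourier u \<xi>))\<^sup>2 + (cmod (fourier v \<xi>))\<^sup>2"
      "0 \<le> cmod (fourier u \<xi>) * cmod (fourier v \<xi>)"
      using sum_squares_bound[of "cmod (fourier u \<xi>)" "cmod (fourier v \<xi>)"] by (simp_all add: mult.assoc)
    then show "cmod (fourier u \<xi>) * cmod (fourier v \<xi>) \<le> (cmod (fourier u \<xi>))\<^sup>2 + (cmod (fourier v \<xi>))\<^sup>2"
      by linarith
  qed simp
  then show "AE \<xi> in lborel. norm (complex_of_real (norm \<xi> powr (2 * s)) * fourier u \<xi> * cnj (fourier v \<xi>))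
     \<le> norm (norm \<xi> powr (2 * s) * (cmod (fourier u \<xi>))\<^sup>2 + norm \<xi> powr (2 * s) * (cmod (fourier v \<xi>))\<^sup>2)"
    by (simp add: norm_mult mult.assoc distrib_left)
qed

text \<open>Carries a pointwise bound on squared increments over to energies, with an error density
  \<open>h\<close> whose first argument is the jump. For linear combinations the squared increment
  of the second function plays the role of \<open>h\<close>.\<close>

lemma jump_energy_le:
  fixes v w :: "real ^ 'n \<Rightarrow> real"
  assumes v[measurable]: "v \<in> borel_measurable borel" and w[measurable]: "w \<in> borel_measurable borel"
    and [measurable]: "\<And>y. h y \<in> borel_measurable borel" "case_prod h \<in> borel_measurable borel"
    and c: "0 \<le> c" and d: "0 \<le> d" and h: "\<And>x y. 0 \<le> h y x"
    and le: "\<And>x y. (v (x + y) - v x)\<^sup>2 \<le> c * (w (x + y) - w x)\<^sup>2 + d * h y x"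
  shows "jump_energy s v \<le> ennreal c * jump_energy s w + ennreal d * (\<integral>\<^sup>+\<omega>. ennreal (levy_weight s \<omega>) * (\<integral>\<^sup>+x. ennreal (h (levy_jump \<omega>) x) \<partial>lborel) \<partial>lborel)"
proof -
  have [measurable]: "case_prod h \<in> borel_measurable (borel \<Otimes>\<^sub>M borel)"
    using assms(4) by (simp add: borel_prod)
  have inner: "(\<integral>\<^sup>+x. ennreal ((v (x + y) - v x)\<^sup>2) \<partial>lborel)
     \<le> ennreal c * (\<integral>\<^sup>+x. ennreal ((w (x + y) - w x)\<^sup>2) \<partial>lborel) + ennreal d * (\<integral>\<^sup>+x. ennreal (h y x) \<partial>lborel)" for y
  proof -
    have "(\<integral>\<^sup>+x. ennreal ((v (x + y) - v x)\<^sup>2) \<partial>lborel) \<le> (\<integral>\<^sup>+x. ennreal c * ennreal ((w (x + y) - w x)\<^sup>2) + ennreal d * ennreal (h y x) \<partial>lborel)"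
      using c d h by (intro nn_integral_mono) (simp add: ennreal_mult[symmetric] ennreal_plus[symmetric] le ennreal_leI del: ennreal_plus)
    then show ?thesis
      by (simp add: nn_integral_add nn_integral_cmult)
  qed
  have "jump_energy s v \<le> (\<integral>\<^sup>+\<omega>. ennreal (levy_weight s \<omega>) * (ennreal c * (\<integral>\<^sup>+x. ennreal ((w (x + levy_jump \<omega>) - w x)\<^sup>2) \<partial>lborel) + ennreal d * (\<integral>\<^sup>+x. ennreal (h (levy_jump \<omega>) x) \<partial>lborel)) \<partial>lborel)"
    unfolding jump_energy_def by (intro nn_integral_mono mult_left_mono inner) simp
  also have "\<dots> = (\<integral>\<^sup>+\<omega>. ennreal c * (ennreal (levy_weight s \<omega>) * (\<integral>\<^sup>+x. ennreal ((w (x + levy_jump \<omega>) - w x)\<^sup>2) \<partial>lborel))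
      + ennreal d * (ennreal (levy_weight s \<omega>) * (\<integral>\<^sup>+x. ennreal (h (levy_jump \<omega>) x) \<partial>lborel)) \<partial>lborel)"
    by (intro nn_integral_cong) (simp add: distrib_left ac_simps)
  also have "\<dots> = ennreal c * jump_energy s w + ennreal d * (\<integral>\<^sup>+\<omega>. ennreal (levy_weight s \<omega>) * (\<integral>\<^sup>+x. ennreal (h (levy_jump \<omega>) x) \<partial>lborel) \<partial>lborel)"
    unfolding jump_energy_def by (subst nn_integral_add) (auto simp: nn_integral_cmult)
  finally show ?thesis .
qed

lemma Hs_lincomb:
  fixes v w :: "real ^ 'n \<Rightarrow> real"
  assumes v: "v \<in> Hs s" "continuous_on UNIV v" and w: "w \<in> Hs s" "continuous_on UNIV w" and s: "0 < s" "s < 1"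
  shows "(\<lambda>x. a * v x + b * w x) \<in> Hs s"
proof -
  have L2: "v \<in> L2" "w \<in> L2"
    using v w by (auto intro: Hs_L2)
  have [measurable]: "v \<in> borel_measurable borel" "w \<in> borel_measurable borel"
    using L2 by (auto intro: L2_measurable)
  have m: "(\<lambda>x. (w (x + y) - w x)\<^sup>2) \<in> borel_measurable borel" "(\<lambda>(y, x). (w (x + y) - w x)\<^sup>2) \<in> borel_measurable borel" for y
  proof -
    show "(\<lambda>x. (w (x + y) - w x)\<^sup>2) \<in> borel_measurable borel"
      by measurable
    have "(\<lambda>(y, x). (w (x + y) - w x)\<^sup>2) \<in> borel_measurable (borel \<Otimes>\<^sub>M borel)"
      by measurable
    then show "(\<lambda>(y, x). (w (x + y) - w x)\<^sup>2) \<in> borel_measurable borel"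
      by (simp add: borel_prod)
  qed
  have "jump_energy s (\<lambda>x. a * v x + b * w x) \<le> ennreal (2 * a\<^sup>2) * jump_energy s v + ennreal (2 * b\<^sup>2) * jump_energy s w"
    unfolding jump_energy_def[of s w]
  proof (rule jump_energy_le)
    fix x y
    have "(a * p + b * q)\<^sup>2 \<le> 2 * a\<^sup>2 * p\<^sup>2 + 2 * b\<^sup>2 * q\<^sup>2" for p q
      using sum_squares_bound[of "a * p" "b * q"] by (simp add: power2_sum power_mult_distrib)
    from this[of "v (x + y) - v x" "w (x + y) - w x"]
    show "(a * v (x + y) + b * w (x + y) - (a * v x + b * w x))\<^sup>2 \<le> 2 * a\<^sup>2 * (v (x + y) - v x)\<^sup>2 + 2 * b\<^sup>2 * (w (x + y) - w x)\<^sup>2"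
      by (simp add: algebra_simps)
  qed (use m in auto)
  also have "\<dots> < \<infinity>"
    using v w L2 Hs_iff_jump_energy_finite[of v s] Hs_iff_jump_energy_finite[of w s] s
    by (simp add: ennreal_mult_less_top)
  finally show ?thesis
    using v w by (subst Hs_iff_jump_energy_finite[OF L2_lincomb[OF L2] _ s]) (auto intro!: continuous_intros)
qed

lemma Hs_energy:
  fixes u :: "real ^ 'n \<Rightarrow> real"
  assumes u: "u \<in> Hs s" "continuous_on UNIV u" and s: "0 < s"
  shows "jump_energy s u = 2 * levy_const s * ennreal (LINT \<xi>|lborel. norm \<xi> powr (2 * s) * (cmod (fourier u \<xi>))\<^sup>2)"
proof -
  have "(\<integral>\<^sup>+\<xi>. ennreal (norm \<xi> powr (2 * s) * (cmod (fourier u \<xi>))\<^sup>2) \<partial>lborel)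
    = ennreal (LINT \<xi>|lborel. norm \<xi> powr (2 * s) * (cmod (fourier u \<xi>))\<^sup>2)"
    using u by (intro nn_integral_eq_integral) (auto simp: Hs_def)
  then show ?thesis
    using jump_energy_eq[OF Hs_L2[OF u(1)] u(2) s] by simp
qed

text \<open>By polarisation, four times the real pairing is the energy of \<open>u + \<phi>\<close>
  minus that of \<open>u - \<phi>\<close>, with \<phi> the squared cutoff times \<open>u\<close>. On
  the jump side \<open>cutoff_square_diff_le\<close> bounds this from below by the cutoff error
  alone. The constant precedes \<open>u\<close>, since it has to serve all solutions of the
  sequence.\<close>

lemma fractional_pairing_cutoff:
  fixes \<rho> :: "real ^ 'n \<Rightarrow> real"
  assumes s: "0 < s" "s < 1" and \<rho>: "cutoff L \<rho>"
  shows "\<exists>C. \<forall>u. u \<in> Hs s \<and> continuous_on UNIV u \<longrightarrow> (\<lambda>x. (\<rho> x)\<^sup>2 * u x) \<in> Hs s \<and>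
     - C * (LINT x|lborel. (u x)\<^sup>2) \<le> Re (LINT \<xi>|lborel. complex_of_real (norm \<xi> powr (2 * s)) * fourier u \<xi> * cnj (fourier (\<lambda>x. (\<rho> x)\<^sup>2 * u x) \<xi>))"
proof -
  obtain K where K: "levy_const s = ennreal K" "0 < K"
    using levy_const_finite[OF s] levy_const_pos[OF s(1)] by (cases "levy_const s") auto
  let ?M = "\<integral>\<^sup>+\<omega>. ennreal (levy_weight s \<omega> * min 1 ((norm (levy_jump \<omega> :: real ^ 'n))\<^sup>2)) \<partial>lborel"
  obtain M where M: "?M = ennreal M" "0 \<le> M"
    using nn_integral_levy_min_finite[OF s, where 'a = "real ^ 'n"] by (cases ?M) auto
  have [measurable]: "\<rho> \<in> borel_measurable borel"
    using cutoff_continuous[OF \<rho>] by (rule borel_measurable_continuous_onI)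
  have r: "0 \<le> \<rho> x" "\<rho> x \<le> 1" for x
    using \<rho> by (auto simp: cutoff_def)
  \<comment> \<open>The cutoff error is at most \<open>2 * (1 + L\<^sup>2) * M\<close> times the
    square norm and enters the energy comparison doubled; dividing by the factor
    \<open>2 * K\<close> of the energies and by the 4 of polarisation gives this value.\<close>
  define C where "C = 2 * (1 + L\<^sup>2) * M / (4 * K)"
  show ?thesis
  proof (intro exI[of _ C] allI impI)
    fix u :: "real ^ 'n \<Rightarrow> real"
    assume "u \<in> Hs s \<and> continuous_on UNIV u"
    then have u: "u \<in> Hs s" and cu: "continuous_on UNIV u" by auto
    have uL2: "u \<in> L2" using u by (rule Hs_L2)
    then have [measurable]: "u \<in> borel_measurable borel"
      by (rule L2_measurable)
    define U where "U = (LINT x|lborel. (u x)\<^sup>2)"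
    have U: "(\<integral>\<^sup>+x. ennreal ((u x)\<^sup>2) \<partial>lborel) = ennreal U"
      unfolding U_def using uL2 by (intro nn_integral_eq_integral) (auto simp: L2_iff_real)
    have U0: "0 \<le> U" unfolding U_def by simp
    define \<phi> where "\<phi> x = (\<rho> x)\<^sup>2 * u x" for x
    have \<phi>L2: "\<phi> \<in> L2"
      unfolding \<phi>_def by (rule cutoff_mult_L2[OF uL2 \<rho>])
    then have [measurable]: "\<phi> \<in> borel_measurable borel"
      by (rule L2_measurable)
    have c\<phi>: "continuous_on UNIV \<phi>"
      unfolding \<phi>_def by (intro continuous_intros cu cutoff_continuous[OF \<rho>])
    define h where "h y x = ((u x)\<^sup>2 + (u (x + y))\<^sup>2) * (\<rho> (x + y) - \<rho> x)\<^sup>2" for y x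
    have hm: "(\<lambda>x. h y x) \<in> borel_measurable borel" "case_prod h \<in> borel_measurable borel" for y
    proof -
      show "(\<lambda>x. h y x) \<in> borel_measurable borel"
        unfolding h_def by measurable
      have "case_prod h \<in> borel_measurable (borel \<Otimes>\<^sub>M borel)"
        unfolding h_def by measurable
      then show "case_prod h \<in> borel_measurable borel"
        by (simp add: borel_prod)
    qed
    have h0: "0 \<le> h y x" for x y
      by (simp add: h_def)
    define H where "H = (\<integral>\<^sup>+\<omega>. ennreal (levy_weight s \<omega>) * (\<integral>\<^sup>+x. ennreal (h (levy_jump \<omega>) x) \<partial>lborel) \<partial>lborel)"
    have H: "H \<le> ennreal (2 * (1 + L\<^sup>2) * M * U)"
      using nn_integral_cutoff_jumps[OF uL2 \<rho> s] M(2) U0 unfolding U M(1) H_def h_def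
      by (simp add: ennreal_mult)
    define wp wm where "wp x = 1 * u x + 1 * \<phi> x" and "wm x = 1 * u x + (-1) * \<phi> x" for x
    have L2: "wp \<in> L2" "wm \<in> L2"
      unfolding wp_def wm_def by (intro L2_lincomb uL2 \<phi>L2)+
    have cont: "continuous_on UNIV wp" "continuous_on UNIV wm"
      unfolding wp_def wm_def by (intro continuous_intros cu c\<phi>)+
    have [measurable]: "wp \<in> borel_measurable borel" "wm \<in> borel_measurable borel"
      using L2 by (auto intro: L2_measurable)
    have Ju: "jump_energy s u < \<infinity>"
      using u Hs_iff_jump_energy_finite[OF uL2 cu s] by simp
    have "jump_energy s \<phi> \<le> ennreal 2 * jump_energy s u + ennreal 8 * H"
      unfolding H_def
    proof (rule jump_energy_le)
      show "(\<phi> (x + y) - \<phi> x)\<^sup>2 \<le> 2 * (u (x + y) - u x)\<^sup>2 + 8 * h y x" for x y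
        unfolding \<phi>_def h_def using cutoff_product_diff_le[OF r(1) r(2) r(1) r(2), of "x + y" "u (x + y)" x "u x"] by (simp only: mult.assoc)
    qed (use hm h0 in auto)
    also have "\<dots> < \<infinity>"
      using Ju H by (auto simp: ennreal_mult_less_top intro: le_less_trans)
    finally have \<phi>: "\<phi> \<in> Hs s"
      using Hs_iff_jump_energy_finite[OF \<phi>L2 c\<phi> s] by simp
    have wHs: "wp \<in> Hs s" "wm \<in> Hs s"
      unfolding wp_def[abs_def] wm_def[abs_def] by (rule Hs_lincomb[OF u cu \<phi> c\<phi> s])+
    have "jump_energy s wm \<le> ennreal 1 * jump_energy s wp + ennreal 2 * H"
      unfolding H_def
    proof (rule jump_energy_le)
      show "(wm (x + y) - wm x)\<^sup>2 \<le> 1 * (wp (x + y) - wp x)\<^sup>2 + 2 * h y x" for x y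
        unfolding wp_def wm_def \<phi>_def h_def using cutoff_square_diff_le[of "u (x + y)" "\<rho> (x + y)" "u x" "\<rho> x"] by (simp add: mult.assoc del: distrib_left_numeral)
    qed (use hm h0 in auto)
    also have "\<dots> \<le> jump_energy s wp + ennreal 2 * ennreal (2 * (1 + L\<^sup>2) * M * U)"
      using H by (intro add_mono mult_left_mono) auto
    finally have le: "jump_energy s wm \<le> jump_energy s wp + ennreal 2 * ennreal (2 * (1 + L\<^sup>2) * M * U)" .
    define Ep Em where "Ep = (LINT \<xi>|lborel. norm \<xi> powr (2 * s) * (cmod (fourier wp \<xi>))\<^sup>2)"
      and "Em = (LINT \<xi>|lborel. norm \<xi> powr (2 * s) * (cmod (fourier wm \<xi>))\<^sup>2)"
    have E0: "0 \<le> Ep" "0 \<le> Em"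
      unfolding Ep_def Em_def by simp_all
    have "ennreal (2 * K * Em) \<le> ennreal (2 * K * Ep + 2 * (2 * (1 + L\<^sup>2) * M * U))"
      using le E0 K(2) M(2) U0 unfolding Hs_energy[OF wHs(1) cont(1) s(1)] Hs_energy[OF wHs(2) cont(2) s(1)] K(1) Ep_def[symmetric] Em_def[symmetric]
      by (simp add: ennreal_mult)
    then have EE: "2 * K * Em \<le> 2 * K * Ep + 2 * (2 * (1 + L\<^sup>2) * M * U)"
      using E0 K(2) M(2) U0 by (subst (asm) ennreal_le_iff) auto
    have "AE \<xi> in lborel. 4 * Re (complex_of_real (norm \<xi> powr (2 * s)) * fourier u \<xi> * cnj (fourier \<phi> \<xi>))
       = norm \<xi> powr (2 * s) * (cmod (fourier wp \<xi>))\<^sup>2 - norm \<xi> powr (2 * s) * (cmod (fourier wm \<xi>))\<^sup>2"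
      using fourier_lincomb[OF uL2 cu \<phi>L2 c\<phi>, of 1 1] fourier_lincomb[OF uL2 cu \<phi>L2 c\<phi>, of 1 "-1"]
    proof eventually_elim
      case (elim \<xi>)
      have "4 * Re (a * cnj b) = (cmod (a + b))\<^sup>2 - (cmod (a - b))\<^sup>2" for a b
        by (simp add: cmod_power2 power2_sum power2_diff algebra_simps)
      from this[of "fourier u \<xi>" "fourier \<phi> \<xi>"] show ?case
        using elim by (simp add: wp_def[abs_def] wm_def[abs_def] mult.assoc right_diff_distrib[symmetric])
    qed
    then have "(LINT \<xi>|lborel. 4 * Re (complex_of_real (norm \<xi> powr (2 * s)) * fourier u \<xi> * cnj (fourier \<phi> \<xi>)))
       = (LINT \<xi>|lborel. norm \<xi> powr (2 * s) * (cmod (fourier wp \<xi>))\<^sup>2 - norm \<xi> powr (2 * s) * (cmod (fourier wm \<xi>))\<^sup>2)"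
      using fourier_measurable[OF uL2 cu] fourier_measurable[OF \<phi>L2 c\<phi>] fourier_measurable[OF L2(1) cont(1)] fourier_measurable[OF L2(2) cont(2)]
      by (intro integral_cong_AE) auto
    also have "\<dots> = Ep - Em"
      unfolding Ep_def Em_def using wHs by (intro Bochner_Integration.integral_diff) (auto simp: Hs_def)
    finally have "4 * Re (LINT \<xi>|lborel. complex_of_real (norm \<xi> powr (2 * s)) * fourier u \<xi> * cnj (fourier \<phi> \<xi>)) = Ep - Em"
      by (simp only: integral_mult_right_zero integral_Re[OF integrable_Hs_pairing[OF u cu \<phi> c\<phi>]])
    moreover have "- (4 * C * U) \<le> Ep - Em"
      using EE K(2) by (simp add: C_def field_simps)
    ultimately have "- C * U \<le> Re (LINT \<xi>|lborel. complex_of_real (norm \<xi> powr (2 * s)) * fourier u \<xi> * cnj (fourier \<phi> \<xi>))"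
      by linarith
    with \<phi> show "(\<lambda>x. (\<rho> x)\<^sup>2 * u x) \<in> Hs s \<and>
     - C * (LINT x|lborel. (u x)\<^sup>2) \<le> Re (LINT \<xi>|lborel. complex_of_real (norm \<xi> powr (2 * s)) * fourier u \<xi> * cnj (fourier (\<lambda>x. (\<rho> x)\<^sup>2 * u x) \<xi>))"
      unfolding \<phi>_def[abs_def] U_def by blast
  qed
qed

section \<open>Differences of solutions\<close>

lemma powr_lipschitz:
  fixes a b M p :: real
  assumes "0 < a" "a \<le> M" "0 < b" "b \<le> M" "1 \<le> p"
  shows "\<bar>b powr p - a powr p\<bar> \<le> p * M powr (p - 1) * \<bar>b - a\<bar>"
proof -
  have *: "b powr p - a powr p \<le> p * M powr (p - 1) * (b - a) \<and> 0 \<le> b powr p - a powr p"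
    if ab: "0 < a" "a < b" "b \<le> M" for a b :: real
  proof -
    have "\<exists>z. a < z \<and> z < b \<and> b powr p - a powr p = (b - a) * (p * z powr (p - 1))"
      using ab by (intro MVT2) (auto intro!: has_real_derivative_powr)
    then obtain z where z: "a < z" "z < b" "b powr p - a powr p = (b - a) * (p * z powr (p - 1))"
      by blast
    have "z powr (p - 1) \<le> M powr (p - 1)"
      using z ab assms(5) by (intro powr_mono2) auto
    then have "(b - a) * (p * z powr (p - 1)) \<le> (b - a) * (p * M powr (p - 1))"
      using ab assms(5) by (intro mult_left_mono) auto
    then show ?thesis
      using z ab assms(5) by (simp add: mult_ac)
  qed
  show ?thesis
    using *[of a b] *[of b a] assms by (cases a b rule: linorder_cases) auto
qed

text \<open>
  The left-hand side is antisymmetric in \<open>a\<close> and \<open>b\<close>, and the multiple of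
  \<open>b\<^bsup>p+1\<^esup> - a\<^bsup>p+1\<^esup>\<close> cancels its first-order part on the diagonal.
\<close>

lemma powr_antisymmetric_remainder:
  fixes a b M p :: real
  assumes "0 < a" "a \<le> M" "0 < b" "b \<le> M" "1 < p"
  shows "\<bar>(b powr p * a - a powr p * b) - (p - 1) / (p + 1) * (b powr (p + 1) - a powr (p + 1))\<bar>
    \<le> 2 * p * M powr (p - 1) * (b - a)\<^sup>2"
proof -
  define h where "h a t = (t powr p * a - a powr p * t) - (p - 1) / (p + 1) * (t powr (p + 1) - a powr (p + 1))" for a t :: real
  have *: "\<bar>h a b\<bar> \<le> 2 * p * M powr (p - 1) * (b - a)\<^sup>2" if ab: "0 < a" "a < b" "b \<le> M" for a b
  proof -
    \<comment> \<open>The derivative of \<open>h a\<close> is a sum of two terms that vanish at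
      \<open>a\<close>, each at most \<open>p * M powr (p - 1) * (b - a)\<close> on the interval.
      With the outer factor \<open>b - a\<close> this is the quadratic bound.\<close>
    have "\<exists>z. a < z \<and> z < b \<and> h a b - h a a
      = (b - a) * (p * z powr (p - 1) * (a - z) + (z powr p - a powr p))"
    proof (rule MVT2[OF ab(2)])
      fix t assume t: "a \<le> t" "t \<le> b"
      then have t0: "0 < t" using ab by linarith
      have tp: "t powr p = t powr (p - 1) * t"
        using t0 powr_add[of t "p - 1" 1] by simp
      have "(h a has_real_derivative ((p * t powr (p - 1)) * a - a powr p * 1)
         - (p - 1) / (p + 1) * ((p + 1) * t powr (p + 1 - 1) - 0)) (at t)"
        unfolding h_def
        by (rule DERIV_diff[OF DERIV_diff[OF DERIV_cmult_right[OF has_real_derivative_powr[OF t0]] DERIV_cmult[OF DERIV_ident]]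
          DERIV_cmult[OF DERIV_diff[OF has_real_derivative_powr[OF t0] DERIV_const]]])
      also have "(p - 1) / (p + 1) * ((p + 1) * t powr (p + 1 - 1) - 0) = (p - 1) * t powr p"
        using assms(5) by simp
      also have "((p * t powr (p - 1)) * a - a powr p * 1) - (p - 1) * t powr p
         = p * t powr (p - 1) * (a - t) + (t powr p - a powr p)"
        by (simp add: tp algebra_simps)
      finally show "(h a has_real_derivative p * t powr (p - 1) * (a - t) + (t powr p - a powr p)) (at t)" .
    qed
    then obtain z where z: "a < z" "z < b" and eq: "h a b - h a a = (b - a) * (p * z powr (p - 1) * (a - z) + (z powr p - a powr p))"
      by blast
    have "\<bar>p * z powr (p - 1) * (a - z)\<bar> \<le> p * M powr (p - 1) * (b - a)"
      unfolding abs_mult using z ab assms(5) by (intro mult_mono) (auto intro!: powr_mono2)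
    moreover have "\<bar>z powr p - a powr p\<bar> \<le> p * M powr (p - 1) * (b - a)"
      by (rule order_trans[OF powr_lipschitz[of a M z p]]) (use z ab assms(5) in \<open>auto intro!: mult_left_mono\<close>)
    ultimately have "\<bar>p * z powr (p - 1) * (a - z) + (z powr p - a powr p)\<bar> \<le> 2 * (p * M powr (p - 1) * (b - a))"
      by linarith
    then have "\<bar>b - a\<bar> * \<bar>p * z powr (p - 1) * (a - z) + (z powr p - a powr p)\<bar> \<le> (b - a) * (2 * (p * M powr (p - 1) * (b - a)))"
      using ab by (intro mult_mono) auto
    moreover have "h a a = 0" by (simp add: h_def)
    ultimately show ?thesis
      using eq by (simp add: abs_mult power2_eq_square mult_ac)
  qed
  have anti: "h a b = - h b a"
    by (simp add: h_def algebra_simps)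
  have "\<bar>h a b\<bar> \<le> 2 * p * M powr (p - 1) * (b - a)\<^sup>2"
  proof (cases a b rule: linorder_cases)
    case equal then show ?thesis by (simp add: h_def)
  next
    case less then show ?thesis using * assms by blast
  next
    case greater then show ?thesis using *[of b a] assms anti by (simp add: power2_commute)
  qed
  then show ?thesis by (simp add: h_def)
qed

section \<open>Testing the equation with translates\<close>

lemma one_minus_cos_le: "1 - cos t \<le> t\<^sup>2 / 2" for t :: real
proof -
  have "\<bar>sin (t / 2)\<bar> \<le> \<bar>t / 2\<bar>"
    by (rule abs_sin_x_le_abs_x)
  then have "(sin (t / 2))\<^sup>2 \<le> (t / 2)\<^sup>2"
    by (metis abs_ge_zero power2_abs power_mono)
  moreover have "cos t = 1 - 2 * (sin (t / 2))\<^sup>2"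
    using cos_double_sin[of "t / 2"] by simp
  ultimately show ?thesis
    by (simp add: power_divide)
qed

lemma Hs_translate:
  fixes u :: "real ^ 'n \<Rightarrow> real"
  assumes u: "u \<in> Hs s" "continuous_on UNIV u"
  shows "(\<lambda>x. u (x + y)) \<in> Hs s"
proof -
  have L2: "u \<in> L2" "(\<lambda>x. u (x + y)) \<in> L2"
    using u by (auto intro: Hs_L2 L2_translate)
  have [measurable]: "fourier u \<in> borel_measurable borel" "fourier (\<lambda>x. u (x + y)) \<in> borel_measurable borel"
    using L2 u by (auto intro!: fourier_measurable continuous_translate)
  have "AE \<xi> in lborel. norm \<xi> powr (2 * s) * (cmod (fourier u \<xi>))\<^sup>2 = norm \<xi> powr (2 * s) * (cmod (fourier (\<lambda>x. u (x + y)) \<xi>))\<^sup>2"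
    using fourier_translate[OF L2(1) u(2), of y] by eventually_elim (simp add: norm_mult)
  then have "integrable lborel (\<lambda>\<xi>. norm \<xi> powr (2 * s) * (cmod (fourier (\<lambda>x. u (x + y)) \<xi>))\<^sup>2)"
    by (rule integrable_cong_AE[THEN iffD1, rotated 2]) (use u in \<open>auto simp: Hs_def\<close>)
  then show ?thesis
    using L2 by (simp add: Hs_def)
qed

text \<open>Factoring out \<open>u\<close> leaves the multiplier
  \<open>u x powr (p - 1) - V x\<close>, bounded because \<open>u\<close> and \<open>V\<close> are.
  The reaction term can then be translated and paired with any square-integrable function.\<close>

lemma bounded_weak_solution_nonlinearity_L2:
  fixes u V :: "real ^ 'n \<Rightarrow> real"
  assumes u: "u \<in> L2" and M: "\<And>x. 0 < u x" "\<And>x. u x \<le> M" and p: "1 < p"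
    and [measurable]: "V \<in> borel_measurable borel" and V: "\<And>x. \<bar>V x\<bar> \<le> B"
  shows "(\<lambda>x. u x powr p - V x * u x) \<in> L2"
proof -
  have [measurable]: "u \<in> borel_measurable borel"
    using u by (rule L2_measurable)
  have "(\<lambda>x. (u x powr (p - 1) - V x) * u x) \<in> L2"
  proof (rule L2_bounded_mult[OF u])
    fix x
    have "u x powr (p - 1) \<le> M powr (p - 1)"
      using M[of x] p by (intro powr_mono2) auto
    then show "\<bar>u x powr (p - 1) - V x\<bar> \<le> M powr (p - 1) + B"
      using V[of x] powr_ge_zero[of "u x" "p - 1"] by linarith
  qed measurable
  moreover have "(u x powr (p - 1) - V x) * u x = u x powr p - V x * u x" for x
    using powr_add[of "u x" "p - 1" 1] M(1)[of x] by (simp add: algebra_simps)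
  ultimately show ?thesis by simp
qed

text \<open>The transform of the translate is that of \<open>u\<close> times a character, so the
  pairing sees only the squared modulus, and its real part carries the cosine. The value is even in
  \<open>y\<close>: the shifts by \<open>y\<close> and \<open>- y\<close> give the same number,
  which is the cancellation of the nonlocal term.\<close>

lemma weak_solution_translate:
  fixes u V :: "real ^ 'n \<Rightarrow> real"
  assumes sol: "weak_solution s p V \<epsilon> u" and cu: "continuous_on UNIV u"
  shows "(LINT x|lborel. (u x powr p - V x * u x) * u (x + y))
    = \<epsilon> powr (2 * s) * (LINT \<xi>|lborel. norm \<xi> powr (2 * s) * (cmod (fourier u \<xi>))\<^sup>2 * cos (\<xi> \<bullet> y))"
proof -
  have u: "u \<in> Hs s" and uL2: "u \<in> L2"
    using sol by (auto simp: weak_solution_def intro: Hs_L2)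
  have uy: "(\<lambda>x. u (x + y)) \<in> Hs s"
    by (rule Hs_translate[OF u cu])
  note int = integrable_Hs_pairing[OF u cu uy continuous_translate[OF cu]]
  have "Re (complex_of_real (\<epsilon> powr (2 * s)) *
     (LINT \<xi>|lborel. complex_of_real (norm \<xi> powr (2 * s)) * fourier u \<xi> * cnj (fourier (\<lambda>x. u (x + y)) \<xi>)))
     = (LINT x|lborel. (u x powr p - V x * u x) * u (x + y))"
    using sol uy by (simp add: weak_solution_def)
  then have "(LINT x|lborel. (u x powr p - V x * u x) * u (x + y))
     = \<epsilon> powr (2 * s) * (LINT \<xi>|lborel. Re (complex_of_real (norm \<xi> powr (2 * s)) * fourier u \<xi> * cnj (fourier (\<lambda>x. u (x + y)) \<xi>)))"
    using integral_Re[OF int] by simp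
  also have "(LINT \<xi>|lborel. Re (complex_of_real (norm \<xi> powr (2 * s)) * fourier u \<xi> * cnj (fourier (\<lambda>x. u (x + y)) \<xi>)))
     = (LINT \<xi>|lborel. norm \<xi> powr (2 * s) * (cmod (fourier u \<xi>))\<^sup>2 * cos (\<xi> \<bullet> y))"
  proof (rule integral_cong_AE)
    have [measurable]: "fourier u \<in> borel_measurable borel" "fourier (\<lambda>x. u (x + y)) \<in> borel_measurable borel"
      using uL2 cu by (auto intro!: fourier_measurable continuous_translate L2_translate)
    show "(\<lambda>\<xi>. Re (complex_of_real (norm \<xi> powr (2 * s)) * fourier u \<xi> * cnj (fourier (\<lambda>x. u (x + y)) \<xi>))) \<in> borel_measurable lborel"
      "(\<lambda>\<xi>. norm \<xi> powr (2 * s) * (cmod (fourier u \<xi>))\<^sup>2 * cos (\<xi> \<bullet> y)) \<in> borel_measurable lborel"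
      by measurable
    show "AE \<xi> in lborel. Re (complex_of_real (norm \<xi> powr (2 * s)) * fourier u \<xi> * cnj (fourier (\<lambda>x. u (x + y)) \<xi>))
       = norm \<xi> powr (2 * s) * (cmod (fourier u \<xi>))\<^sup>2 * cos (\<xi> \<bullet> y)"
      using fourier_translate[OF uL2 cu, of y]
    proof eventually_elim
      case (elim \<xi>)
      have "complex_of_real (norm \<xi> powr (2 * s)) * fourier u \<xi> * cnj (fourier (\<lambda>x. u (x + y)) \<xi>)
         = complex_of_real (norm \<xi> powr (2 * s)) * (fourier u \<xi> * cnj (fourier u \<xi>)) * cis (- (\<xi> \<bullet> y))"
        unfolding elim by (simp add: cis_cnj inner_commute)
      also have "\<dots> = complex_of_real (norm \<xi> powr (2 * s) * (cmod (fourier u \<xi>))\<^sup>2) * cis (- (\<xi> \<bullet> y))"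
        by (simp add: complex_norm_square[symmetric])
      finally have eq: "complex_of_real (norm \<xi> powr (2 * s)) * fourier u \<xi> * cnj (fourier (\<lambda>x. u (x + y)) \<xi>)
         = complex_of_real (norm \<xi> powr (2 * s) * (cmod (fourier u \<xi>))\<^sup>2) * cis (- (\<xi> \<bullet> y))" .
      show ?case
        unfolding eq by simp
    qed
  qed
  finally show ?thesis .
qed

text \<open>
  Testing with \<open>2u - u(\<cdot> + y) - u(\<cdot> - y)\<close> bounds the \<open>H\<^sup>s\<close> energy of the difference
  \<open>u(\<cdot> + y) - u\<close> by its \<open>L\<^sup>2\<close> norm. Splitting frequencies at a large radius, the high ones are
  absorbed by this energy and the low ones contribute \<open>O(\<bar>y\<bar>\<^sup>2)\<close>.
\<close>

lemma weak_solution_difference_bound: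
  fixes u V :: "real ^ 'n \<Rightarrow> real"
  assumes s: "0 < s" and p: "1 < p" and \<epsilon>: "0 < \<epsilon>"
    and sol: "weak_solution s p V \<epsilon> u" and cu: "continuous_on UNIV u"
    and M: "\<And>x. 0 < u x" "\<And>x. u x \<le> M"
    and [measurable]: "V \<in> borel_measurable borel"
    and VB: "\<And>x. \<bar>V x\<bar> \<le> B" and VL: "\<And>x y. \<bar>V (x + y) - V x\<bar> \<le> L * norm y"
  shows "\<exists>C. \<forall>y. (LINT x|lborel. (u (x + y) - u x)\<^sup>2) \<le> C * (norm y)\<^sup>2"
proof -
  have u: "u \<in> Hs s" and uL2: "u \<in> L2"
    using sol by (auto simp: weak_solution_def intro: Hs_L2)
  have [measurable]: "u \<in> borel_measurable borel"
    using uL2 by (rule L2_measurable)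
  have [measurable]: "fourier u \<in> borel_measurable borel"
    by (rule fourier_measurable[OF uL2 cu])
  define c where "c = \<epsilon> powr (2 * s)"
  have c: "0 < c" using \<epsilon> by (simp add: c_def)
  have M0: "0 < M" using M[of 0] by linarith
  have B0: "0 \<le> B" using VB[of 0] by linarith
  define f where "f x = u x powr p - V x * u x" for x
  have fL2: "f \<in> L2"
    unfolding f_def using bounded_weak_solution_nonlinearity_L2[OF uL2 M p _ VB] by simp
  have [measurable]: "f \<in> borel_measurable borel"
    using fL2 by (rule L2_measurable)
  define g where "g \<xi> = (cmod (fourier u \<xi>))\<^sup>2" for \<xi>
  have [measurable]: "g \<in> borel_measurable borel"
    unfolding g_def[abs_def] by measurable
  have g0: "0 \<le> g \<xi>" for \<xi> by (simp add: g_def)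
  have intA: "integrable lborel (\<lambda>\<xi>. norm \<xi> powr (2 * s) * g \<xi>)"
    using u by (simp add: Hs_def g_def)
  have intg: "integrable lborel g"
  proof -
    have "fourier u \<in> L2"
      using is_fourier_L2_fourier[OF uL2 cu] by (simp add: is_fourier_L2_def)
    then show ?thesis
      by (simp add: L2_def g_def[abs_def])
  qed
  have int_cos: "integrable lborel (\<lambda>\<xi>. h \<xi> * cos (\<xi> \<bullet> y))" if "integrable lborel h" for h and y :: "real ^ 'n"
  proof (rule Bochner_Integration.integrable_bound[OF that])
    have [measurable]: "h \<in> borel_measurable borel"
      using borel_measurable_integrable[OF that] by simp
    show "(\<lambda>\<xi>. h \<xi> * cos (\<xi> \<bullet> y)) \<in> borel_measurable lborel"
      by measurable
  qed (simp add: abs_mult mult_left_le)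
  define U where "U = (LINT x|lborel. (u x)\<^sup>2)"
  define W where "W = (LINT \<xi>|lborel. g \<xi>)"
  have U0: "0 \<le> U" and W0: "0 \<le> W"
    by (simp_all add: U_def W_def g0)
  define E where "E y = (LINT x|lborel. (u (x + y) - u x)\<^sup>2)" for y
  \<comment> \<open>Half of the \<open>Hs\<close> energy of the increment, since the squared
    multiplier is \<open>2 * (1 - cos (\<xi> \<bullet> y))\<close>.\<close>
  define F where "F y = (LINT \<xi>|lborel. norm \<xi> powr (2 * s) * g \<xi> - norm \<xi> powr (2 * s) * g \<xi> * cos (\<xi> \<bullet> y))" for y
  define A where "A y = (LINT x|lborel. f x * u (x + y))" for y
  have A: "A y = c * (LINT \<xi>|lborel. norm \<xi> powr (2 * s) * g \<xi> * cos (\<xi> \<bullet> y))" for y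
    unfolding A_def f_def c_def g_def by (rule weak_solution_translate[OF sol cu])
  have dL2: "(\<lambda>x. u (x + y) - u x) \<in> L2" for y
    using L2_lincomb[OF L2_translate[OF uL2, of y] uL2, of 1 "-1"] by simp
  have dfL2: "(\<lambda>x. f (x + y) - f x) \<in> L2" for y
    using L2_lincomb[OF L2_translate[OF fL2, of y] fL2, of 1 "-1"] by simp
  have E_eq: "E y = (LINT \<xi>|lborel. 2 * (g \<xi> - g \<xi> * cos (\<xi> \<bullet> y)))" for y
  proof -
    have "ennreal (E y) = (\<integral>\<^sup>+x. ennreal ((u (x + y) - u x)\<^sup>2) \<partial>lborel)"
      unfolding E_def using dL2[of y] by (intro nn_integral_eq_integral[symmetric]) (auto simp: L2_iff_real)
    also have "\<dots> = (\<integral>\<^sup>+\<xi>. ennreal (2 * (g \<xi> - g \<xi> * cos (\<xi> \<bullet> y))) \<partial>lborel)"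
      unfolding nn_integral_diff_translate[OF uL2 cu] by (simp add: g_def algebra_simps)
    also have "\<dots> = ennreal (LINT \<xi>|lborel. 2 * (g \<xi> - g \<xi> * cos (\<xi> \<bullet> y)))"
      using intg int_cos[OF intg] g0 by (intro nn_integral_eq_integral) (auto intro!: mult_left_le)
    finally show ?thesis
      using g0 by (subst (asm) ennreal_inj) (auto simp: E_def intro!: integral_nonneg_AE AE_I2 mult_left_le)
  qed
  have cF: "c * F y = A 0 - A y" for y
    unfolding A F_def using intA int_cos[OF intA] by (simp add: algebra_simps)
  have A_sym: "A (- y) = A y" for y
    unfolding A by simp
  \<comment> \<open>Expanding and translating yields \<open>A 0 - A (- y) - A y + A 0\<close>;
    evenness of \<open>A\<close> merges the middle terms.\<close>
  have A_diff: "2 * (A 0 - A y) = (LINT x|lborel. (f (x + y) - f x) * (u (x + y) - u x))" for y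
  proof -
    have i: "integrable lborel (\<lambda>x. f (x + y) * u (x + y))" "integrable lborel (\<lambda>x. f (x + y) * u x)"
      "integrable lborel (\<lambda>x. f x * u (x + y))" "integrable lborel (\<lambda>x. f x * u x)"
      by (intro L2_mult_integrable L2_translate fL2 uL2)+
    have "(LINT x|lborel. (f (x + y) - f x) * (u (x + y) - u x))
      = (LINT x|lborel. (f (x + y) * u (x + y) - f (x + y) * u x) - (f x * u (x + y) - f x * u x))"
      by (simp add: algebra_simps)
    also have "\<dots> = ((LINT x|lborel. f (x + y) * u (x + y)) - (LINT x|lborel. f (x + y) * u x))
       - ((LINT x|lborel. f x * u (x + y)) - (LINT x|lborel. f x * u x))"
      using i by simp
    also have "(LINT x|lborel. f (x + y) * u (x + y)) = A 0"
      using integral_lborel_translate[of "\<lambda>x. f x * u x" y] by (simp add: A_def)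
    also have "(LINT x|lborel. f (x + y) * u x) = A (- y)"
      using integral_lborel_translate[of "\<lambda>x. f x * u (x + - y)" y] by (simp add: A_def)
    finally show ?thesis
      using A_sym[of y] by (simp add: A_def)
  qed
  \<comment> \<open>The summands come from the Lipschitz constant of the power on the range of
    \<open>u\<close>, from the bound on \<open>V\<close>, and from Young's inequality for the term
    with the increment of \<open>V\<close>.\<close>
  define C1 where "C1 = p * M powr (p - 1) + B + 1"
  have C1: "C1 > 0" using p B0 by (simp add: C1_def add_nonneg_pos)
  have cF_le: "2 * c * F y \<le> C1 * E y + L\<^sup>2 * (norm y)\<^sup>2 * U" for y
  proof -
    have "(f (x + y) - f x) * (u (x + y) - u x) \<le> C1 * (u (x + y) - u x)\<^sup>2 + L\<^sup>2 * (norm y)\<^sup>2 * (u x)\<^sup>2" for x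
    proof -
      define a b where "a = u x" and "b = u (x + y)"
      have ab: "0 < a" "a \<le> M" "0 < b" "b \<le> M"
        using M by (auto simp: a_def b_def)
      have "(f (x + y) - f x) * (b - a) = (b powr p - a powr p) * (b - a) - V (x + y) * (b - a)\<^sup>2 - (V (x + y) - V x) * a * (b - a)"
        by (simp add: f_def a_def b_def power2_eq_square algebra_simps)
      moreover have "(b powr p - a powr p) * (b - a) \<le> (p * M powr (p - 1)) * (b - a)\<^sup>2"
      proof -
        have "(b powr p - a powr p) * (b - a) \<le> \<bar>b powr p - a powr p\<bar> * \<bar>b - a\<bar>"
          by (simp add: abs_mult[symmetric])
        also have "\<dots> \<le> (p * M powr (p - 1) * \<bar>b - a\<bar>) * \<bar>b - a\<bar>"
          using p by (intro mult_right_mono powr_lipschitz ab) auto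
        finally show ?thesis
          by (simp add: power2_eq_square abs_mult_self_eq mult.assoc)
      qed
      moreover have "- (V (x + y) * (b - a)\<^sup>2) \<le> B * (b - a)\<^sup>2"
        using mult_right_mono[of "- V (x + y)" B "(b - a)\<^sup>2"] VB[of "x + y"] by simp
      moreover have "- ((V (x + y) - V x) * a * (b - a)) \<le> (b - a)\<^sup>2 + L\<^sup>2 * (norm y)\<^sup>2 * a\<^sup>2"
      proof -
        define v where "v = V (x + y) - V x"
        have "\<bar>v\<bar>\<^sup>2 \<le> (L * norm y)\<^sup>2"
          unfolding v_def by (rule power_mono[OF VL]) simp
        then have "v\<^sup>2 * a\<^sup>2 \<le> (L\<^sup>2 * (norm y)\<^sup>2) * a\<^sup>2"
          by (intro mult_right_mono) (auto simp: power_mult_distrib)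
        moreover have "0 \<le> (v * a + (b - a))\<^sup>2"
          by simp
        then have "- (2 * (v * a * (b - a))) \<le> v\<^sup>2 * a\<^sup>2 + (b - a)\<^sup>2"
          by (simp add: power2_sum power_mult_distrib)
        moreover have "0 \<le> v\<^sup>2 * a\<^sup>2 + (b - a)\<^sup>2"
          by simp
        ultimately show ?thesis
          unfolding v_def[symmetric] by linarith
      qed
      ultimately have "(f (x + y) - f x) * (b - a) \<le> (p * M powr (p - 1)) * (b - a)\<^sup>2 + B * (b - a)\<^sup>2 + ((b - a)\<^sup>2 + L\<^sup>2 * (norm y)\<^sup>2 * a\<^sup>2)"
        by linarith
      then show ?thesis
        by (simp add: C1_def a_def b_def distrib_right)
    qed
    then have "(LINT x|lborel. (f (x + y) - f x) * (u (x + y) - u x))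
      \<le> (LINT x|lborel. C1 * (u (x + y) - u x)\<^sup>2 + L\<^sup>2 * (norm y)\<^sup>2 * (u x)\<^sup>2)"
      using dL2[of y] uL2 by (intro integral_mono L2_mult_integrable dfL2) (auto simp: L2_iff_real)
    also have "\<dots> = C1 * E y + L\<^sup>2 * (norm y)\<^sup>2 * U"
      using dL2[of y] uL2 by (subst Bochner_Integration.integral_add) (auto simp: L2_iff_real E_def U_def)
    finally show ?thesis
      using A_diff[of y] cF[of y] by (simp add: mult.assoc)
  qed
  \<comment> \<open>Above this radius \<open>c / C1 * norm \<xi> powr (2 * s)\<close> is at least 2,
    so \<open>c / C1 * F y\<close> controls the high frequencies of \<open>E y\<close>. By
    \<open>cF_le\<close> that quantity is at most \<open>E y / 2\<close> plus a quadratic term, and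
    the half is absorbed on the left.\<close>
  define R where "R = (2 * C1 / c) powr (1 / (2 * s))"
  have R: "R > 0" using C1 c by (simp add: R_def)
  have Rs: "R powr (2 * s) = 2 * C1 / c"
    unfolding R_def powr_powr using s C1 c by simp
  have E_le: "E y \<le> R\<^sup>2 * (norm y)\<^sup>2 * W + c / C1 * F y" for y
  proof -
    have "2 * (g \<xi> - g \<xi> * cos (\<xi> \<bullet> y)) \<le> R\<^sup>2 * (norm y)\<^sup>2 * g \<xi>
      + c / C1 * (norm \<xi> powr (2 * s) * g \<xi> - norm \<xi> powr (2 * s) * g \<xi> * cos (\<xi> \<bullet> y))" for \<xi>
    proof -
      define k where "k = 1 - cos (\<xi> \<bullet> y)"
      have k0: "0 \<le> k" by (simp add: k_def)
      have "2 * k \<le> R\<^sup>2 * (norm y)\<^sup>2 + c / C1 * (norm \<xi> powr (2 * s) * k)"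
      proof (cases "norm \<xi> \<le> R")
        case True
        have "2 * k \<le> (\<xi> \<bullet> y)\<^sup>2"
          using one_minus_cos_le[of "\<xi> \<bullet> y"] by (simp add: k_def)
        also have "\<dots> \<le> (R * norm y)\<^sup>2"
        proof -
          have "\<bar>\<xi> \<bullet> y\<bar> \<le> R * norm y"
            using Cauchy_Schwarz_ineq2[of \<xi> y] mult_right_mono[OF True, of "norm y"] by simp
          then have "\<bar>\<xi> \<bullet> y\<bar>\<^sup>2 \<le> (R * norm y)\<^sup>2"
            by (rule power_mono) simp
          then show ?thesis by simp
        qed
        finally have "2 * k \<le> R\<^sup>2 * (norm y)\<^sup>2"
          by (simp add: power_mult_distrib)
        moreover have "0 \<le> c / C1 * (norm \<xi> powr (2 * s) * k)"
          using c C1 k0 by simp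
        ultimately show ?thesis by linarith
      next
        case False
        have "2 * C1 / c \<le> norm \<xi> powr (2 * s)"
          unfolding Rs[symmetric] using False R s by (intro powr_mono2) auto
        then have "2 \<le> c / C1 * norm \<xi> powr (2 * s)"
          using c C1 by (simp add: field_simps)
        then have "2 * k \<le> (c / C1 * norm \<xi> powr (2 * s)) * k"
          using k0 by (rule mult_right_mono)
        moreover have "0 \<le> R\<^sup>2 * (norm y)\<^sup>2" by simp
        ultimately show ?thesis by (simp only: mult.assoc)
      qed
      then have "2 * k * g \<xi> \<le> (R\<^sup>2 * (norm y)\<^sup>2 + c / C1 * (norm \<xi> powr (2 * s) * k)) * g \<xi>"
        using g0 by (rule mult_right_mono)
      then show ?thesis
        by (simp add: k_def algebra_simps)
    qed
    then have "E y \<le> (LINT \<xi>|lborel. R\<^sup>2 * (norm y)\<^sup>2 * g \<xi>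
      + c / C1 * (norm \<xi> powr (2 * s) * g \<xi> - norm \<xi> powr (2 * s) * g \<xi> * cos (\<xi> \<bullet> y)))"
      unfolding E_eq using intg intA int_cos[OF intg] int_cos[OF intA]
      by (intro integral_mono Bochner_Integration.integrable_add integrable_mult_right Bochner_Integration.integrable_diff) auto
    also have "\<dots> = R\<^sup>2 * (norm y)\<^sup>2 * W + c / C1 * F y"
      using intg intA int_cos[OF intA]
      by (subst Bochner_Integration.integral_add) (auto simp: W_def F_def)
    finally show ?thesis .
  qed
  have "E y \<le> (2 * R\<^sup>2 * W + L\<^sup>2 * U / C1) * (norm y)\<^sup>2" for y
  proof -
    have "c / C1 * F y = (2 * c * F y) / (2 * C1)"
      using C1 by simp
    also have "\<dots> \<le> (C1 * E y + L\<^sup>2 * (norm y)\<^sup>2 * U) / (2 * C1)"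
      using C1 cF_le[of y] by (intro divide_right_mono) auto
    also have "\<dots> = E y / 2 + L\<^sup>2 * (norm y)\<^sup>2 * U / (2 * C1)"
      using C1 by (simp add: field_simps)
    finally have "E y \<le> R\<^sup>2 * (norm y)\<^sup>2 * W + (E y / 2 + L\<^sup>2 * (norm y)\<^sup>2 * U / (2 * C1))"
      using E_le[of y] by linarith
    then have "E y \<le> 2 * (R\<^sup>2 * (norm y)\<^sup>2 * W) + 2 * (L\<^sup>2 * (norm y)\<^sup>2 * U / (2 * C1))"
      by linarith
    also have "\<dots> = (2 * R\<^sup>2 * W + L\<^sup>2 * U / C1) * (norm y)\<^sup>2"
      using C1 by (simp add: field_simps)
    finally show ?thesis .
  qed
  then show ?thesis
    unfolding E_def by blast
qed

text \<open>The tested equation and translation invariance show that the terms subtracted from the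
  integrand have integral zero. What is left is pointwise quadratic in the increment of
  \<open>u\<close> and \<open>norm y * u x\<close>, and the increment is of order
  \<open>norm y\<close> in L2 by the preceding bound.\<close>

lemma weak_solution_potential_difference_bound:
  fixes u V :: "real ^ 'n \<Rightarrow> real"
  assumes s: "0 < s" and p: "1 < p" and \<epsilon>: "0 < \<epsilon>"
    and sol: "weak_solution s p V \<epsilon> u" and cu: "continuous_on UNIV u"
    and M: "\<And>x. 0 < u x" "\<And>x. u x \<le> M"
    and [measurable]: "V \<in> borel_measurable borel"
    and VB: "\<And>x. \<bar>V x\<bar> \<le> B" and VL: "\<And>x y. \<bar>V (x + y) - V x\<bar> \<le> L * norm y"
  shows "\<exists>C. \<forall>y. \<bar>LINT x|lborel. (V (x + y) - V x) * (u x)\<^sup>2\<bar> \<le> C * (norm y)\<^sup>2"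
proof -
  have uL2: "u \<in> L2"
    using sol by (auto simp: weak_solution_def intro: Hs_L2)
  have [measurable]: "u \<in> borel_measurable borel"
    using uL2 by (rule L2_measurable)
  define f where "f x = u x powr p - V x * u x" for x
  have fL2: "f \<in> L2"
    unfolding f_def using bounded_weak_solution_nonlinearity_L2[OF uL2 M p _ VB] by simp
  have [measurable]: "f \<in> borel_measurable borel"
    using fL2 by (rule L2_measurable)
  have pL2: "(\<lambda>x. u x powr p) \<in> L2"
    using bounded_weak_solution_nonlinearity_L2[OF uL2 M p, of "\<lambda>_. 0" 0] by simp
  obtain C where C: "\<And>y. (LINT x|lborel. (u (x + y) - u x)\<^sup>2) \<le> C * (norm y)\<^sup>2"
    using weak_solution_difference_bound[OF s p \<epsilon> sol cu M _ VB VL] by auto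
  define U where "U = (LINT x|lborel. (u x)\<^sup>2)"
  define q where "q = (p - 1) / (p + 1)"
  define K where "K = 2 * p * M powr (p - 1)"
  have K0: "0 \<le> K" using p by (simp add: K_def)
  have "\<bar>LINT x|lborel. (V (x + y) - V x) * (u x)\<^sup>2\<bar> \<le> ((K + 1) * C + L\<^sup>2 * U) * (norm y)\<^sup>2" for y
  proof -
    have dL2: "(\<lambda>x. u (x + y) - u x) \<in> L2"
      using L2_lincomb[OF L2_translate[OF uL2, of y] uL2, of 1 "-1"] by simp
    \<comment> \<open>Inserting \<open>f\<close> turns \<open>r\<close> into the remainder of
      \<open>powr_antisymmetric_remainder\<close> minus
      \<open>(V (x + y) - V x) * u x * (u (x + y) - u x)\<close>; both are second order.\<close>
    define r where "r x = (V (x + y) - V x) * (u x)\<^sup>2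
       - (f x * u (x + y) - f (x + y) * u x) - q * (u (x + y) powr p * u (x + y) - u x powr p * u x)" for x
    have iV: "integrable lborel (\<lambda>x. (V (x + y) - V x) * (u x)\<^sup>2)"
    proof -
      have "(\<lambda>x. (V (x + y) - V x) * u x) \<in> L2"
        by (rule L2_bounded_mult[OF uL2 _ VL]) measurable
      from L2_mult_integrable[OF this uL2] show ?thesis
        by (simp add: power2_eq_square mult.assoc)
    qed
    have i1: "integrable lborel (\<lambda>x. f x * u (x + y))" "integrable lborel (\<lambda>x. f (x + y) * u x)"
      "integrable lborel (\<lambda>x. u (x + y) powr p * u (x + y))" "integrable lborel (\<lambda>x. u x powr p * u x)"
      by (intro L2_mult_integrable L2_translate[of "\<lambda>x. u x powr p"] L2_translate[OF fL2] L2_translate[OF uL2] fL2 uL2 pL2)+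
    have z1: "(LINT x|lborel. f x * u (x + y)) = (LINT x|lborel. f (x + y) * u x)"
    proof -
      have "(LINT x|lborel. f x * u (x + y)) = (LINT x|lborel. f x * u (x + - y))"
        unfolding f_def weak_solution_translate[OF sol cu] by simp
      also have "\<dots> = (LINT x|lborel. f (x + y) * u x)"
        using integral_lborel_translate[of "\<lambda>x. f x * u (x + - y)" y] by simp
      finally show ?thesis .
    qed
    have z2: "(LINT x|lborel. u (x + y) powr p * u (x + y)) = (LINT x|lborel. u x powr p * u x)"
      using integral_lborel_translate[of "\<lambda>x. u x powr p * u x" y] by simp
    have ir: "integrable lborel r"
      unfolding r_def using iV i1 by auto
    have "(LINT x|lborel. r x) = (LINT x|lborel. (V (x + y) - V x) * (u x)\<^sup>2)
       - ((LINT x|lborel. f x * u (x + y)) - (LINT x|lborel. f (x + y) * u x))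
       - q * ((LINT x|lborel. u (x + y) powr p * u (x + y)) - (LINT x|lborel. u x powr p * u x))"
      unfolding r_def using iV i1 by simp
    then have eq: "(LINT x|lborel. (V (x + y) - V x) * (u x)\<^sup>2) = (LINT x|lborel. r x)"
      using z1 z2 by simp
    have "\<bar>r x\<bar> \<le> (K + 1) * (u (x + y) - u x)\<^sup>2 + (L\<^sup>2 * (norm y)\<^sup>2) * (u x)\<^sup>2" for x
    proof -
      define a b v where "a = u x" and "b = u (x + y)" and "v = V (x + y) - V x"
      have ab: "0 < a" "a \<le> M" "0 < b" "b \<le> M"
        using M by (auto simp: a_def b_def)
      have pw: "t powr (p + 1) = t powr p * t" if "0 < t" for t
        using that by (simp add: powr_add)
      have "r x = ((b powr p * a - a powr p * b) - q * (b powr (p + 1) - a powr (p + 1))) - v * a * (b - a)"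
        unfolding pw[OF ab(1)] pw[OF ab(3)]
        by (simp add: r_def f_def a_def b_def v_def power2_eq_square algebra_simps)
      moreover have "\<bar>(b powr p * a - a powr p * b) - q * (b powr (p + 1) - a powr (p + 1))\<bar> \<le> K * (b - a)\<^sup>2"
        unfolding q_def K_def by (rule powr_antisymmetric_remainder[OF ab p])
      moreover have "\<bar>v * a * (b - a)\<bar> \<le> (b - a)\<^sup>2 + (L\<^sup>2 * (norm y)\<^sup>2) * a\<^sup>2"
      proof -
        have "\<bar>v\<bar>\<^sup>2 \<le> (L * norm y)\<^sup>2"
          unfolding v_def by (rule power_mono[OF VL]) simp
        then have "v\<^sup>2 * a\<^sup>2 \<le> (L\<^sup>2 * (norm y)\<^sup>2) * a\<^sup>2"
          by (intro mult_right_mono) (auto simp: power_mult_distrib)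
        moreover have "2 * (\<bar>v * a\<bar> * \<bar>b - a\<bar>) \<le> v\<^sup>2 * a\<^sup>2 + (b - a)\<^sup>2"
          using sum_squares_bound[of "\<bar>v * a\<bar>" "\<bar>b - a\<bar>"] by (simp add: power_mult_distrib mult.assoc)
        moreover have "0 \<le> \<bar>v * a\<bar> * \<bar>b - a\<bar>"
          by simp
        ultimately show ?thesis
          unfolding abs_mult[of "v * a"] by linarith
      qed
      ultimately have "\<bar>r x\<bar> \<le> K * (b - a)\<^sup>2 + ((b - a)\<^sup>2 + (L\<^sup>2 * (norm y)\<^sup>2) * a\<^sup>2)"
        by linarith
      then show ?thesis
        by (simp add: a_def b_def distrib_right)
    qed
    then have "(LINT x|lborel. \<bar>r x\<bar>) \<le> (LINT x|lborel. (K + 1) * (u (x + y) - u x)\<^sup>2 + (L\<^sup>2 * (norm y)\<^sup>2) * (u x)\<^sup>2)"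
      using ir dL2 uL2 by (intro integral_mono) (auto simp: L2_iff_real)
    also have "\<dots> = (K + 1) * (LINT x|lborel. (u (x + y) - u x)\<^sup>2) + (L\<^sup>2 * (norm y)\<^sup>2) * U"
      unfolding U_def using dL2 uL2 by (subst Bochner_Integration.integral_add) (auto simp: L2_iff_real)
    also have "\<dots> \<le> (K + 1) * (C * (norm y)\<^sup>2) + (L\<^sup>2 * (norm y)\<^sup>2) * U"
      using C K0 by (intro add_mono mult_left_mono) auto
    finally have "(LINT x|lborel. \<bar>r x\<bar>) \<le> ((K + 1) * C + L\<^sup>2 * U) * (norm y)\<^sup>2"
      by (simp add: algebra_simps)
    then show ?thesis
      unfolding eq using integral_abs_bound[of lborel r] by linarith
  qed
  then show ?thesis by blast
qed

text \<open>Difference quotients of \<open>V\<close> along \<open>e\<close> are dominated through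
  the Lipschitz bound, so their weighted integrals converge to the left-hand side. The quadratic
  estimate divided by the step size sends the same integrals to zero.\<close>

lemma weak_solution_gradient_identity:
  fixes u V :: "real ^ 'n \<Rightarrow> real"
  assumes s: "0 < s" and p: "1 < p" and \<epsilon>: "0 < \<epsilon>"
    and sol: "weak_solution s p V \<epsilon> u" and cu: "continuous_on UNIV u"
    and M: "\<And>x. 0 < u x" "\<And>x. u x \<le> M"
    and G: "\<And>x. GDERIV V x :> G x" and cG: "continuous_on UNIV G"
    and VB: "\<And>x. \<bar>V x\<bar> \<le> B" and VL: "\<And>x y. \<bar>V (x + y) - V x\<bar> \<le> L * norm y"
  shows "(LINT x|lborel. (e \<bullet> G x) * (u x)\<^sup>2) = 0"
proof -
  have uL2: "u \<in> L2"
    using sol by (auto simp: weak_solution_def intro: Hs_L2)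
  have [measurable]: "u \<in> borel_measurable borel"
    using uL2 by (rule L2_measurable)
  have "continuous_on UNIV V"
    using G by (auto simp: gderiv_def continuous_on_eq_continuous_at intro: has_derivative_continuous)
  then have Vm [measurable]: "V \<in> borel_measurable borel"
    by (rule borel_measurable_continuous_onI)
  have [measurable]: "G \<in> borel_measurable borel"
    using cG by (rule borel_measurable_continuous_onI)
  obtain C where C: "\<And>y. \<bar>LINT x|lborel. (V (x + y) - V x) * (u x)\<^sup>2\<bar> \<le> C * (norm y)\<^sup>2"
    using weak_solution_potential_difference_bound[OF s p \<epsilon> sol cu M Vm VB VL] by auto
  define t where "t n = 1 / real (Suc n)" for n
  have t: "0 < t n" for n by (simp add: t_def)
  have t0: "t \<longlonglongrightarrow> 0" unfolding t_def by real_asymp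
  have deriv: "(\<lambda>n. (V (x + t n *\<^sub>R e) - V x) / t n) \<longlonglongrightarrow> e \<bullet> G x" for x
  proof -
    have "((\<lambda>r. V (x + r *\<^sub>R e)) has_derivative (\<lambda>r. (r *\<^sub>R e) \<bullet> G x)) (at 0)"
    proof -
      have 1: "((\<lambda>r. x + r *\<^sub>R e) has_derivative (\<lambda>r. r *\<^sub>R e)) (at 0)"
        by (auto intro!: derivative_eq_intros)
      have 2: "(V has_derivative (\<lambda>h. h \<bullet> G x)) (at (x + 0 *\<^sub>R e))"
        using G[of x] by (simp add: gderiv_def)
      show ?thesis
        by (rule has_derivative_compose[OF 1 2])
    qed
    then have "((\<lambda>r. V (x + r *\<^sub>R e)) has_real_derivative (e \<bullet> G x)) (at 0)"
      by (simp add: has_field_derivative_def mult_commute_abs)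
    then have "(\<lambda>h. (V (x + h *\<^sub>R e) - V x) / h) \<midarrow>0\<rightarrow> e \<bullet> G x"
      by (simp add: DERIV_def)
    moreover have "filterlim t (at 0) sequentially"
      using t0 t by (auto simp: filterlim_at intro!: always_eventually) (metis less_irrefl)
    ultimately show ?thesis
      by (rule filterlim_compose)
  qed
  define I where "I n = (LINT x|lborel. (V (x + t n *\<^sub>R e) - V x) / t n * (u x)\<^sup>2)" for n
  have "I \<longlonglongrightarrow> (LINT x|lborel. (e \<bullet> G x) * (u x)\<^sup>2)"
    unfolding I_def
  proof (rule integral_dominated_convergence[where w = "\<lambda>x. \<bar>L * norm e\<bar> * (u x)\<^sup>2"])
    show "integrable lborel (\<lambda>x. \<bar>L * norm e\<bar> * (u x)\<^sup>2)"
      using uL2 by (simp add: L2_iff_real)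
    show "AE x in lborel. (\<lambda>n. (V (x + t n *\<^sub>R e) - V x) / t n * (u x)\<^sup>2) \<longlonglongrightarrow> (e \<bullet> G x) * (u x)\<^sup>2"
      by (intro AE_I2 tendsto_mult_right deriv)
    fix n
    have "\<bar>(V (x + t n *\<^sub>R e) - V x) / t n\<bar> \<le> \<bar>L * norm e\<bar>" for x
    proof -
      have "\<bar>V (x + t n *\<^sub>R e) - V x\<bar> \<le> \<bar>L * norm e\<bar> * t n"
      proof -
        have "\<bar>V (x + t n *\<^sub>R e) - V x\<bar> \<le> L * norm (t n *\<^sub>R e)"
          by (rule VL)
        also have "\<dots> = (L * norm e) * t n"
          using t[of n] by simp
        also have "\<dots> \<le> \<bar>L * norm e\<bar> * t n"
          using t[of n] by (intro mult_right_mono) auto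
        finally show ?thesis .
      qed
      then show ?thesis
        using t[of n] by (simp add: divide_le_eq)
    qed
    then have "\<bar>(V (x + t n *\<^sub>R e) - V x) / t n\<bar> * (u x)\<^sup>2 \<le> \<bar>L * norm e\<bar> * (u x)\<^sup>2" for x
      by (rule mult_right_mono) simp
    then show "AE x in lborel. norm ((V (x + t n *\<^sub>R e) - V x) / t n * (u x)\<^sup>2) \<le> \<bar>L * norm e\<bar> * (u x)\<^sup>2"
      by (simp add: abs_mult)
  qed measurable
  moreover have "I \<longlonglongrightarrow> 0"
  proof (rule Lim_null_comparison)
    show "eventually (\<lambda>n. norm (I n) \<le> C * (norm e)\<^sup>2 * t n) sequentially"
    proof (intro always_eventually allI)
      fix n
      have "I n = (LINT x|lborel. (V (x + t n *\<^sub>R e) - V x) * (u x)\<^sup>2) / t n"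
        by (simp add: I_def)
      then have "norm (I n) \<le> C * (norm (t n *\<^sub>R e))\<^sup>2 / t n"
        using C[of "t n *\<^sub>R e"] t[of n] by (simp add: divide_right_mono)
      also have "\<dots> = C * (norm e)\<^sup>2 * t n"
        using t[of n] by (simp add: power2_eq_square)
      finally show "norm (I n) \<le> C * (norm e)\<^sup>2 * t n" .
    qed
    show "(\<lambda>n. C * (norm e)\<^sup>2 * t n) \<longlonglongrightarrow> 0"
      using tendsto_mult_right_zero[OF t0] by simp
  qed
  ultimately show ?thesis
    by (rule LIMSEQ_unique)
qed

section \<open>Concentration of mass\<close>

text \<open>In the equation tested with the squared cutoff times \<open>u\<close>, the coefficient
  \<open>u x powr (p - 1) - V x\<close> is at most \<open>- v0 / 2\<close> on the support of the
  cutoff, while the nonlocal side is at least \<open>- C * \<epsilon> powr (2 * s)\<close> times the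
  square norm. The quantifier order is essential: one constant serves every \<epsilon> and every
  solution.\<close>

lemma weak_solution_outer_mass:
  fixes \<rho> V :: "real ^ 'n \<Rightarrow> real"
  assumes s: "0 < s" "s < 1" and p: "1 < p" and \<rho>: "cutoff L \<rho>" and v0: "0 < v0"
    and V: "\<And>x. v0 \<le> V x" "\<And>x. V x \<le> B" and [measurable]: "V \<in> borel_measurable borel"
  shows "\<exists>C\<ge>0. \<forall>\<epsilon> u. weak_solution s p V \<epsilon> u \<and> continuous_on UNIV u \<and> (\<forall>x. 0 < u x)
     \<and> bounded (range u) \<and> (\<forall>x. \<rho> x \<noteq> 0 \<longrightarrow> u x powr (p - 1) \<le> v0 / 2)
     \<longrightarrow> (LINT x|lborel. (\<rho> x)\<^sup>2 * (u x)\<^sup>2) \<le> C * \<epsilon> powr (2 * s) * (LINT x|lborel. (u x)\<^sup>2)"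
proof -
  obtain C where C: "\<And>u. u \<in> Hs s \<Longrightarrow> continuous_on UNIV u \<Longrightarrow> (\<lambda>x. (\<rho> x)\<^sup>2 * u x) \<in> Hs s \<and>
     - C * (LINT x|lborel. (u x)\<^sup>2) \<le> Re (LINT \<xi>|lborel. complex_of_real (norm \<xi> powr (2 * s)) * fourier u \<xi> * cnj (fourier (\<lambda>x. (\<rho> x)\<^sup>2 * u x) \<xi>))"
    using fractional_pairing_cutoff[OF s \<rho>] by blast
  show ?thesis
  \<comment> \<open>The factor \<open>2 / v0\<close> removes the coercivity constant
    \<open>v0 / 2\<close>; the absolute value ensures the nonnegativity demanded of the
    witness.\<close>
  proof (intro exI[of _ "2 * \<bar>C\<bar> / v0"] conjI allI impI)
    show "0 \<le> 2 * \<bar>C\<bar> / v0" using v0 by simp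
    fix \<epsilon> :: real and u :: "real ^ 'n \<Rightarrow> real"
    assume "weak_solution s p V \<epsilon> u \<and> continuous_on UNIV u \<and> (\<forall>x. 0 < u x)
     \<and> bounded (range u) \<and> (\<forall>x. \<rho> x \<noteq> 0 \<longrightarrow> u x powr (p - 1) \<le> v0 / 2)"
    then have sol: "weak_solution s p V \<epsilon> u" and cu: "continuous_on UNIV u" and pos: "\<And>x. 0 < u x"
      and bdd: "bounded (range u)" and small: "\<And>x. \<rho> x \<noteq> 0 \<Longrightarrow> u x powr (p - 1) \<le> v0 / 2"
      by auto
    obtain M where M: "\<And>x. u x \<le> M"
      using bdd by (auto simp: bounded_iff abs_le_iff)
    have u: "u \<in> Hs s" and uL2: "u \<in> L2"
      using sol by (auto simp: weak_solution_def intro: Hs_L2)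
    define U where "U = (LINT x|lborel. (u x)\<^sup>2)"
    have U0: "0 \<le> U" by (simp add: U_def)
    define \<phi> where "\<phi> = (\<lambda>x. (\<rho> x)\<^sup>2 * u x)"
    have \<phi>L2: "\<phi> \<in> L2"
      unfolding \<phi>_def by (rule cutoff_mult_L2[OF uL2 \<rho>])
    define P where "P = (LINT \<xi>|lborel. complex_of_real (norm \<xi> powr (2 * s)) * fourier u \<xi> * cnj (fourier \<phi> \<xi>))"
    have \<phi>: "\<phi> \<in> Hs s" and P: "- C * U \<le> Re P"
      using C[OF u cu] by (simp_all add: \<phi>_def P_def U_def)
    define f where "f x = u x powr p - V x * u x" for x
    have VB: "\<bar>V x\<bar> \<le> B" for x
      using V[of x] v0 by linarith
    have fL2: "f \<in> L2"
      unfolding f_def using bounded_weak_solution_nonlinearity_L2[OF uL2 pos M p _ VB] by simp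
    have "complex_of_real (\<epsilon> powr (2 * s)) * P = complex_of_real (LINT x|lborel. f x * \<phi> x)"
      using sol \<phi> unfolding weak_solution_def P_def f_def by blast
    then have "Re (complex_of_real (\<epsilon> powr (2 * s)) * P) = (LINT x|lborel. f x * \<phi> x)"
      by simp
    then have eq: "\<epsilon> powr (2 * s) * Re P = (LINT x|lborel. f x * \<phi> x)"
      by simp
    have int: "integrable lborel (\<lambda>x. (\<rho> x)\<^sup>2 * (u x)\<^sup>2)"
      using L2_mult_integrable[OF \<phi>L2 uL2] by (simp add: \<phi>_def power2_eq_square mult.assoc)
    have "f x * \<phi> x \<le> - (v0 / 2) * ((\<rho> x)\<^sup>2 * (u x)\<^sup>2)" for x
    proof (cases "\<rho> x = 0")
      case False
      have "u x powr p = u x powr (p - 1) * u x"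
        using powr_add[of "u x" "p - 1" 1] pos[of x] by simp
      then have "f x * \<phi> x = (u x powr (p - 1) - V x) * ((\<rho> x)\<^sup>2 * (u x)\<^sup>2)"
        by (simp add: f_def \<phi>_def power2_eq_square algebra_simps)
      also have "\<dots> \<le> - (v0 / 2) * ((\<rho> x)\<^sup>2 * (u x)\<^sup>2)"
        using small[OF False] V(1)[of x] by (intro mult_right_mono) auto
      finally show ?thesis .
    qed (simp add: \<phi>_def)
    then have "(LINT x|lborel. f x * \<phi> x) \<le> (LINT x|lborel. - (v0 / 2) * ((\<rho> x)\<^sup>2 * (u x)\<^sup>2))"
      using int L2_mult_integrable[OF fL2 \<phi>L2] by (intro integral_mono) auto
    also have "\<dots> = - (v0 / 2) * (LINT x|lborel. (\<rho> x)\<^sup>2 * (u x)\<^sup>2)"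
      by simp
    finally have "v0 / 2 * (LINT x|lborel. (\<rho> x)\<^sup>2 * (u x)\<^sup>2) \<le> - (\<epsilon> powr (2 * s) * Re P)"
      using eq by linarith
    also have "\<dots> \<le> \<epsilon> powr (2 * s) * (\<bar>C\<bar> * U)"
    proof -
      have "- Re P \<le> \<bar>C\<bar> * U"
        using P mult_right_mono[OF abs_ge_self[of C] U0] by linarith
      from mult_left_mono[OF this powr_ge_zero[of \<epsilon> "2 * s"]] show ?thesis by simp
    qed
    finally show "(LINT x|lborel. (\<rho> x)\<^sup>2 * (u x)\<^sup>2) \<le> 2 * \<bar>C\<bar> / v0 * \<epsilon> powr (2 * s) * (LINT x|lborel. (u x)\<^sup>2)"
      using v0 by (simp add: field_simps U_def)
  qed
qed

text \<open>This function is 0 up to distance \<open>r / 2\<close> from the centre and 1 from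
  distance \<open>r\<close> on. Clamping to the unit interval does not increase increments, so the
  slope \<open>2 / r\<close> of the radial ramp is a Lipschitz constant.\<close>

lemma radial_cutoff:
  assumes "0 < r"
  shows "cutoff (2 / r) (\<lambda>x::'a::euclidean_space. max 0 (min 1 (2 * dist x x0 / r - 1)))"
  unfolding cutoff_def
proof (intro conjI allI lipschitz_onI)
  fix x y :: 'a
  have "dist (max 0 (min 1 (2 * dist x x0 / r - 1))) (max 0 (min 1 (2 * dist y x0 / r - 1)))
    \<le> \<bar>(2 * dist x x0 / r - 1) - (2 * dist y x0 / r - 1)\<bar>"
    by (auto simp: dist_real_def max_def min_def abs_if)
  also have "\<dots> = 2 / r * \<bar>dist x x0 - dist y x0\<bar>"
  proof -
    have "(2 * dist x x0 / r - 1) - (2 * dist y x0 / r - 1) = 2 / r * (dist x x0 - dist y x0)"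
      by (simp add: diff_divide_distrib right_diff_distrib)
    then show ?thesis
      using assms by (simp only: abs_mult) simp
  qed
  also have "\<dots> \<le> 2 / r * dist x y"
    using assms abs_dist_diff_le[of x x0 y] by (intro mult_left_mono) (auto simp: dist_commute)
  finally show "dist (max 0 (min 1 (2 * dist x x0 / r - 1))) (max 0 (min 1 (2 * dist y x0 / r - 1))) \<le> 2 / r * dist x y" .
qed (use assms in auto)

text \<open>Compactness supplies the bound inside the ball. Applied to a solution it yields the
  bound that the gradient identity assumes; that bound may vary along the sequence.\<close>

lemma bounded_outside_ball_imp_bounded:
  fixes u :: "'a::euclidean_space \<Rightarrow> real"
  assumes "continuous_on UNIV u" "\<And>x. x \<notin> ball c R \<Longrightarrow> \<bar>u x\<bar> \<le> \<delta>"
  shows "bounded (range u)"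
proof -
  have "bounded (u ` cball c R)"
    by (intro compact_imp_bounded compact_continuous_image continuous_on_subset[OF assms(1)]) auto
  moreover have "bounded (u ` (- ball c R))"
    using assms(2) by (auto simp: bounded_iff intro!: exI[of _ \<delta>])
  moreover have "range u = u ` cball c R \<union> u ` (- ball c R)"
    using ball_subset_cball[of c R] by auto
  ultimately show ?thesis by simp
qed

theorem theorem1p1:
  fixes s p :: real
    and V :: "real ^ 'n \<Rightarrow> real"
    and x0 :: "real ^ 'n"
    and \<epsilon> :: "nat \<Rightarrow> real"
    and u :: "nat \<Rightarrow> real ^ 'n \<Rightarrow> real"
  assumes "0 < s" and "s < 1"
    and "real CARD('n) > 2 * s"
    and "1 < p" and "p < (real CARD('n) + 2 * s) / (real CARD('n) - 2 * s)"
    and "finite_C2_norm V"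
    and "(INF x. V x) > 0"
    and "\<And>k. \<epsilon> k > 0" and "\<epsilon> \<longlonglongrightarrow> 0"
    and "\<And>k. weak_solution s p V (\<epsilon> k) (u k)"
    and "\<And>k. continuous_on UNIV (u k)"
    and "\<And>k x. u k x > 0"
    and "strongly_concentrates \<epsilon> u x0"
  shows "GDERIV V x0 :> 0"
proof -
  note s = assms(1,2) and p = assms(4) and \<epsilon> = assms(8,9) and sol = assms(10) and cu = assms(11) and pos = assms(12)
  obtain G H where G: "\<And>x. GDERIV V x :> G x"
    and dG: "\<And>x. (G has_derivative (\<lambda>h. (H :: real ^ 'n \<Rightarrow> real ^ 'n ^ 'n) x *v h)) (at x)"
    and bV: "bounded (range V)" and bG: "bounded (range G)"
    using assms(6) unfolding finite_C2_norm_def by blast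
  have dV: "(V has_derivative (\<lambda>h. h \<bullet> G x)) (at x)" for x
    using G[of x] by (simp add: gderiv_def)
  have cG: "continuous_on UNIV G"
    using dG by (auto simp: continuous_on_eq_continuous_at intro: has_derivative_continuous)
  have cV: "continuous_on UNIV V"
    using dV by (auto simp: continuous_on_eq_continuous_at intro: has_derivative_continuous)
  obtain B where B: "\<And>x. \<bar>V x\<bar> \<le> B"
    using bV by (auto simp: bounded_iff)
  obtain L where L: "\<And>x. norm (G x) \<le> L"
    using bG by (auto simp: bounded_iff)
  have VL: "\<bar>V (x + y) - V x\<bar> \<le> L * norm y" for x y
  proof -
    have "norm (V (x + y) - V x) \<le> L * norm (x + y - x)"
    proof (rule differentiable_bound[of UNIV V "\<lambda>z h. h \<bullet> G z"])
      show "onorm (\<lambda>h. h \<bullet> G z) \<le> L" for z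
      proof (rule onorm_le)
        fix h
        have "norm (h \<bullet> G z) \<le> norm h * norm (G z)"
          using Cauchy_Schwarz_ineq2[of h "G z"] by simp
        also have "\<dots> \<le> norm h * L"
          by (intro mult_left_mono L) simp
        finally show "norm (h \<bullet> G z) \<le> L * norm h"
          by (simp add: mult.commute)
      qed
    qed (use dV in auto)
    then show ?thesis by simp
  qed
  define v0 where "v0 = (INF x. V x)"
  have v0: "0 < v0"
    using assms(7) by (simp add: v0_def)
  have Vv0: "v0 \<le> V x" for x
    unfolding v0_def using bV by (intro cINF_lower bounded_imp_bdd_below) auto
  have Vm: "V \<in> borel_measurable borel"
    using cV by (rule borel_measurable_continuous_onI)
  have Gm [measurable]: "G \<in> borel_measurable borel"
    using cG by (rule borel_measurable_continuous_onI)
  have "G x0 = 0"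
  proof (rule ccontr)
    assume "G x0 \<noteq> 0"
    \<comment> \<open>With this direction \<open>m\<close> is the squared length of the gradient,
      and near \<open>x0\<close> the integrand of the gradient identity is at least
      \<open>m / 2\<close> times the squared solution.\<close>
    define e where "e = G x0"
    define m where "m = e \<bullet> G x0"
    have m: "0 < m"
      using \<open>G x0 \<noteq> 0\<close> by (simp add: m_def e_def)
    have "isCont (\<lambda>x. e \<bullet> G x) x0"
      using cG by (auto simp: continuous_on_eq_continuous_at intro!: continuous_intros)
    then have "\<exists>r>0. \<forall>x. dist x x0 < r \<longrightarrow> dist (e \<bullet> G x) (e \<bullet> G x0) < m / 2"
      using half_gt_zero[OF m] unfolding continuous_at_eps_delta by blast
    then obtain r where r: "0 < r" "\<And>x. dist x x0 < r \<Longrightarrow> \<bar>e \<bullet> G x - m\<bar> < m / 2"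
      unfolding m_def dist_real_def by blast
    define \<rho> where "\<rho> x = max 0 (min 1 (2 * dist x x0 / r - 1))" for x
    have \<rho>: "cutoff (2 / r) \<rho>"
      unfolding \<rho>_def by (rule radial_cutoff[OF r(1)])
    have \<rho>1: "\<rho> x = 1" if "r \<le> dist x x0" for x
      using that r(1) by (simp add: \<rho>_def field_simps)
    have \<rho>0: "r / 2 < dist x x0" if "\<rho> x \<noteq> 0" for x
    proof (rule ccontr)
      assume "\<not> r / 2 < dist x x0"
      then have "2 * dist x x0 / r - 1 \<le> 0"
        using r(1) by (simp add: field_simps)
      then have "\<rho> x = 0"
        unfolding \<rho>_def by linarith
      with that show False by simp
    qed
    obtain C where C0: "0 \<le> C" and C: "\<And>\<epsilon> u. weak_solution s p V \<epsilon> u \<Longrightarrow> continuous_on UNIV u \<Longrightarrow> (\<And>x. 0 < u x)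
     \<Longrightarrow> bounded (range u) \<Longrightarrow> (\<And>x. \<rho> x \<noteq> 0 \<Longrightarrow> u x powr (p - 1) \<le> v0 / 2)
     \<Longrightarrow> (LINT x|lborel. (\<rho> x)\<^sup>2 * (u x)\<^sup>2) \<le> C * \<epsilon> powr (2 * s) * (LINT x|lborel. (u x)\<^sup>2)"
    proof -
      have "V x \<le> B" for x
        using B[of x] by simp
      from weak_solution_outer_mass[OF s p \<rho> v0 Vv0 this Vm] that show thesis
        by blast
    qed
    \<comment> \<open>Chosen so that \<open>\<delta> powr (p - 1)\<close> is exactly the threshold
      \<open>v0 / 2\<close> of the outer mass estimate.\<close>
    define \<delta> where "\<delta> = (v0 / 2) powr (1 / (p - 1))"
    have \<delta>: "0 < \<delta>" "\<delta> powr (p - 1) = v0 / 2"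
      using v0 p by (simp_all add: \<delta>_def powr_powr)
    obtain \<epsilon>0 R where \<epsilon>0: "0 < \<epsilon>0" and R: "0 < R"
      and conc: "\<And>k x. \<epsilon> k \<in> {0<..<\<epsilon>0} \<Longrightarrow> x \<notin> ball x0 (\<epsilon> k * R) \<Longrightarrow> u k x \<le> \<delta>"
    proof -
      have "\<exists>\<epsilon>0>0. \<exists>R>0. \<forall>k. \<epsilon> k \<in> {0<..<\<epsilon>0} \<longrightarrow> (\<forall>x \<in> - ball x0 (\<epsilon> k * R). u k x \<le> \<delta>)"
        using assms(13) \<delta>(1) unfolding strongly_concentrates_def by blast
      then show thesis
        using that by (metis ComplI)
    qed
    \<comment> \<open>Any value of at least \<open>m / 2 + norm e * \<bar>L\<bar>\<close> absorbs
      the possibly negative contribution far from \<open>x0\<close>; the summand \<open>m\<close>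
      also makes this one positive.\<close>
    define N where "N = 2 * \<bar>L\<bar> * norm e + m"
    have N: "0 < N" using m by (simp add: N_def add_nonneg_pos)
    have "(\<lambda>k. N * (C * \<epsilon> k powr (2 * s))) \<longlonglongrightarrow> N * (C * 0)"
    proof (intro tendsto_intros)
      show "(\<lambda>k. \<epsilon> k powr (2 * s)) \<longlonglongrightarrow> 0"
        using tendsto_powr'[OF \<epsilon>(2), of "\<lambda>_. 2 * s" "2 * s"] \<epsilon>(1) s by (auto simp: less_imp_le)
    qed
    then have "eventually (\<lambda>k. N * (C * \<epsilon> k powr (2 * s)) < m / 2) sequentially"
      using m by (intro order_tendstoD(2)[of _ "N * (C * 0)"]) auto
    moreover have "eventually (\<lambda>k. \<epsilon> k < \<epsilon>0) sequentially"
      using order_tendstoD(2)[OF \<epsilon>(2)] \<epsilon>0 by blast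
    \<comment> \<open>This places the concentration ball of radius \<open>\<epsilon> k * R\<close>
      inside the region where \<rho> vanishes, so the solution is at most \<delta> wherever \<rho>
      does not vanish.\<close>
    moreover have "eventually (\<lambda>k. \<epsilon> k < r / (2 * R)) sequentially"
      using order_tendstoD(2)[OF \<epsilon>(2), of "r / (2 * R)"] r(1) R by simp
    ultimately have "eventually (\<lambda>k. N * (C * \<epsilon> k powr (2 * s)) < m / 2 \<and> \<epsilon> k < \<epsilon>0 \<and> \<epsilon> k < r / (2 * R)) sequentially"
      by eventually_elim auto
    then obtain k where k: "N * (C * \<epsilon> k powr (2 * s)) < m / 2" "\<epsilon> k < \<epsilon>0" "\<epsilon> k < r / (2 * R)"
      by (auto simp: eventually_sequentially)
    define w where "w = u k"
    have w: "weak_solution s p V (\<epsilon> k) w" "continuous_on UNIV w" "\<And>x. 0 < w x"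
      using sol cu pos by (auto simp: w_def)
    have out: "w x \<le> \<delta>" if "x \<notin> ball x0 (\<epsilon> k * R)" for x
      unfolding w_def using conc[of k x] that \<epsilon>(1)[of k] k(2) by simp
    have bw: "bounded (range w)"
      using out w(3) by (intro bounded_outside_ball_imp_bounded[OF w(2), of x0 "\<epsilon> k * R" \<delta>]) (auto simp: abs_of_pos)
    then obtain M where M: "\<And>x. w x \<le> M"
      by (auto simp: bounded_iff abs_le_iff)
    have wL2: "w \<in> L2"
      using w(1) by (auto simp: weak_solution_def intro: Hs_L2)
    have [measurable]: "w \<in> borel_measurable borel" "\<rho> \<in> borel_measurable borel"
      using L2_measurable[OF wL2] cutoff_continuous[OF \<rho>] by (auto intro: borel_measurable_continuous_onI)
    define U where "U = (LINT x|lborel. (w x)\<^sup>2)"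
    have iw: "integrable lborel (\<lambda>x. (w x)\<^sup>2)"
      using wL2 by (simp add: L2_iff_real)
    \<comment> \<open>Strict positivity is needed to turn the smallness of
      \<open>N * (C * \<epsilon> k powr (2 * s))\<close> into a strict inequality between
      masses.\<close>
    have U: "0 < U"
    proof -
      have "U \<noteq> 0"
      proof
        assume "U = 0"
        then have "AE x in lborel. (w x)\<^sup>2 = 0"
          using integral_nonneg_eq_0_iff_AE[OF iw] by (simp add: U_def)
        then have "AE x in (lborel :: (real ^ 'n) measure). False"
          by eventually_elim (metis less_irrefl w(3) zero_eq_power2)
        then show False
          by (simp add: eventually_False ae_filter_eq_bot_iff)
      qed
      moreover have "0 \<le> U" by (simp add: U_def)
      ultimately show ?thesis by linarith
    qed
    have mass: "(LINT x|lborel. (\<rho> x)\<^sup>2 * (w x)\<^sup>2) \<le> C * \<epsilon> k powr (2 * s) * U"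
      unfolding U_def
    proof (rule C[OF w bw])
      fix x assume "\<rho> x \<noteq> 0"
      then have "r / 2 < dist x x0" by (rule \<rho>0)
      moreover have "\<epsilon> k * R < r / 2"
        using k(3) R by (simp add: field_simps)
      ultimately have "w x \<le> \<delta>"
        by (intro out) (simp add: dist_commute)
      then have "w x powr (p - 1) \<le> \<delta> powr (p - 1)"
        using w(3)[of x] p by (intro powr_mono2) auto
      then show "w x powr (p - 1) \<le> v0 / 2"
        by (simp add: \<delta>(2))
    qed
    have zero: "(LINT x|lborel. (e \<bullet> G x) * (w x)\<^sup>2) = 0"
      by (rule weak_solution_gradient_identity[OF s(1) p \<epsilon>(1) w(1,2) w(3) M G cG B VL])
    have eG: "\<bar>e \<bullet> G x\<bar> \<le> norm e * \<bar>L\<bar>" for x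
      using Cauchy_Schwarz_ineq2[of e "G x"] mult_left_mono[OF order_trans[OF L[of x] abs_ge_self[of L]] norm_ge_zero[of e]] by linarith
    have i1: "integrable lborel (\<lambda>x. (e \<bullet> G x) * (w x)\<^sup>2)"
      by (rule Bochner_Integration.integrable_bound[OF integrable_mult_right[OF iw, of "norm e * \<bar>L\<bar>"]])
        (use eG in \<open>auto simp: abs_mult intro!: mult_right_mono\<close>)
    have i2: "integrable lborel (\<lambda>x. (\<rho> x)\<^sup>2 * (w x)\<^sup>2)"
    proof -
      have "\<bar>(\<rho> x)\<^sup>2\<bar> \<le> 1" for x
        using \<rho> by (simp add: cutoff_def power_le_one)
      then show ?thesis
        by (intro Bochner_Integration.integrable_bound[OF iw]) (auto simp: abs_mult intro!: mult_left_le_one_le)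
    qed
    \<comment> \<open>Within distance \<open>r\<close> the lower bound \<open>m / 2\<close> suffices
      and the subtracted term only helps; beyond it \<rho> equals 1 and \<open>N\<close> takes over.
      Integrating against the gradient identity bounds the total mass by the outer mass.\<close>
    have "m / 2 * (w x)\<^sup>2 - N * ((\<rho> x)\<^sup>2 * (w x)\<^sup>2) \<le> (e \<bullet> G x) * (w x)\<^sup>2" for x
    proof -
      have "m / 2 - N * (\<rho> x)\<^sup>2 \<le> e \<bullet> G x"
      proof (cases "dist x x0 < r")
        case True
        then have "m / 2 \<le> e \<bullet> G x"
          using r(2)[OF True] by linarith
        moreover have "0 \<le> N * (\<rho> x)\<^sup>2" using N by simp
        ultimately show ?thesis by linarith
      next
        case False
        then have "\<rho> x = 1" by (intro \<rho>1) simp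
        moreover have "0 \<le> norm e * \<bar>L\<bar>" by simp
        ultimately show ?thesis
          using eG[of x] m unfolding N_def by (simp add: algebra_simps)
      qed
      from mult_right_mono[OF this, of "(w x)\<^sup>2"] show ?thesis
        by (simp add: algebra_simps)
    qed
    then have "(LINT x|lborel. m / 2 * (w x)\<^sup>2 - N * ((\<rho> x)\<^sup>2 * (w x)\<^sup>2)) \<le> (LINT x|lborel. (e \<bullet> G x) * (w x)\<^sup>2)"
      using iw i1 i2 by (intro integral_mono) auto
    then have "m / 2 * U \<le> N * (LINT x|lborel. (\<rho> x)\<^sup>2 * (w x)\<^sup>2)"
      using iw i2 zero by (simp add: U_def)
    also have "\<dots> \<le> N * (C * \<epsilon> k powr (2 * s) * U)"
      using N mass by (intro mult_left_mono) auto
    also have "\<dots> = N * (C * \<epsilon> k powr (2 * s)) * U"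
      by simp
    also have "\<dots> < m / 2 * U"
      using k(1) U by (rule mult_strict_right_mono)
    finally show False by simp
  qed
  then show ?thesis
    using G[of x0] by simp
qed

end
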